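(* Let $\Omega\subset\mathbb{R}^d$ be convex and compact, let $m>d/2$, and let $\Phi$ be the Matérn kernel with smoothness parameter $\nu=m-d/2$ and scale parameter $\phi>0$. Let $f\in\mathcal{N}_\Phi(\Omega)$ and let $f_e\in\mathcal{N}_\Phi(\mathbb{R}^d)$ denote its canonical extension. Then the integral equation $$f(x)=\int_\Omega \Phi(x-t)\,v(t)\,dt,\qquad x\in\Omega,$$ has a solution $v\in L_2(\Omega)$ if and only if $f_e\in H^{2m}(\mathbb{R}^d)$.
   Context: The Matérn kernel is $\Phi(x;\nu,\phi)=\frac{1}{\Gamma(\nu)2^{\nu-1}}(2\sqrt{\nu}\phi|x|)^\nu K_\nu(2\sqrt{\nu}\phi|x|)$ for $x\in\mathbb{R}^d$, where $K_\nu$ is the modified Bessel function of the second kind. For $D\subseteq\mathbb{R}^d$, the reproducing kernel Hilbert space $\mathcal{N}_\Phi(D)$ is the completion of $F_\Phi(D)=\{\sum_{i=1}^n\beta_i\Phi(\cdot-x_i):\beta_i\in\mathbb{R},x_i\in D,n\in\mathbb{N}\}$ (functions on $D$) under the inner product $\langle\sum_i\beta_i\Phi(\cdot-x_i),\sum_j\gamma_j\Phi(\cdot-x'_j)\rangle=\sum_{i,j}\beta_i\gamma_j\Phi(x_i-x'_j)$. The canonical extension: the map sending $\sum_i\beta_i\Phi(x-x_i)$, $x\in\Omega$, to the same expression for $x\in\mathbb{R}^d$ is an inner-product-preserving map $F_\Phi(\Omega)\to F_\Phi(\mathbb{R}^d)$; it extends by continuity to an isometry $\mathcal{N}_\Phi(\Omega)\to\mathcal{N}_\Phi(\mathbb{R}^d)$,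 $h\mapsto h_e$, with $h_e|_\Omega=h$. $H^{2m}(\mathbb{R}^d)$ is the (fractional) Sobolev space. *)

theory Defs
  imports "HOL-Analysis.Analysis"
begin

text \<open>Modified Bessel function of the second kind, via the standard integral
  representation K_nu(z) = int_0^infty exp(-z cosh t) cosh(nu t) dt, for z > 0.\<close>
definition besselK :: "real \<Rightarrow> real \<Rightarrow> real" where
  "besselK \<nu> z = (LBINT t=0..\<infinity>. exp (- z * cosh t) * cosh (\<nu> * t))"

text \<open>Matern kernel with smoothness nu and scale phi; value 1 at the origin
  (the continuous extension of the formula).\<close>
definition matern :: "real \<Rightarrow> real \<Rightarrow> 'a::real_normed_vector \<Rightarrow> real" where
  "matern \<nu> \<phi> x =
     (if x = 0 then 1
      else (let r = 2 * sqrt \<nu> * \<phi> * norm x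
            in r powr \<nu> * besselK \<nu> r / (Gamma \<nu> * 2 powr (\<nu> - 1))))"

definition kexp :: "('a::ab_group_add \<Rightarrow> real) \<Rightarrow> (real \<times> 'a) list \<Rightarrow> 'a \<Rightarrow> real" where
  "kexp K c x = (\<Sum>(b, y)\<leftarrow>c. b * K (x - y))"

definition kinner :: "('a::ab_group_add \<Rightarrow> real) \<Rightarrow> (real \<times> 'a) list \<Rightarrow> (real \<times> 'a) list \<Rightarrow> real" where
  "kinner K c c' = (\<Sum>(b, y)\<leftarrow>c. \<Sum>(g, z)\<leftarrow>c'. b * g * K (y - z))"

definition kdist2 :: "('a::ab_group_add \<Rightarrow> real) \<Rightarrow> (real \<times> 'a) list \<Rightarrow> (real \<times> 'a) list \<Rightarrow> real" where
  "kdist2 K c c' = (let d = c @ map (\<lambda>(b, y). (- b, y)) c' in kinner K d d)"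

definition kcauchy :: "('a::ab_group_add \<Rightarrow> real) \<Rightarrow> (nat \<Rightarrow> (real \<times> 'a) list) \<Rightarrow> bool" where
  "kcauchy K s = (\<forall>e>0. \<exists>N. \<forall>m\<ge>N. \<forall>n\<ge>N. kdist2 K (s m) (s n) < e)"

text \<open>Sequences in F_Phi(D) that are Cauchy in the native norm and converge
  pointwise on D to f; the native space N_Phi(D) (the completion of F_Phi(D),
  realised as functions on D) consists of all such pointwise limits.\<close>
definition approx_seq :: "('a::ab_group_add \<Rightarrow> real) \<Rightarrow> 'a set \<Rightarrow> ('a \<Rightarrow> real) \<Rightarrow> (nat \<Rightarrow> (real \<times> 'a) list) \<Rightarrow> bool" where
  "approx_seq K D f s \<longleftrightarrow>
     (\<forall>n. snd ` set (s n) \<subseteq> D) \<and> kcauchy K s \<and>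
     (\<forall>x\<in>D. (\<lambda>n. kexp K (s n) x) \<longlonglongrightarrow> f x)"

definition native_space :: "('a::ab_group_add \<Rightarrow> real) \<Rightarrow> 'a set \<Rightarrow> ('a \<Rightarrow> real) set" where
  "native_space K D = {f. \<exists>s. approx_seq K D f s}"

definition canon_ext :: "('a::ab_group_add \<Rightarrow> real) \<Rightarrow> 'a set \<Rightarrow> ('a \<Rightarrow> real) \<Rightarrow> 'a \<Rightarrow> real" where
  "canon_ext K D f = (let s = (SOME s. approx_seq K D f s) in (\<lambda>x. lim (\<lambda>n. kexp K (s n) x)))"

text \<open>Truncated Fourier integral; the L2 Fourier transform (Plancherel) is the
  L2-limit of these as R tends to infinity.\<close>
definition ft_trunc :: "('a::euclidean_space \<Rightarrow> real) \<Rightarrow> real \<Rightarrow> 'a \<Rightarrow> complex" where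
  "ft_trunc f R \<omega> = (LINT x:ball 0 R|lebesgue. f x *\<^sub>R cis (- (\<omega> \<bullet> x)))"

definition sobolev_space :: "real \<Rightarrow> ('a::euclidean_space \<Rightarrow> real) set" where
  "sobolev_space s = {f. f \<in> borel_measurable lebesgue \<and>
      (\<integral>\<^sup>+ x. ennreal ((f x)\<^sup>2) \<partial>lebesgue) < \<infinity> \<and>
      (\<exists>g :: 'a \<Rightarrow> complex. g \<in> borel_measurable lebesgue \<and>
        (\<integral>\<^sup>+ \<omega>. ennreal ((1 + (norm \<omega>)\<^sup>2) powr s * (cmod (g \<omega>))\<^sup>2) \<partial>lebesgue) < \<infinity> \<and>
        (\<lambda>n. \<integral>\<^sup>+ \<omega>. ennreal ((cmod (g \<omega> - ft_trunc f (real n) \<omega>))\<^sup>2) \<partial>lebesgue)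
          \<longlonglongrightarrow> 0)}"

end

theory Submission
  imports Defs "HOL-Probability.Probability"
begin

text \<open>
  The Matern kernel is a mixture of Gaussians over a Gamma distribution, and so is the function \<open>S\<close>
  whose Fourier transform it is; \<open>S\<close> is comparable to \<open>(1 + |\<omega>|\<^sup>2) powr (- m)\<close>. Hence the native space
  is isometric to a closed subspace of \<open>L\<^sup>2\<close>: the expansion with coefficients \<open>b\<close> and nodes \<open>y\<close>
  corresponds to \<open>sqrt S\<close> times the trigonometric polynomial \<open>\<Sum> b cis (- (\<omega> \<bullet> y))\<close>, and \<open>f\<^sub>e\<close> is the
  inverse Fourier transform of \<open>sqrt S * q\<close> for the \<open>L\<^sup>2\<close>-limit \<open>q\<close>. By Plancherel, \<open>f\<^sub>e\<close> lies in
  \<open>H\<^sup>2\<^sup>m\<close> if and only if \<open>q / sqrt S\<close> lies in \<open>L\<^sup>2\<close>.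

  If \<open>f\<close> agrees on \<open>\<Omega>\<close> with the convolution of the kernel and some \<open>v\<close> supported in \<open>\<Omega>\<close>, then
  \<open>q - sqrt S * v^\<close> is orthogonal to everything that is generated by \<open>\<Omega>\<close>, in particular to itself.
  So \<open>q / sqrt S\<close> is the transform of \<open>v\<close>.

  Conversely, if \<open>q / sqrt S\<close> lies in \<open>L\<^sup>2\<close>, then it is the transform of some \<open>L\<^sup>2\<close> function, whose
  convolution with the kernel is \<open>f\<^sub>e\<close>. That function vanishes outside \<open>\<Omega>\<close>: its pairing with a test
  function \<open>\<psi>\<close> is the inner product of \<open>q\<close> with \<open>\<psi>^ / sqrt S\<close>, hence a limit of combinations of values
  of \<open>\<psi>\<close> on \<open>\<Omega>\<close>.
\<close>

section \<open>Square-integrable functions\<close>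

definition square_integrable :: "'a measure \<Rightarrow> ('a \<Rightarrow> complex) \<Rightarrow> bool" where
  "square_integrable M f \<longleftrightarrow> f \<in> borel_measurable M \<and> integrable M (\<lambda>x. (cmod (f x))\<^sup>2)"

definition L2_norm :: "'a measure \<Rightarrow> ('a \<Rightarrow> complex) \<Rightarrow> real" where
  "L2_norm M f = sqrt (\<integral>x. (cmod (f x))\<^sup>2 \<partial>M)"

definition L2_tendsto :: "'a measure \<Rightarrow> (nat \<Rightarrow> 'a \<Rightarrow> complex) \<Rightarrow> ('a \<Rightarrow> complex) \<Rightarrow> bool" where
  "L2_tendsto M u v \<longleftrightarrow> (\<lambda>n. L2_norm M (\<lambda>x. u n x - v x)) \<longlonglongrightarrow> 0"

definition L2_Cauchy :: "'a measure \<Rightarrow> (nat \<Rightarrow> 'a \<Rightarrow> complex) \<Rightarrow> bool" where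
  "L2_Cauchy M u \<longleftrightarrow> (\<forall>e>0. \<exists>N. \<forall>m\<ge>N. \<forall>n\<ge>N. L2_norm M (\<lambda>x. u m x - u n x) < e)"

lemma borel_measurable_square_integrable [measurable_dest]:
  "square_integrable M f \<Longrightarrow> f \<in> borel_measurable M"
  by (simp add: square_integrable_def)

lemma integrable_norm_square: "square_integrable M f \<Longrightarrow> integrable M (\<lambda>x. (cmod (f x))\<^sup>2)"
  by (simp add: square_integrable_def)

lemma borel_measurable_cnj [measurable]: "cnj \<in> borel_measurable borel"
  by (intro borel_measurable_continuous_onI continuous_intros)

lemma borel_measurable_cis [measurable]: "cis \<in> borel_measurable borel"
  by (intro borel_measurable_continuous_onI continuous_intros)

lemma square_integrable_bound:
  assumes f: "square_integrable M f" and [measurable]: "g \<in> borel_measurable M"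
    and bound: "AE x in M. cmod (g x) \<le> C * cmod (f x)"
  shows "square_integrable M g"
proof -
  have "integrable M (\<lambda>x. (cmod (g x))\<^sup>2)"
  proof (rule Bochner_Integration.integrable_bound)
    show "integrable M (\<lambda>x. C\<^sup>2 * (cmod (f x))\<^sup>2)"
      using integrable_norm_square[OF f] by simp
    show "AE x in M. norm ((cmod (g x))\<^sup>2) \<le> norm (C\<^sup>2 * (cmod (f x))\<^sup>2)"
      using bound
    proof eventually_elim
      case (elim x)
      hence "(cmod (g x))\<^sup>2 \<le> (C * cmod (f x))\<^sup>2" by (intro power_mono) auto
      thus ?case by (simp add: power_mult_distrib)
    qed
  qed simp
  thus ?thesis by (simp add: square_integrable_def)
qed

lemma square_integrable_cong_AE:
  assumes "square_integrable M f" and "g \<in> borel_measurable M" and "AE x in M. f x = g x"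
  shows "square_integrable M g"
  by (rule square_integrable_bound[OF assms(1,2), where C = 1]) (use assms(3) in auto)

lemma square_integrable_mult_left: "square_integrable M f \<Longrightarrow> square_integrable M (\<lambda>x. c * f x)"
  by (rule square_integrable_bound[where C = "cmod c"]) (auto simp: norm_mult)

lemma square_integrable_cnj: "square_integrable M f \<Longrightarrow> square_integrable M (\<lambda>x. cnj (f x))"
  by (rule square_integrable_bound[where C = 1 and f = f]) auto

lemma square_integrable_add:
  assumes f: "square_integrable M f" and g: "square_integrable M g"
  shows "square_integrable M (\<lambda>x. f x + g x)"
proof -
  note [measurable] = f[THEN borel_measurable_square_integrable] g[THEN borel_measurable_square_integrable]
  have "integrable M (\<lambda>x. (cmod (f x + g x))\<^sup>2)"
  proof (rule Bochner_Integration.integrable_bound)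
    show "integrable M (\<lambda>x. 2 * (cmod (f x))\<^sup>2 + 2 * (cmod (g x))\<^sup>2)"
      using integrable_norm_square[OF f] integrable_norm_square[OF g] by simp
    have "(cmod (z + w))\<^sup>2 \<le> 2 * (cmod z)\<^sup>2 + 2 * (cmod w)\<^sup>2" for z w
    proof -
      have "(cmod (z + w))\<^sup>2 \<le> (cmod z + cmod w)\<^sup>2"
        by (intro power_mono norm_triangle_ineq) auto
      also have "\<dots> \<le> 2 * (cmod z)\<^sup>2 + 2 * (cmod w)\<^sup>2"
        using sum_squares_bound[of "cmod z" "cmod w"] by (simp add: power2_sum)
      finally show ?thesis .
    qed
    thus "AE x in M. norm ((cmod (f x + g x))\<^sup>2) \<le> norm (2 * (cmod (f x))\<^sup>2 + 2 * (cmod (g x))\<^sup>2)"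
      by (intro AE_I2) simp
  qed simp
  thus ?thesis by (simp add: square_integrable_def)
qed

lemma square_integrable_diff:
  assumes "square_integrable M f" and "square_integrable M g"
  shows "square_integrable M (\<lambda>x. f x - g x)"
  using square_integrable_add[OF assms(1) square_integrable_mult_left[OF assms(2), of "-1"]] by simp

lemma integrable_bounded_imp_square_integrable:
  assumes f: "integrable M f" and bound: "\<And>x. cmod (f x) \<le> B"
  shows "square_integrable M f"
proof -
  note [measurable] = borel_measurable_integrable[OF f]
  have "integrable M (\<lambda>x. (cmod (f x))\<^sup>2)"
  proof (rule Bochner_Integration.integrable_bound)
    show "integrable M (\<lambda>x. B * cmod (f x))"
      using f by simp
    have "(cmod (f x))\<^sup>2 \<le> B * cmod (f x)" for x
      using mult_right_mono[OF bound[of x], of "cmod (f x)"] by (simp add: power2_eq_square)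
    thus "AE x in M. norm ((cmod (f x))\<^sup>2) \<le> norm (B * cmod (f x))"
      by (intro AE_I2) (auto intro: order_trans[OF _ abs_ge_self])
  qed simp
  thus ?thesis by (simp add: square_integrable_def)
qed

lemma integrable_mult_square_integrable:
  assumes f: "square_integrable M f" and g: "square_integrable M g"
  shows "integrable M (\<lambda>x. f x * g x)"
proof (rule Bochner_Integration.integrable_bound)
  show "integrable M (\<lambda>x. (cmod (f x))\<^sup>2 + (cmod (g x))\<^sup>2)"
    using integrable_norm_square[OF f] integrable_norm_square[OF g] by simp
  show "(\<lambda>x. f x * g x) \<in> borel_measurable M"
    using f g by measurable
  have "a * b \<le> a\<^sup>2 + b\<^sup>2" if "a \<ge> 0" "b \<ge> 0" for a b :: real
    using sum_squares_bound[of a b] mult_nonneg_nonneg[OF that] by linarith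
  thus "AE x in M. norm (f x * g x) \<le> norm ((cmod (f x))\<^sup>2 + (cmod (g x))\<^sup>2)"
    by (intro AE_I2) (simp add: norm_mult)
qed

lemma square_integrable_indicator:
  assumes "A \<in> sets M" and "emeasure M A < \<infinity>"
  shows "square_integrable M (\<lambda>x. complex_of_real (indicator A x))"
  by (rule integrable_bounded_imp_square_integrable[where B = 1]) (use assms in auto)

lemma integrable_indicator_square_integrable:
  assumes "square_integrable M f" and "A \<in> sets M" and "emeasure M A < \<infinity>"
  shows "integrable M (\<lambda>x. indicator A x *\<^sub>R f x)"
  using integrable_mult_square_integrable[OF square_integrable_indicator[OF assms(2,3)] assms(1)]
  by (simp add: scaleR_conv_of_real)

lemma L2_norm_nonneg [simp]: "L2_norm M f \<ge> 0"
  by (simp add: L2_norm_def)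

lemma power2_L2_norm: "(L2_norm M f)\<^sup>2 = (\<integral>x. (cmod (f x))\<^sup>2 \<partial>M)"
  by (simp add: L2_norm_def)

lemma L2_norm_minus_commute: "L2_norm M (\<lambda>x. f x - g x) = L2_norm M (\<lambda>x. g x - f x)"
  by (simp add: L2_norm_def norm_minus_commute)

lemma nn_integral_norm_square:
  "square_integrable M f \<Longrightarrow> (\<integral>\<^sup>+x. ennreal ((cmod (f x))\<^sup>2) \<partial>M) = ennreal ((L2_norm M f)\<^sup>2)"
  unfolding power2_L2_norm by (intro nn_integral_eq_integral integrable_norm_square) auto

lemma square_integrableI_nn_integral:
  assumes "f \<in> borel_measurable M" and "(\<integral>\<^sup>+x. ennreal ((cmod (f x))\<^sup>2) \<partial>M) < \<infinity>"
  shows "square_integrable M f"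
  unfolding square_integrable_def using assms by (auto intro!: integrableI_bounded)

lemma L2_norm_eq_0_iff_AE:
  assumes "square_integrable M f"
  shows "L2_norm M f = 0 \<longleftrightarrow> (AE x in M. f x = 0)"
  using integral_nonneg_eq_0_iff_AE[OF integrable_norm_square[OF assms]] by (simp add: L2_norm_def)

lemma L2_Cauchy_Schwarz:
  assumes f: "square_integrable M f" and g: "square_integrable M g"
  shows "(\<integral>x. cmod (f x * g x) \<partial>M) \<le> L2_norm M f * L2_norm M g"
proof -
  define C where "C = (\<integral>x. cmod (f x * g x) \<partial>M)"
  have "integrable M (\<lambda>x. cmod (f x) * cmod (g x))"
    using integrable_norm[OF integrable_mult_square_integrable[OF f g]] by (simp add: norm_mult)
  hence quadratic: "0 \<le> l\<^sup>2 * (L2_norm M f)\<^sup>2 - 2 * l * C + (L2_norm M g)\<^sup>2" for l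
  proof -
    have "0 \<le> (\<integral>x. (l * cmod (f x) - cmod (g x))\<^sup>2 \<partial>M)" by simp
    also have "\<dots> = (\<integral>x. l\<^sup>2 * (cmod (f x))\<^sup>2 - 2 * l * (cmod (f x) * cmod (g x)) + (cmod (g x))\<^sup>2 \<partial>M)"
      by (intro Bochner_Integration.integral_cong) (auto simp: power2_diff power_mult_distrib)
    also have "\<dots> = l\<^sup>2 * (L2_norm M f)\<^sup>2 - 2 * l * C + (L2_norm M g)\<^sup>2"
      using integrable_norm_square[OF f] integrable_norm_square[OF g]
        \<open>integrable M (\<lambda>x. cmod (f x) * cmod (g x))\<close>
      by (simp add: power2_L2_norm C_def norm_mult)
    finally show ?thesis .
  qed
  show ?thesis
  proof (cases "L2_norm M f = 0")
    case True
    hence "AE x in M. f x = 0" using L2_norm_eq_0_iff_AE[OF f] by simp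
    hence "C = 0" unfolding C_def by (intro integral_eq_zero_AE) auto
    thus ?thesis by (simp add: C_def)
  next
    case False
    hence pos: "L2_norm M f > 0" using L2_norm_nonneg[of M f] by linarith
    have "0 \<le> (C / (L2_norm M f)\<^sup>2)\<^sup>2 * (L2_norm M f)\<^sup>2 - 2 * (C / (L2_norm M f)\<^sup>2) * C + (L2_norm M g)\<^sup>2"
      by (rule quadratic)
    also have "\<dots> = (L2_norm M g)\<^sup>2 - C\<^sup>2 / (L2_norm M f)\<^sup>2"
      using pos by (simp add: field_simps power2_eq_square)
    finally have "C\<^sup>2 \<le> (L2_norm M f * L2_norm M g)\<^sup>2"
      using pos by (simp add: field_simps power_mult_distrib)
    thus ?thesis unfolding C_def by (rule power2_le_imp_le) simp
  qed
qed

lemma norm_integral_mult_le_L2_norm: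
  assumes "square_integrable M f" and "square_integrable M g"
  shows "cmod (\<integral>x. f x * g x \<partial>M) \<le> L2_norm M f * L2_norm M g"
  using integral_norm_bound[of M "\<lambda>x. f x * g x"] L2_Cauchy_Schwarz[OF assms] by linarith

lemma L2_norm_triangle:
  assumes f: "square_integrable M f" and g: "square_integrable M g"
  shows "L2_norm M (\<lambda>x. f x + g x) \<le> L2_norm M f + L2_norm M g"
proof (rule power2_le_imp_le)
  have fg: "integrable M (\<lambda>x. cmod (f x * g x))"
    by (intro integrable_norm integrable_mult_square_integrable f g)
  have "(L2_norm M (\<lambda>x. f x + g x))\<^sup>2 \<le> (\<integral>x. (cmod (f x))\<^sup>2 + 2 * cmod (f x * g x) + (cmod (g x))\<^sup>2 \<partial>M)"
    unfolding power2_L2_norm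
  proof (rule integral_mono)
    show "(cmod (f x + g x))\<^sup>2 \<le> (cmod (f x))\<^sup>2 + 2 * cmod (f x * g x) + (cmod (g x))\<^sup>2" for x
      using power_mono[OF norm_triangle_ineq[of "f x" "g x"], of 2]
      by (simp add: power2_sum norm_mult mult.assoc)
    show "integrable M (\<lambda>x. (cmod (f x))\<^sup>2 + 2 * cmod (f x * g x) + (cmod (g x))\<^sup>2)"
      by (intro Bochner_Integration.integrable_add integrable_mult_right fg integrable_norm_square f g)
  qed (intro integrable_norm_square square_integrable_add f g)
  also have "\<dots> = (L2_norm M f)\<^sup>2 + 2 * (\<integral>x. cmod (f x * g x) \<partial>M) + (L2_norm M g)\<^sup>2"
    using integrable_norm_square[OF f] integrable_norm_square[OF g] fg
    by (simp add: power2_L2_norm)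
  also have "\<dots> \<le> (L2_norm M f + L2_norm M g)\<^sup>2"
    using L2_Cauchy_Schwarz[OF f g] by (simp add: power2_sum)
  finally show "(L2_norm M (\<lambda>x. f x + g x))\<^sup>2 \<le> (L2_norm M f + L2_norm M g)\<^sup>2" .
qed simp

lemma L2_norm_triangle_diff:
  assumes "square_integrable M f" and "square_integrable M g" and "square_integrable M h"
  shows "L2_norm M (\<lambda>x. f x - g x) \<le> L2_norm M (\<lambda>x. h x - f x) + L2_norm M (\<lambda>x. h x - g x)"
  using L2_norm_triangle[of M "\<lambda>x. f x - h x" "\<lambda>x. h x - g x"] assms
  by (simp add: square_integrable_diff L2_norm_minus_commute[of M h f])

lemma L2_tendsto_imp_L2_Cauchy:
  assumes u: "\<And>n. square_integrable M (u n)" and v: "square_integrable M v"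
    and lim: "L2_tendsto M u v"
  shows "L2_Cauchy M u"
  unfolding L2_Cauchy_def
proof (intro allI impI)
  fix e :: real assume "e > 0"
  obtain N where N: "\<And>n. n \<ge> N \<Longrightarrow> L2_norm M (\<lambda>x. u n x - v x) < e / 2"
    using order_tendstoD(2)[OF lim[unfolded L2_tendsto_def], of "e / 2"] \<open>e > 0\<close>
    by (auto simp: eventually_sequentially)
  have "L2_norm M (\<lambda>x. u m x - u n x) < e" if "m \<ge> N" "n \<ge> N" for m n
    using L2_norm_triangle_diff[OF u[of m] u[of n] v] N[OF that(1)] N[OF that(2)]
    by (simp add: L2_norm_minus_commute[of M v])
  thus "\<exists>N. \<forall>m\<ge>N. \<forall>n\<ge>N. L2_norm M (\<lambda>x. u m x - u n x) < e" by blast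
qed

lemma L2_tendsto_unique:
  assumes u: "\<And>n. square_integrable M (u n)" and v: "square_integrable M v" and w: "square_integrable M w"
    and "L2_tendsto M u v" and "L2_tendsto M u w"
  shows "AE x in M. v x = w x"
proof -
  have "(\<lambda>n. L2_norm M (\<lambda>x. u n x - v x) + L2_norm M (\<lambda>x. u n x - w x)) \<longlonglongrightarrow> 0 + 0"
    using assms(4,5) unfolding L2_tendsto_def by (rule tendsto_add)
  hence "L2_norm M (\<lambda>x. v x - w x) \<le> 0 + 0"
    by (rule LIMSEQ_le_const) (use L2_norm_triangle_diff[OF v w u] in blast)
  hence "L2_norm M (\<lambda>x. v x - w x) = 0" using L2_norm_nonneg[of M "\<lambda>x. v x - w x"] by linarith
  thus ?thesis using L2_norm_eq_0_iff_AE[OF square_integrable_diff[OF v w]] by simp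
qed

lemma tendsto_integral_mult_L2:
  assumes u: "\<And>n. square_integrable M (u n)" and v: "square_integrable M v" and g: "square_integrable M g"
    and lim: "L2_tendsto M u v"
  shows "(\<lambda>n. \<integral>x. u n x * g x \<partial>M) \<longlonglongrightarrow> (\<integral>x. v x * g x \<partial>M)"
proof -
  have bound: "cmod ((\<integral>x. u n x * g x \<partial>M) - (\<integral>x. v x * g x \<partial>M)) \<le> L2_norm M (\<lambda>x. u n x - v x) * L2_norm M g" for n
  proof -
    have "(\<integral>x. u n x * g x \<partial>M) - (\<integral>x. v x * g x \<partial>M) = (\<integral>x. (u n x - v x) * g x \<partial>M)"
      by (simp add: left_diff_distrib integrable_mult_square_integrable u v g)
    thus ?thesis
      by (simp add: norm_integral_mult_le_L2_norm square_integrable_diff u v g)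
  qed
  have "(\<lambda>n. L2_norm M (\<lambda>x. u n x - v x) * L2_norm M g) \<longlonglongrightarrow> 0"
    using lim unfolding L2_tendsto_def by (rule tendsto_mult_left_zero)
  hence "(\<lambda>n. (\<integral>x. u n x * g x \<partial>M) - (\<integral>x. v x * g x \<partial>M)) \<longlonglongrightarrow> 0"
    by (rule Lim_null_comparison[OF always_eventually, rotated]) (use bound in blast)
  thus ?thesis by (rule LIM_zero_cancel)
qed

lemma L2_tendsto_cong_AE:
  assumes [measurable]: "\<And>n. u n \<in> borel_measurable M" "v \<in> borel_measurable M" "w \<in> borel_measurable M"
    and "L2_tendsto M u v" and AE_eq: "AE x in M. v x = w x"
  shows "L2_tendsto M u w"
proof -
  have "L2_norm M (\<lambda>x. u n x - v x) = L2_norm M (\<lambda>x. u n x - w x)" for n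
    unfolding L2_norm_def using AE_eq by (intro arg_cong[where f = sqrt] integral_cong_AE) auto
  thus ?thesis using \<open>L2_tendsto M u v\<close> by (simp add: L2_tendsto_def)
qed

lemma L2_tendsto_cnj:
  assumes "L2_tendsto M u v"
  shows "L2_tendsto M (\<lambda>n x. cnj (u n x)) (\<lambda>x. cnj (v x))"
  using assms by (simp add: L2_tendsto_def L2_norm_def flip: complex_cnj_diff)

lemma L2_Fatou:
  assumes u: "\<And>n. square_integrable M (u n)" and [measurable]: "v \<in> borel_measurable M"
    and lim: "AE x in M. (\<lambda>n. u n x) \<longlonglongrightarrow> v x" and norm_le: "\<forall>\<^sub>F n in sequentially. L2_norm M (u n) \<le> e"
  shows "square_integrable M v" and "L2_norm M v \<le> e"
proof -
  note [measurable] = borel_measurable_square_integrable[OF u]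
  obtain n where "L2_norm M (u n) \<le> e" using norm_le by (auto simp: eventually_sequentially)
  hence "e \<ge> 0" using L2_norm_nonneg[of M "u n"] by linarith
  have "(\<integral>\<^sup>+x. ennreal ((cmod (v x))\<^sup>2) \<partial>M) = (\<integral>\<^sup>+x. liminf (\<lambda>n. ennreal ((cmod (u n x))\<^sup>2)) \<partial>M)"
  proof (rule nn_integral_cong_AE)
    show "AE x in M. ennreal ((cmod (v x))\<^sup>2) = liminf (\<lambda>n. ennreal ((cmod (u n x))\<^sup>2))"
      using lim
    proof eventually_elim
      case (elim x)
      have "(\<lambda>n. ennreal ((cmod (u n x))\<^sup>2)) \<longlonglongrightarrow> ennreal ((cmod (v x))\<^sup>2)"
        by (intro tendsto_intros elim)
      from lim_imp_Liminf[OF _ this] show ?case by simp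
    qed
  qed
  also have "\<dots> \<le> liminf (\<lambda>n. \<integral>\<^sup>+x. ennreal ((cmod (u n x))\<^sup>2) \<partial>M)"
    by (rule nn_integral_liminf) simp
  also have "\<dots> \<le> liminf (\<lambda>n. ennreal (e\<^sup>2))"
    using norm_le by (intro Liminf_mono) (auto simp: nn_integral_norm_square u intro!: power_mono elim!: eventually_mono)
  finally have nn_le: "(\<integral>\<^sup>+x. ennreal ((cmod (v x))\<^sup>2) \<partial>M) \<le> ennreal (e\<^sup>2)" by (simp add: Liminf_const)
  thus v: "square_integrable M v"
    by (intro square_integrableI_nn_integral) (auto intro: le_less_trans)
  have "(L2_norm M v)\<^sup>2 \<le> e\<^sup>2"
    using nn_le unfolding nn_integral_norm_square[OF v] by simp
  thus "L2_norm M v \<le> e" using \<open>e \<ge> 0\<close> by (rule power2_le_imp_le)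
qed

lemma (in sigma_finite_measure) square_integrable_pos_exists:
  "\<exists>g. square_integrable M g \<and> (\<forall>x\<in>space M. g x \<noteq> 0)"
proof -
  obtain h where [measurable]: "h \<in> borel_measurable M" and h: "integral\<^sup>N M h \<noteq> \<infinity>"
    and h_pos: "\<And>x. x \<in> space M \<Longrightarrow> 0 < h x" and h_fin: "\<And>x. x \<in> space M \<Longrightarrow> h x < \<infinity>"
    using Ex_finite_integrable_function by blast
  define g where "g x = complex_of_real (sqrt (enn2real (h x)))" for x
  have "(\<integral>\<^sup>+x. ennreal ((cmod (g x))\<^sup>2) \<partial>M) = integral\<^sup>N M h"
    using h_fin by (intro nn_integral_cong) (auto simp: g_def)
  hence "square_integrable M g"
    using h by (intro square_integrableI_nn_integral) (simp add: g_def[abs_def], simp add: less_top)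
  moreover have "g x \<noteq> 0" if "x \<in> space M" for x
    using h_pos[OF that] h_fin[OF that] by (auto simp: g_def enn2real_eq_0_iff)
  ultimately show ?thesis by blast
qed

text \<open>Multiplication by a nowhere vanishing function in \<open>L\<^sup>2\<close> turns an \<open>L\<^sup>2\<close>-Cauchy sequence into an
  \<open>L\<^sup>1\<close>-Cauchy one.\<close>

lemma (in sigma_finite_measure) L2_Cauchy_AE_convergent_subseq:
  assumes u: "\<And>n. square_integrable M (u n)"
    and cauchy: "L2_Cauchy M u"
  obtains r :: "nat \<Rightarrow> nat" where "strict_mono r" "AE x in M. convergent (\<lambda>k. u (r k) x)"
proof -
  obtain g where g: "square_integrable M g" "\<forall>x\<in>space M. g x \<noteq> 0"
    using square_integrable_pos_exists by blast
  have "\<exists>N. \<forall>m\<ge>N. \<forall>n\<ge>N. (\<integral>x. cmod (u m x * g x - u n x * g x) \<partial>M) < e" if "e > 0" for e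
  proof -
    have "e / (1 + L2_norm M g) > 0" using that by (simp add: add_pos_nonneg)
    then obtain N where N: "\<forall>m\<ge>N. \<forall>n\<ge>N. L2_norm M (\<lambda>x. u m x - u n x) < e / (1 + L2_norm M g)"
      using cauchy unfolding L2_Cauchy_def by blast
    have "(\<integral>x. cmod (u m x * g x - u n x * g x) \<partial>M) < e" if "m \<ge> N" "n \<ge> N" for m n
    proof -
      have "(\<integral>x. cmod (u m x * g x - u n x * g x) \<partial>M) \<le> L2_norm M (\<lambda>x. u m x - u n x) * L2_norm M g"
        using L2_Cauchy_Schwarz[OF square_integrable_diff[OF u[of m] u[of n]] g(1)]
        by (simp add: left_diff_distrib)
      also have "\<dots> \<le> L2_norm M (\<lambda>x. u m x - u n x) * (1 + L2_norm M g)"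
        by (intro mult_left_mono) auto
      also have "\<dots> < e"
        using N that by (simp add: pos_less_divide_eq add_pos_nonneg)
      finally show ?thesis .
    qed
    thus ?thesis by blast
  qed
  then obtain r where r: "strict_mono r" and cauchy_mult: "AE x in M. Cauchy (\<lambda>k. u (r k) x * g x)"
    by (rule cauchy_L1_AE_cauchy_subseq[OF integrable_mult_square_integrable[OF u g(1)]])
  have "AE x in M. convergent (\<lambda>k. u (r k) x)"
    using cauchy_mult AE_space
  proof eventually_elim
    case (elim x)
    have "convergent (\<lambda>k. u (r k) x * g x * inverse (g x))"
      by (rule convergent_mult[OF Cauchy_convergent[OF elim(1)] convergent_const])
    thus ?case using g(2) elim(2) by (simp add: mult.assoc)
  qed
  with r show ?thesis by (rule that)
qed

lemma L2_tendsto_if_AE_convergent_subseq: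
  assumes u: "\<And>n. square_integrable M (u n)" and cauchy: "L2_Cauchy M u" and r: "strict_mono r"
    and [measurable]: "v \<in> borel_measurable M" and lim: "AE x in M. (\<lambda>k. u (r k) x) \<longlonglongrightarrow> v x"
  shows "square_integrable M v" and "L2_tendsto M u v"
proof -
  note [measurable] = borel_measurable_square_integrable[OF u]
  have diff: "square_integrable M (\<lambda>x. u n x - v x) \<and> L2_norm M (\<lambda>x. u n x - v x) \<le> e"
    if tail_le: "\<forall>m\<ge>N. L2_norm M (\<lambda>x. u n x - u m x) \<le> e" for n N e
  proof -
    have "\<forall>\<^sub>F k in sequentially. N \<le> r k"
      using filterlim_subseq[OF r] by (simp add: filterlim_at_top)
    hence "\<forall>\<^sub>F k in sequentially. L2_norm M (\<lambda>x. u n x - u (r k) x) \<le> e"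
      by eventually_elim (use tail_le in blast)
    moreover have "AE x in M. (\<lambda>k. u n x - u (r k) x) \<longlonglongrightarrow> u n x - v x"
      using lim by eventually_elim (intro tendsto_intros)
    ultimately show ?thesis
      using L2_Fatou[of M "\<lambda>k x. u n x - u (r k) x" "\<lambda>x. u n x - v x" e] square_integrable_diff[OF u u]
      by simp
  qed
  show "square_integrable M v"
  proof -
    obtain N where N: "\<forall>m\<ge>N. \<forall>n\<ge>N. L2_norm M (\<lambda>x. u m x - u n x) < 1"
      using cauchy unfolding L2_Cauchy_def by (metis zero_less_one)
    hence "square_integrable M (\<lambda>x. u N x - v x)"
      by (intro conjunct1[OF diff[of N N 1]]) (auto intro: less_imp_le)
    from square_integrable_diff[OF u[of N] this] show ?thesis by simp
  qed
  show "L2_tendsto M u v"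
    unfolding L2_tendsto_def
  proof (rule LIMSEQ_I)
    fix e :: real assume "e > 0"
    hence "e / 2 > 0" by simp
    then obtain N where N: "\<forall>m\<ge>N. \<forall>n\<ge>N. L2_norm M (\<lambda>x. u m x - u n x) < e / 2"
      using cauchy unfolding L2_Cauchy_def by blast
    have "L2_norm M (\<lambda>x. u n x - v x) \<le> e / 2" if "n \<ge> N" for n
      using N that by (intro conjunct2[OF diff[of N]]) (auto intro: less_imp_le)
    thus "\<exists>N. \<forall>n\<ge>N. norm (L2_norm M (\<lambda>x. u n x - v x) - 0) < e"
      using \<open>e > 0\<close> by (intro exI[of _ N]) (force intro: le_less_trans)
  qed
qed

theorem (in sigma_finite_measure) L2_complete:
  assumes u: "\<And>n. square_integrable M (u n)"
    and cauchy: "L2_Cauchy M u"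
  obtains v where "square_integrable M v" "L2_tendsto M u v"
proof -
  note [measurable] = borel_measurable_square_integrable[OF u]
  obtain r :: "nat \<Rightarrow> nat" where r: "strict_mono r" and convergent: "AE x in M. convergent (\<lambda>k. u (r k) x)"
    using L2_Cauchy_AE_convergent_subseq[OF u cauchy] by blast
  define v where "v x = lim (\<lambda>k. u (r k) x)" for x
  have [measurable]: "v \<in> borel_measurable M"
    unfolding v_def by (rule borel_measurable_lim_metric) simp
  have lim: "AE x in M. (\<lambda>k. u (r k) x) \<longlonglongrightarrow> v x"
    using convergent by eventually_elim (auto simp: v_def convergent_LIMSEQ_iff)
  show ?thesis
    by (rule that[OF L2_tendsto_if_AE_convergent_subseq[OF u cauchy r _ lim]]) simp_all
qed

lemma square_integrable_completion:
  "f \<in> borel_measurable M \<Longrightarrow> square_integrable (completion M) f \<longleftrightarrow> square_integrable M f"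
  by (auto simp: square_integrable_def integrable_completion intro: measurable_completion)

lemma L2_tendsto_completion:
  assumes [measurable]: "\<And>n. u n \<in> borel_measurable M" "v \<in> borel_measurable M"
  shows "L2_tendsto (completion M) u v \<longleftrightarrow> L2_tendsto M u v"
  by (simp add: L2_tendsto_def L2_norm_def integral_completion)

lemma nn_integral_tendsto_0_iff_L2_tendsto:
  assumes u: "\<And>n. square_integrable M (u n)" and [measurable]: "g \<in> borel_measurable M"
  shows "(\<lambda>n. \<integral>\<^sup>+x. ennreal ((cmod (g x - u n x))\<^sup>2) \<partial>M) \<longlonglongrightarrow> 0 \<longleftrightarrow> square_integrable M g \<and> L2_tendsto M u g"
proof
  assume lim: "(\<lambda>n. \<integral>\<^sup>+x. ennreal ((cmod (g x - u n x))\<^sup>2) \<partial>M) \<longlonglongrightarrow> 0"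
  note [measurable] = borel_measurable_square_integrable[OF u]
  obtain n where "(\<integral>\<^sup>+x. ennreal ((cmod (g x - u n x))\<^sup>2) \<partial>M) < 1"
    using order_tendstoD(2)[OF lim, of 1] by (auto simp: eventually_sequentially)
  hence "square_integrable M (\<lambda>x. g x - u n x)"
    by (intro square_integrableI_nn_integral) (auto intro: less_trans)
  from square_integrable_add[OF this u[of n]] have g: "square_integrable M g" by simp
  have "(\<lambda>n. ennreal ((L2_norm M (\<lambda>x. g x - u n x))\<^sup>2)) \<longlonglongrightarrow> ennreal 0"
    using lim by (simp add: nn_integral_norm_square square_integrable_diff g u)
  hence "(\<lambda>n. (L2_norm M (\<lambda>x. g x - u n x))\<^sup>2) \<longlonglongrightarrow> 0"
    by (subst (asm) tendsto_ennreal_iff) auto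
  hence "L2_tendsto M u g"
    using tendsto_real_sqrt[of "\<lambda>n. (L2_norm M (\<lambda>x. g x - u n x))\<^sup>2" 0]
    by (simp add: L2_tendsto_def L2_norm_minus_commute[of M g])
  with g show "square_integrable M g \<and> L2_tendsto M u g" ..
next
  assume g: "square_integrable M g \<and> L2_tendsto M u g"
  have "(\<lambda>n. ennreal ((L2_norm M (\<lambda>x. u n x - g x))\<^sup>2)) \<longlonglongrightarrow> ennreal (0\<^sup>2)"
    using g unfolding L2_tendsto_def by (intro tendsto_intros) auto
  thus "(\<lambda>n. \<integral>\<^sup>+x. ennreal ((cmod (g x - u n x))\<^sup>2) \<partial>M) \<longlonglongrightarrow> 0"
    using g by (simp add: nn_integral_norm_square square_integrable_diff u L2_norm_minus_commute[of M g])
qed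

lemma compact_L2_ex_borel:
  fixes v :: "'a::euclidean_space \<Rightarrow> real"
  assumes D: "compact D" and v: "set_borel_measurable lebesgue D v"
    and v2: "set_integrable lebesgue D (\<lambda>t. (v t)\<^sup>2)"
  obtains u :: "'a \<Rightarrow> real" where "u \<in> borel_measurable borel" "\<And>t. t \<notin> D \<Longrightarrow> u t = 0"
    "AE t in lebesgue. indicator D t * v t = u t"
    "integrable lborel (\<lambda>t. complex_of_real (u t))" "square_integrable lborel (\<lambda>t. complex_of_real (u t))"
proof -
  have [measurable]: "D \<in> sets borel" using D by (simp add: compact_imp_closed)
  have "(\<lambda>t. indicator D t * v t) \<in> borel_measurable lebesgue"
    using v by (simp add: set_borel_measurable_def)
  then obtain u0 where [measurable]: "u0 \<in> borel_measurable lborel"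
    and u0: "AE t in lborel. indicator D t * v t = u0 t"
    using completion_ex_borel_measurable_real by blast
  define u where "u t = indicator D t * u0 t" for t
  have [measurable]: "u \<in> borel_measurable borel" unfolding u_def by measurable
  have "AE t in lborel. indicator D t * v t = u t"
    using u0 by eventually_elim (auto simp: u_def split: split_indicator_asm split_indicator)
  hence u_eq: "AE t in lebesgue. indicator D t * v t = u t" by (rule AE_completion)
  have "(\<integral>\<^sup>+t. ennreal ((cmod (complex_of_real (u t)))\<^sup>2) \<partial>lborel) = (\<integral>\<^sup>+t. ennreal ((u t)\<^sup>2) \<partial>lebesgue)"
    by (simp add: nn_integral_completion)
  also have "\<dots> = (\<integral>\<^sup>+t. ennreal (norm (indicator D t *\<^sub>R (v t)\<^sup>2)) \<partial>lebesgue)"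
  proof (rule nn_integral_cong_AE)
    show "AE t in lebesgue. ennreal ((u t)\<^sup>2) = ennreal (norm (indicator D t *\<^sub>R (v t)\<^sup>2))"
      using u_eq by eventually_elim (auto split: split_indicator_asm split_indicator)
  qed
  also have "\<dots> < \<infinity>"
    using v2 by (simp add: set_integrable_def integrable_iff_bounded)
  finally have u2: "square_integrable lborel (\<lambda>t. complex_of_real (u t))"
    by (intro square_integrableI_nn_integral) simp_all
  have "integrable lborel (\<lambda>t. indicator D t *\<^sub>R complex_of_real (u t))"
    using emeasure_bounded_finite[OF compact_imp_bounded[OF D]]
    by (intro integrable_indicator_square_integrable u2) auto
  moreover have "indicator D t *\<^sub>R complex_of_real (u t) = complex_of_real (u t)" for t
    by (simp add: u_def split: split_indicator)
  ultimately have "integrable lborel (\<lambda>t. complex_of_real (u t))" by simp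
  with \<open>u \<in> borel_measurable borel\<close> u_eq u2 show ?thesis
    by (intro that[of u]) (auto simp: u_def)
qed

section \<open>Lebesgue integrals on Euclidean spaces\<close>

lemma integrable_mult_bounded:
  fixes f g :: "'a \<Rightarrow> complex"
  assumes f: "integrable M f" and [measurable]: "g \<in> borel_measurable M" and bound: "\<And>x. cmod (g x) \<le> B"
  shows "integrable M (\<lambda>x. f x * g x)"
proof (rule Bochner_Integration.integrable_bound)
  show "integrable M (\<lambda>x. cmod (f x) * B)" using f by simp
  show "(\<lambda>x. f x * g x) \<in> borel_measurable M"
    using borel_measurable_integrable[OF f] by measurable
  show "AE x in M. norm (f x * g x) \<le> norm (cmod (f x) * B)"
    using bound by (intro AE_I2) (auto simp: norm_mult abs_mult intro!: mult_left_mono order_trans[OF _ abs_ge_self])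
qed

lemma integrable_mult_cis:
  assumes "integrable M u" and [measurable]: "f \<in> borel_measurable M"
  shows "integrable M (\<lambda>x. u x * cis (f x))"
  by (rule integrable_mult_bounded[OF assms(1), where B = 1]) auto

lemma lborel_integrable_affine:
  fixes f :: "'a::euclidean_space \<Rightarrow> 'b::{banach, second_countable_topology}"
  assumes f: "integrable lborel f" and c_nonzero: "c \<noteq> 0"
  shows "integrable lborel (\<lambda>x. f (t + c *\<^sub>R x))"
proof -
  have [measurable]: "f \<in> borel_measurable borel" using borel_measurable_integrable[OF f] by simp
  have "integrable (density (distr lborel borel (\<lambda>x. t + c *\<^sub>R x)) (\<lambda>_. ennreal (\<bar>c\<bar> ^ DIM('a)))) f"
    using f lborel_affine[OF c_nonzero, of t] by simp
  hence "integrable lborel (\<lambda>x. \<bar>c\<bar> ^ DIM('a) *\<^sub>R f (t + c *\<^sub>R x))"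
    by (simp add: integrable_density integrable_distr_eq)
  hence "integrable lborel (\<lambda>x. inverse (\<bar>c\<bar> ^ DIM('a)) *\<^sub>R \<bar>c\<bar> ^ DIM('a) *\<^sub>R f (t + c *\<^sub>R x))"
    by (rule integrable_scaleR_right)
  thus ?thesis using c_nonzero by simp
qed

lemma lborel_integrable_affine_iff:
  fixes f :: "'a::euclidean_space \<Rightarrow> 'b::{banach, second_countable_topology}"
  assumes c_nonzero: "c \<noteq> 0"
  shows "integrable lborel (\<lambda>x. f (t + c *\<^sub>R x)) \<longleftrightarrow> integrable lborel f"
proof
  assume "integrable lborel (\<lambda>x. f (t + c *\<^sub>R x))"
  from lborel_integrable_affine[OF this, of "inverse c" "- (inverse c *\<^sub>R t)"]
  show "integrable lborel f" using c_nonzero by (simp add: scaleR_right_diff_distrib)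
qed (rule lborel_integrable_affine[OF _ c_nonzero])

lemma lborel_integral_affine:
  fixes f :: "'a::euclidean_space \<Rightarrow> 'b::{banach, second_countable_topology}"
  assumes c_nonzero: "c \<noteq> 0"
  shows "(LBINT x. f x) = \<bar>c\<bar> ^ DIM('a) *\<^sub>R (LBINT x. f (t + c *\<^sub>R x))"
proof (cases "integrable lborel f")
  case True
  hence [measurable]: "f \<in> borel_measurable borel" by (auto dest: borel_measurable_integrable)
  show ?thesis
    by (subst lborel_affine[OF c_nonzero, of t]) (simp add: integral_density integral_distr)
next
  case False
  thus ?thesis using lborel_integrable_affine_iff[OF c_nonzero, of f t] by (simp add: not_integrable_integral_eq)
qed

lemma
  fixes f :: "'a::euclidean_space \<Rightarrow> 'b::{banach, second_countable_topology}"
  shows lborel_integrable_reflect_iff: "integrable lborel (\<lambda>x. f (t - x)) \<longleftrightarrow> integrable lborel f"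
    and lborel_integral_reflect: "(LBINT x. f (t - x)) = (LBINT x. f x)"
  using lborel_integrable_affine_iff[of "-1" f t] lborel_integral_affine[of "-1" f t] by auto

lemma
  fixes f :: "'a::euclidean_space \<Rightarrow> 'b::{banach, second_countable_topology}"
  shows lborel_integrable_uminus_iff: "integrable lborel (\<lambda>x. f (- x)) \<longleftrightarrow> integrable lborel f"
    and lborel_integral_uminus: "(LBINT x. f (- x)) = (LBINT x. f x)"
  using lborel_integrable_reflect_iff[of f 0] lborel_integral_reflect[of f 0] by auto

lemma
  fixes f :: "'a::euclidean_space \<Rightarrow> 'b::{banach, second_countable_topology}"
  shows lborel_integrable_translate_iff: "integrable lborel (\<lambda>x. f (x - t)) \<longleftrightarrow> integrable lborel f"
    and lborel_integral_translate: "(LBINT x. f (x - t)) = (LBINT x. f x)"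
  using lborel_integrable_affine_iff[of 1 f "- t"] lborel_integral_affine[of 1 f "- t"] by auto

lemma
  fixes u :: "'a::euclidean_space \<Rightarrow> complex"
  assumes "square_integrable lborel u"
  shows square_integrable_translate: "square_integrable lborel (\<lambda>x. u (x - t))"
    and square_integrable_uminus: "square_integrable lborel (\<lambda>x. u (- x))"
proof -
  note [measurable] = borel_measurable_square_integrable[OF assms]
  show "square_integrable lborel (\<lambda>x. u (x - t))" "square_integrable lborel (\<lambda>x. u (- x))"
    using integrable_norm_square[OF assms]
      lborel_integrable_translate_iff[of "\<lambda>x. (cmod (u x))\<^sup>2" t] lborel_integrable_uminus_iff[of "\<lambda>x. (cmod (u x))\<^sup>2"]
    by (simp_all add: square_integrable_def)
qed

lemma L2_norm_translate:
  fixes u :: "'a::euclidean_space \<Rightarrow> complex"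
  shows "L2_norm lborel (\<lambda>x. u (x - t)) = L2_norm lborel u"
  using lborel_integral_translate[of "\<lambda>x. (cmod (u x))\<^sup>2" t] by (simp add: L2_norm_def)

lemma integrable_pair_mult:
  fixes f :: "'a::euclidean_space \<Rightarrow> complex" and g :: "'b::euclidean_space \<Rightarrow> complex"
  assumes f: "integrable lborel f" and g: "integrable lborel g"
  shows "integrable (lborel \<Otimes>\<^sub>M lborel) (\<lambda>(x, y). f x * g y)"
proof -
  note [measurable] = borel_measurable_integrable[OF f] borel_measurable_integrable[OF g]
  show ?thesis
  proof (rule lborel_pair.Fubini_integrable)
    show "integrable lborel (\<lambda>x. \<integral>y. norm (case (x, y) of (x, y) \<Rightarrow> f x * g y) \<partial>lborel)"
      using f by (simp add: norm_mult)
    show "AE x in lborel. integrable lborel (\<lambda>y. case (x, y) of (x, y) \<Rightarrow> f x * g y)"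
      using g by simp
  qed measurable
qed

lemma
  fixes f :: "'a::euclidean_space \<Rightarrow> real \<Rightarrow> 'b::{real_normed_field, banach, second_countable_topology}"
  assumes f: "\<And>b. b \<in> Basis \<Longrightarrow> integrable lborel (f b)"
  shows lborel_integrable_prod_Basis: "integrable lborel (\<lambda>x::'a. \<Prod>b\<in>Basis. f b (x \<bullet> b))"
    and lborel_integral_prod_Basis:
      "(LBINT x. (\<Prod>b\<in>Basis. f b ((x::'a) \<bullet> b))) = (\<Prod>b\<in>Basis. \<integral>t. f b t \<partial>lborel)"
proof -
  interpret product_sigma_finite "\<lambda>_::'a. lborel :: real measure" ..
  have [measurable]: "f b \<in> borel_measurable borel" if "b \<in> Basis" for b
    using borel_measurable_integrable[OF f[OF that]] by simp
  have "(\<lambda>x::'a. \<Prod>b\<in>Basis. f b (x \<bullet> b)) \<in> borel_measurable borel"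
    by measurable
  moreover have "(\<Prod>b\<in>Basis. f b ((\<Sum>c\<in>Basis. g c *\<^sub>R c) \<bullet> b)) = (\<Prod>b\<in>Basis. f b (g b))" for g :: "'a \<Rightarrow> real"
    by (intro prod.cong) simp_all
  ultimately show "integrable lborel (\<lambda>x::'a. \<Prod>b\<in>Basis. f b (x \<bullet> b))"
    and "(LBINT x. (\<Prod>b\<in>Basis. f b ((x::'a) \<bullet> b))) = (\<Prod>b\<in>Basis. \<integral>t. f b t \<partial>lborel)"
    by (subst lborel_eq;
        simp add: integrable_distr_eq integral_distr product_integrable_prod product_integral_prod f)+
qed

lemma norm_square_eq_sum_Basis: "(norm (x::'a::euclidean_space))\<^sup>2 = (\<Sum>b\<in>Basis. (x \<bullet> b)\<^sup>2)"
  unfolding power2_norm_eq_inner by (subst euclidean_inner) (simp add: power2_eq_square)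

lemma cis_inner_eq_prod_Basis: "cis (w \<bullet> x) = (\<Prod>b\<in>Basis. cis ((w \<bullet> b) * (x \<bullet> b)))"
  for w x :: "'a::euclidean_space"
  by (simp add: cis_conv_exp exp_sum[OF finite_Basis, symmetric] euclidean_inner[of w x] sum_distrib_left)

lemma integral_zero_if_box_integrals_zero:
  fixes h :: "'a::euclidean_space \<Rightarrow> complex"
  assumes h: "integrable lborel h" and zero: "\<And>a b. (LINT x:box a b|lborel. h x) = 0"
  shows "(LBINT x. h x) = 0"
proof -
  let ?B = "\<lambda>n. box (- (real n *\<^sub>R One)) (real n *\<^sub>R One) :: 'a set"
  have "set_integrable lborel (\<Union>n. ?B n) h"
    unfolding UN_box_eq_UNIV set_integrable_def using h by simp
  moreover have "incseq ?B"
    by (intro incseq_SucI subset_box_imp) auto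
  ultimately have "(\<lambda>n. LINT x:?B n|lborel. h x) \<longlonglongrightarrow> (LINT x:(\<Union>n. ?B n)|lborel. h x)"
    by (intro set_integral_cont_up) auto
  thus ?thesis
    unfolding zero UN_box_eq_UNIV by (simp add: set_lebesgue_integral_def LIMSEQ_const_iff)
qed

lemma AE_zero_if_box_integrals_zero:
  fixes h :: "'a::euclidean_space \<Rightarrow> complex"
  assumes h: "integrable lborel h" and zero: "\<And>a b. (LINT x:box a b|lborel. h x) = 0"
  shows "AE x in lborel. h x = 0"
proof (rule sigma_finite_measure.density_zero[OF sigma_finite_lborel h])
  have h_on: "set_integrable lborel A h" if "A \<in> sets borel" for A
    unfolding set_integrable_def using that h by (intro integrable_mult_indicator) auto
  fix A :: "'a set" assume "A \<in> sets lborel"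
  hence A: "A \<in> sigma_sets UNIV (range (\<lambda>(a, b). box a b))"
    by (simp add: borel_eq_box)
  have "Int_stable (range (\<lambda>(a, b). box a b :: 'a set))"
    by (auto simp: Int_stable_def box_Int_box)
  moreover have "range (\<lambda>(a, b). box a b :: 'a set) \<subseteq> Pow UNIV" by simp
  ultimately show "(LINT x:A|lborel. h x) = 0"
    using A
  proof (induction A rule: sigma_sets_induct_disjoint)
    case (basic A)
    thus ?case using zero by auto
  next
    case empty
    thus ?case by (simp add: set_lebesgue_integral_def)
  next
    case (compl A)
    hence A: "A \<in> sets borel" by (simp add: borel_eq_box)
    have "(LBINT x. h x) = (LINT x:A \<union> (UNIV - A)|lborel. h x)"
      by (simp add: set_lebesgue_integral_def)
    also have "\<dots> = (LINT x:A|lborel. h x) + (LINT x:UNIV - A|lborel. h x)"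
      using A by (intro set_integral_Un h_on) auto
    finally show ?case using compl integral_zero_if_box_integrals_zero[OF h zero] by simp
  next
    case (union A)
    hence A: "A i \<in> sets borel" for i by (auto simp: borel_eq_box)
    have "(LINT x:(\<Union>i. A i)|lborel. h x) = (\<Sum>i. LINT x:A i|lborel. h x)"
      using A union(1) by (intro lebesgue_integral_countable_add h_on) (auto simp: disjoint_family_on_def)
    thus ?case using union by simp
  qed
qed

lemma AE_isCont_indicator_convex:
  fixes B :: "'a::euclidean_space set"
  assumes "convex B"
  shows "AE x in lborel. isCont (\<lambda>x. complex_of_real (indicator B x)) x"
proof -
  have "frontier B \<in> null_sets lborel"
    using negligible_convex_frontier[OF assms] by (auto simp: null_sets_completion_iff negligible_iff_null_sets)
  hence "AE x in lborel. x \<notin> frontier B" by (rule AE_not_in)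
  thus ?thesis
    by eventually_elim (auto simp: isCont_indicator intro!: continuous_intros)
qed

section \<open>The Fourier transform and dilated convolutions\<close>

definition ft :: "('a::euclidean_space \<Rightarrow> complex) \<Rightarrow> 'a \<Rightarrow> complex" where
  "ft u \<omega> = (LBINT x. u x * cis (- (\<omega> \<bullet> x)))"

lemma borel_measurable_ft [measurable]:
  assumes [measurable]: "u \<in> borel_measurable borel"
  shows "ft u \<in> borel_measurable borel"
  unfolding ft_def by measurable

lemma norm_ft_le: "cmod (ft u \<omega>) \<le> (LBINT x. cmod (u x))"
  unfolding ft_def using integral_norm_bound[of lborel "\<lambda>x. u x * cis (- (\<omega> \<bullet> x))"]
  by (simp add: norm_mult)

lemma ft_diff:
  assumes "integrable lborel u" "integrable lborel v"
  shows "ft (\<lambda>x. u x - v x) \<omega> = ft u \<omega> - ft v \<omega>"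
  unfolding ft_def using assms by (simp add: left_diff_distrib integrable_mult_cis)

lemma ft_reflect: "ft (\<lambda>x. u (t - x)) \<omega> = ft u (- \<omega>) * cis (- (\<omega> \<bullet> t))"
proof -
  have "ft u (- \<omega>) * cis (- (\<omega> \<bullet> t)) = (LBINT x. u x * cis (\<omega> \<bullet> x - \<omega> \<bullet> t))"
    unfolding ft_def by (subst integral_mult_left_zero[symmetric]) (simp add: mult.assoc cis_mult)
  also have "\<dots> = (LBINT x. u (t - x) * cis (\<omega> \<bullet> (t - x) - \<omega> \<bullet> t))"
    by (rule lborel_integral_reflect[symmetric])
  finally show ?thesis by (simp add: ft_def inner_diff_right)
qed

lemma cnj_ft: "cnj (ft u \<omega>) = ft (\<lambda>x. cnj (u x)) (- \<omega>)"
  unfolding ft_def Bochner_Integration.integral_cnj[symmetric] by (simp add: cis_cnj)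

lemma ft_duality:
  assumes u: "integrable lborel u" and v: "integrable lborel v"
  shows "(LBINT \<omega>. ft u \<omega> * v \<omega>) = (LBINT x. u x * ft v x)"
proof -
  have [measurable]: "u \<in> borel_measurable borel" "v \<in> borel_measurable borel"
    using borel_measurable_integrable[OF u] borel_measurable_integrable[OF v] by auto
  have pair: "integrable (lborel \<Otimes>\<^sub>M lborel) (\<lambda>(\<omega>, x). v \<omega> * u x * cis (- (\<omega> \<bullet> x)))"
    by (rule Bochner_Integration.integrable_bound[OF integrable_pair_mult[OF v u]]) (auto simp: norm_mult)
  have "(LBINT \<omega>. ft u \<omega> * v \<omega>) = (LBINT \<omega>. (LBINT x. v \<omega> * u x * cis (- (\<omega> \<bullet> x))))"
    by (subst mult.commute) (simp add: ft_def mult.assoc)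
  also have "\<dots> = (LBINT x. (LBINT \<omega>. v \<omega> * u x * cis (- (\<omega> \<bullet> x))))"
    using lborel_pair.Fubini_integral[OF pair] by simp
  also have "\<dots> = (LBINT x. u x * ft v x)"
    unfolding ft_def integral_mult_right_zero[symmetric]
    by (intro Bochner_Integration.integral_cong refl) (simp add: inner_commute mult_ac)
  finally show ?thesis .
qed

definition dilated_conv ::
    "real \<Rightarrow> ('a::euclidean_space \<Rightarrow> complex) \<Rightarrow> ('a \<Rightarrow> complex) \<Rightarrow> 'a \<Rightarrow> complex" where
  "dilated_conv \<delta> u w x = (LBINT t. u (x - \<delta> *\<^sub>R t) * w t)"

abbreviation conv :: "('a::euclidean_space \<Rightarrow> complex) \<Rightarrow> ('a \<Rightarrow> complex) \<Rightarrow> 'a \<Rightarrow> complex" where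
  "conv \<equiv> dilated_conv 1"

lemma borel_measurable_dilated_conv [measurable]:
  assumes [measurable]: "u \<in> borel_measurable borel" "w \<in> borel_measurable borel"
  shows "dilated_conv \<delta> u w \<in> borel_measurable borel"
  unfolding dilated_conv_def by measurable

lemma integrable_dilated_conv_pair:
  fixes u w :: "'a::euclidean_space \<Rightarrow> complex"
  assumes u: "integrable lborel u" and w: "integrable lborel w"
  shows "integrable (lborel \<Otimes>\<^sub>M lborel) (\<lambda>(t, x). u (x - \<delta> *\<^sub>R t) * w t)"
proof (rule lborel_pair.Fubini_integrable)
  have [measurable]: "u \<in> borel_measurable borel" "w \<in> borel_measurable borel"
    using borel_measurable_integrable[OF u] borel_measurable_integrable[OF w] by auto
  show "(\<lambda>(t, x). u (x - \<delta> *\<^sub>R t) * w t) \<in> borel_measurable (lborel \<Otimes>\<^sub>M lborel)"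
    by measurable
  show "integrable lborel (\<lambda>t. \<integral>x. norm (case (t, x) of (t, x) \<Rightarrow> u (x - \<delta> *\<^sub>R t) * w t) \<partial>lborel)"
    using w by (simp add: norm_mult lborel_integral_translate[of "\<lambda>x. cmod (u x)"])
  show "AE t in lborel. integrable lborel (\<lambda>x. case (t, x) of (t, x) \<Rightarrow> u (x - \<delta> *\<^sub>R t) * w t)"
    using u by (simp add: lborel_integrable_translate_iff)
qed

lemma integrable_dilated_conv:
  assumes "integrable lborel u" and "integrable lborel w"
  shows "integrable lborel (dilated_conv \<delta> u w)"
  using lborel_pair.integrable_snd[OF integrable_dilated_conv_pair[OF assms]]
  by (simp add: dilated_conv_def[abs_def])

lemma ft_dilated_conv:
  assumes u: "integrable lborel u" and w: "integrable lborel w"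
  shows "ft (dilated_conv \<delta> u w) \<omega> = ft u \<omega> * ft w (\<delta> *\<^sub>R \<omega>)"
proof -
  have [measurable]: "u \<in> borel_measurable borel" "w \<in> borel_measurable borel"
    using borel_measurable_integrable[OF u] borel_measurable_integrable[OF w] by auto
  have pair: "integrable (lborel \<Otimes>\<^sub>M lborel) (\<lambda>(t, x). u (x - \<delta> *\<^sub>R t) * w t * cis (- (\<omega> \<bullet> x)))"
    by (rule Bochner_Integration.integrable_bound[OF integrable_dilated_conv_pair[OF u w]])
       (auto simp: norm_mult)
  have inner: "(LBINT x. u (x - \<delta> *\<^sub>R t) * w t * cis (- (\<omega> \<bullet> x))) = ft u \<omega> * (w t * cis (- (\<delta> *\<^sub>R \<omega> \<bullet> t)))" for t
  proof -
    have "ft u \<omega> * (w t * cis (- (\<delta> *\<^sub>R \<omega> \<bullet> t))) = (LBINT x. u x * w t * cis (- (\<omega> \<bullet> (x + \<delta> *\<^sub>R t))))"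
      unfolding ft_def integral_mult_left_zero[symmetric]
      by (simp add: mult_ac cis_mult inner_add_right add.commute)
    also have "\<dots> = (LBINT x. u (x - \<delta> *\<^sub>R t) * w t * cis (- (\<omega> \<bullet> (x - \<delta> *\<^sub>R t + \<delta> *\<^sub>R t))))"
      by (rule lborel_integral_translate[symmetric])
    finally show ?thesis by simp
  qed
  have "ft (dilated_conv \<delta> u w) \<omega> = (LBINT x. (LBINT t. u (x - \<delta> *\<^sub>R t) * w t * cis (- (\<omega> \<bullet> x))))"
    unfolding ft_def dilated_conv_def by simp
  also have "\<dots> = (LBINT t. (LBINT x. u (x - \<delta> *\<^sub>R t) * w t * cis (- (\<omega> \<bullet> x))))"
    using lborel_pair.Fubini_integral[OF pair] by simp
  finally show ?thesis unfolding inner by (simp add: ft_def)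
qed

lemma integral_ft_dilated:
  fixes u w :: "'a::euclidean_space \<Rightarrow> complex"
  assumes u: "integrable lborel u" and w: "integrable lborel w" and "\<delta> \<noteq> 0"
  shows "(LBINT \<omega>. ft u \<omega> * (w (\<delta> *\<^sub>R \<omega>) * cis (\<omega> \<bullet> y))) = dilated_conv \<delta> u (\<lambda>z. ft w (- z)) y"
proof -
  let ?v = "\<lambda>\<omega>. w (\<delta> *\<^sub>R \<omega>) * cis (\<omega> \<bullet> y)"
  have ft_v: "ft w (- z) = \<bar>\<delta>\<bar> ^ DIM('a) *\<^sub>R ft ?v (y - \<delta> *\<^sub>R z)" for z
  proof -
    have "ft w (- z) = (LBINT \<omega>. w \<omega> * cis (z \<bullet> \<omega>))" by (simp add: ft_def)
    also have "\<dots> = \<bar>\<delta>\<bar> ^ DIM('a) *\<^sub>R (LBINT \<omega>. w (0 + \<delta> *\<^sub>R \<omega>) * cis (z \<bullet> (0 + \<delta> *\<^sub>R \<omega>)))"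
      by (rule lborel_integral_affine[OF \<open>\<delta> \<noteq> 0\<close>])
    also have "(LBINT \<omega>. w (0 + \<delta> *\<^sub>R \<omega>) * cis (z \<bullet> (0 + \<delta> *\<^sub>R \<omega>))) = ft ?v (y - \<delta> *\<^sub>R z)"
      unfolding ft_def
      by (intro Bochner_Integration.integral_cong)
         (auto simp: mult.assoc cis_mult inner_diff_left inner_commute[of y])
    finally show ?thesis .
  qed
  have "(LBINT \<omega>. ft u \<omega> * ?v \<omega>) = (LBINT x. u x * ft ?v x)"
    using lborel_integrable_affine[OF w \<open>\<delta> \<noteq> 0\<close>, of 0]
    by (intro ft_duality u integrable_mult_cis) auto
  also have "\<dots> = \<bar>- \<delta>\<bar> ^ DIM('a) *\<^sub>R (LBINT z. u (y + (- \<delta>) *\<^sub>R z) * ft ?v (y + (- \<delta>) *\<^sub>R z))"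
    by (rule lborel_integral_affine) (use \<open>\<delta> \<noteq> 0\<close> in simp)
  also have "\<dots> = dilated_conv \<delta> u (\<lambda>z. ft w (- z)) y"
    by (simp add: dilated_conv_def ft_v)
  finally show ?thesis .
qed

lemma dilated_conv_adjoint:
  fixes h k w :: "'a::euclidean_space \<Rightarrow> complex"
  assumes h: "integrable lborel h" and w: "integrable lborel w"
    and [measurable]: "k \<in> borel_measurable borel" and bound: "\<And>x. cmod (k x) \<le> B"
  shows "(LBINT x. h x * dilated_conv \<delta> k w x) = (LBINT y. k y * dilated_conv (- \<delta>) h w y)"
proof -
  have pair: "integrable (lborel \<Otimes>\<^sub>M lborel) (\<lambda>(t, x). w t * h x * k (x - \<delta> *\<^sub>R t))"
    using integrable_mult_bounded[OF integrable_pair_mult[OF w h], of "\<lambda>(t, x). k (x - \<delta> *\<^sub>R t)" B] bound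
    by (simp add: split_beta')
  have translated_pair: "integrable (lborel \<Otimes>\<^sub>M lborel) (\<lambda>(t, y). h (y - (- \<delta>) *\<^sub>R t) * w t * k y)"
    using integrable_mult_bounded[OF integrable_dilated_conv_pair[OF h w, of "- \<delta>"], of "\<lambda>(t, y). k y" B] bound
    by (simp add: split_beta')
  have "(LBINT x. h x * dilated_conv \<delta> k w x) = (LBINT x. (LBINT t. w t * h x * k (x - \<delta> *\<^sub>R t)))"
    unfolding dilated_conv_def integral_mult_right_zero[symmetric] by (simp only: mult_ac)
  also have "\<dots> = (LBINT t. (LBINT x. w t * h x * k (x - \<delta> *\<^sub>R t)))"
    using lborel_pair.Fubini_integral[OF pair] by simp
  also have "\<dots> = (LBINT t. (LBINT y. h (y - (- \<delta>) *\<^sub>R t) * w t * k y))"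
  proof (rule Bochner_Integration.integral_cong[OF refl])
    fix t
    show "(LBINT x. w t * h x * k (x - \<delta> *\<^sub>R t)) = (LBINT y. h (y - (- \<delta>) *\<^sub>R t) * w t * k y)"
      using lborel_integral_translate[of "\<lambda>y. h (y + \<delta> *\<^sub>R t) * w t * k y" "\<delta> *\<^sub>R t"]
      by (simp add: mult_ac)
  qed
  also have "\<dots> = (LBINT y. (LBINT t. h (y - (- \<delta>) *\<^sub>R t) * w t * k y))"
    using lborel_pair.Fubini_integral[OF translated_pair] by simp
  also have "\<dots> = (LBINT y. k y * dilated_conv (- \<delta>) h w y)"
    unfolding dilated_conv_def integral_mult_right_zero[symmetric] by (simp only: mult_ac)
  finally show ?thesis .
qed

lemma norm_dilated_conv_le:
  assumes [measurable]: "k \<in> borel_measurable borel" and w: "integrable lborel w"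
    and bound: "\<And>x. cmod (k x) \<le> B"
  shows "cmod (dilated_conv \<delta> k w x) \<le> B * (LBINT t. cmod (w t))"
proof -
  have "0 \<le> B" using order_trans[OF norm_ge_zero bound] .
  have "cmod (dilated_conv \<delta> k w x) \<le> (LBINT t. cmod (k (x - \<delta> *\<^sub>R t) * w t))"
    unfolding dilated_conv_def by (rule integral_norm_bound)
  also have "\<dots> \<le> (LBINT t. B * cmod (w t))"
    using w bound \<open>0 \<le> B\<close>
    by (intro integral_mono_AE') (auto simp: norm_mult intro!: mult_right_mono)
  finally show ?thesis by simp
qed

lemma dilated_conv_tendsto:
  assumes [measurable]: "k \<in> borel_measurable borel" and w: "integrable lborel w"
    and bound: "\<And>x. cmod (k x) \<le> B" and cont: "isCont k x" and \<delta>: "\<delta> \<longlonglongrightarrow> 0"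
  shows "(\<lambda>n. dilated_conv (\<delta> n) k w x) \<longlonglongrightarrow> k x * (LBINT t. w t)"
proof -
  have "(\<lambda>n. LBINT t. k (x - \<delta> n *\<^sub>R t) * w t) \<longlonglongrightarrow> (LBINT t. k x * w t)"
  proof (rule integral_dominated_convergence[where w = "\<lambda>t. B * cmod (w t)"])
    show "AE t in lborel. (\<lambda>n. k (x - \<delta> n *\<^sub>R t) * w t) \<longlonglongrightarrow> k x * w t"
    proof (rule AE_I2)
      fix t
      have "(\<lambda>n. x - \<delta> n *\<^sub>R t) \<longlonglongrightarrow> x - 0 *\<^sub>R t" by (intro tendsto_intros \<delta>)
      thus "(\<lambda>n. k (x - \<delta> n *\<^sub>R t) * w t) \<longlonglongrightarrow> k x * w t"
        using isCont_tendsto_compose[OF cont] by (intro tendsto_intros) simp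
    qed
    show "AE t in lborel. norm (k (x - \<delta> n *\<^sub>R t) * w t) \<le> B * cmod (w t)" for n
      using bound by (auto simp: norm_mult intro!: mult_right_mono)
  qed (use w in auto)
  thus ?thesis by (simp add: dilated_conv_def[abs_def])
qed

lemma tendsto_integral_mult_dilated_conv:
  assumes h: "integrable lborel h" and w: "integrable lborel w"
    and [measurable]: "k \<in> borel_measurable borel" and bound: "\<And>x. cmod (k x) \<le> B"
    and cont: "AE x in lborel. isCont k x" and \<delta>: "\<delta> \<longlonglongrightarrow> 0"
  shows "(\<lambda>n. LBINT x. h x * dilated_conv (\<delta> n) k w x) \<longlonglongrightarrow> (LBINT x. h x * (k x * (LBINT t. w t)))"
proof (rule integral_dominated_convergence[where w = "\<lambda>x. cmod (h x) * (B * (LBINT t. cmod (w t)))"])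
  have [measurable]: "h \<in> borel_measurable borel" "w \<in> borel_measurable borel"
    using borel_measurable_integrable[OF h] borel_measurable_integrable[OF w] by auto
  show "(\<lambda>x. h x * (k x * (LBINT t. w t))) \<in> borel_measurable lborel"
    "(\<lambda>x. h x * dilated_conv (\<delta> n) k w x) \<in> borel_measurable lborel" for n
    by measurable
  show "AE x in lborel. (\<lambda>n. h x * dilated_conv (\<delta> n) k w x) \<longlonglongrightarrow> h x * (k x * (LBINT t. w t))"
    using cont
  proof eventually_elim
    case (elim x)
    show ?case by (intro tendsto_intros dilated_conv_tendsto[OF _ w bound elim \<delta>]) simp
  qed
  show "AE x in lborel. norm (h x * dilated_conv (\<delta> n) k w x) \<le> cmod (h x) * (B * (LBINT t. cmod (w t)))" for n
    unfolding norm_mult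
    by (intro AE_I2 mult_left_mono norm_dilated_conv_le[OF _ w bound]) auto
qed (use h in auto)

lemma dilated_conv_eq_0:
  assumes "\<And>z. k z \<noteq> 0 \<Longrightarrow> \<bar>\<delta>\<bar> * R < dist x z" and "\<And>t. w t \<noteq> 0 \<Longrightarrow> norm t \<le> R"
  shows "dilated_conv \<delta> k w x = 0"
proof -
  have "k (x - \<delta> *\<^sub>R t) * w t = 0" for t
    using assms(1)[of "x - \<delta> *\<^sub>R t"] assms(2)[of t] mult_left_mono[of "norm t" R "\<bar>\<delta>\<bar>"]
    by (force simp: dist_norm)
  thus ?thesis by (simp only: dilated_conv_def Bochner_Integration.integral_zero)
qed

lemma norm_integral_mult_dilated_conv_le:
  fixes u v w :: "'a::euclidean_space \<Rightarrow> complex"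
  assumes v: "square_integrable lborel v" and u: "square_integrable lborel u" and w: "integrable lborel w"
  shows "cmod (LBINT x. v x * dilated_conv \<delta> u w x) \<le> L2_norm lborel v * L2_norm lborel u * (LBINT t. cmod (w t))"
proof -
  let ?C = "L2_norm lborel v * L2_norm lborel u"
  let ?f = "\<lambda>t x. w t * (v x * u (x - \<delta> *\<^sub>R t))"
  note [measurable] = v[THEN borel_measurable_square_integrable] u[THEN borel_measurable_square_integrable]
    borel_measurable_integrable[OF w]
  have inner_le: "(LBINT x. cmod (v x * u (x - \<delta> *\<^sub>R t))) \<le> ?C" for t
    using L2_Cauchy_Schwarz[OF v square_integrable_translate[OF u]] by (simp add: L2_norm_translate)
  have f_le: "(LBINT x. cmod (?f t x)) \<le> cmod (w t) * ?C" for t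
    using mult_left_mono[OF inner_le, of "cmod (w t)" t] by (simp add: norm_mult)
  have pair: "integrable (lborel \<Otimes>\<^sub>M lborel) (\<lambda>(t, x). ?f t x)"
  proof (rule lborel_pair.Fubini_integrable)
    show "integrable lborel (\<lambda>t. \<integral>x. norm (case (t, x) of (t, x) \<Rightarrow> ?f t x) \<partial>lborel)"
    proof (rule Bochner_Integration.integrable_bound)
      show "integrable lborel (\<lambda>t. cmod (w t) * ?C)" using w by simp
      show "AE t in lborel. norm (\<integral>x. norm (case (t, x) of (t, x) \<Rightarrow> ?f t x) \<partial>lborel) \<le> norm (cmod (w t) * ?C)"
        using f_le by (intro AE_I2) (auto intro: order_trans[OF _ abs_ge_self])
    qed measurable
    show "AE t in lborel. integrable lborel (\<lambda>x. case (t, x) of (t, x) \<Rightarrow> ?f t x)"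
      using integrable_mult_square_integrable[OF v square_integrable_translate[OF u]] by simp
  qed measurable
  have "(LBINT x. v x * dilated_conv \<delta> u w x) = (LBINT x. (LBINT t. ?f t x))"
    unfolding dilated_conv_def integral_mult_right_zero[symmetric] by (simp only: mult_ac)
  also have "\<dots> = (LBINT t. (LBINT x. ?f t x))"
    using lborel_pair.Fubini_integral[OF pair] by simp
  also have "cmod \<dots> \<le> (LBINT t. cmod (LBINT x. ?f t x))" by (rule integral_norm_bound)
  also have "\<dots> \<le> (LBINT t. cmod (w t) * ?C)"
  proof (rule integral_mono_AE')
    show "AE t in lborel. cmod (LBINT x. ?f t x) \<le> cmod (w t) * ?C"
      by (intro AE_I2 order_trans[OF integral_norm_bound f_le])
  qed (use w in auto)
  finally show ?thesis by (simp add: mult.commute)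
qed

section \<open>Gaussian regularisation, inversion and uniqueness\<close>

lemma
  fixes a w :: real
  assumes a: "a > 0"
  shows integrable_exp_square_cis: "integrable lborel (\<lambda>t. complex_of_real (exp (- (a * t\<^sup>2))) * cis (w * t))"
    and integral_exp_square_cis: "(LBINT t. complex_of_real (exp (- (a * t\<^sup>2))) * cis (w * t))
      = complex_of_real (sqrt (pi / a) * exp (- (w\<^sup>2 / (4 * a))))"
proof -
  define c where "c = sqrt (2 * a)"
  have c: "c > 0" "c\<^sup>2 = 2 * a" using a by (auto simp: c_def)
  define F where "F x = complex_of_real (std_normal_density x) * cis (w / c * x)" for x
  have F: "integrable lborel F"
    unfolding F_def by (intro integrable_mult_cis integrable_of_real integrable_normal_density) auto
  have F_scaled: "F (0 + c * t) = (1 / sqrt (2 * pi)) *\<^sub>R (complex_of_real (exp (- (a * t\<^sup>2))) * cis (w * t))" for t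
    using c by (simp add: F_def std_normal_density_def power_mult_distrib scaleR_conv_of_real)
  have "integrable lborel (\<lambda>t. sqrt (2 * pi) *\<^sub>R F (0 + c * t))"
    using lborel_integrable_real_affine[OF F, of c 0] c by (intro integrable_scaleR_right) simp
  thus "integrable lborel (\<lambda>t. complex_of_real (exp (- (a * t\<^sup>2))) * cis (w * t))"
    unfolding F_scaled by simp
  have "(LBINT x. F x) = char std_normal_distribution (w / c)"
    unfolding char_def F_def by (subst integral_density) (auto simp: cis_conv_exp scaleR_conv_of_real)
  also have "\<dots> = complex_of_real (exp (- (w\<^sup>2 / (4 * a))))"
    using c by (simp add: char_std_normal_distribution power_divide)
  finally have "complex_of_real (exp (- (w\<^sup>2 / (4 * a))))
      = (c / sqrt (2 * pi)) *\<^sub>R (LBINT t. complex_of_real (exp (- (a * t\<^sup>2))) * cis (w * t))"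
    using lborel_integral_real_affine[of c F 0] c(1) unfolding F_scaled by simp
  moreover have "sqrt (pi / a) * (c / sqrt (2 * pi)) = 1"
    using a by (simp add: c_def real_sqrt_divide real_sqrt_mult)
  ultimately have "sqrt (pi / a) *\<^sub>R complex_of_real (exp (- (w\<^sup>2 / (4 * a))))
      = (LBINT t. complex_of_real (exp (- (a * t\<^sup>2))) * cis (w * t))"
    by (simp only: scaleR_scaleR mult.assoc[symmetric] scaleR_one)
  thus "(LBINT t. complex_of_real (exp (- (a * t\<^sup>2))) * cis (w * t))
      = complex_of_real (sqrt (pi / a) * exp (- (w\<^sup>2 / (4 * a))))"
    by (simp add: scaleR_conv_of_real)
qed

lemma
  fixes \<omega> :: "'a::euclidean_space"
  assumes a: "a > 0"
  shows integrable_exp_norm_square: "integrable lborel (\<lambda>x::'a. exp (- (a * (norm x)\<^sup>2)))"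
    and ft_exp_norm_square: "ft (\<lambda>x. complex_of_real (exp (- (a * (norm x)\<^sup>2)))) \<omega>
      = complex_of_real ((pi / a) powr (DIM('a) / 2) * exp (- ((norm \<omega>)\<^sup>2 / (4 * a))))"
proof -
  define f where "f w b t = complex_of_real (exp (- (a * t\<^sup>2))) * cis ((w \<bullet> b) * t)"
    for w b :: 'a and t :: real
  have f: "integrable lborel (f w b)" for w b
    unfolding f_def by (rule integrable_exp_square_cis[OF a])
  have "complex_of_real (exp (- (a * (norm x)\<^sup>2))) = (\<Prod>b\<in>Basis. complex_of_real (exp (- (a * (x \<bullet> b)\<^sup>2))))" for x :: 'a
    unfolding of_real_prod[symmetric] exp_sum[OF finite_Basis, symmetric]
    by (simp add: norm_square_eq_sum_Basis sum_distrib_left sum_negf)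
  hence prod_f: "complex_of_real (exp (- (a * (norm x)\<^sup>2))) * cis (w \<bullet> x) = (\<Prod>b\<in>Basis. f w b (x \<bullet> b))" for w x
    by (simp add: f_def prod.distrib cis_inner_eq_prod_Basis)
  have "integrable lborel (\<lambda>x. \<Prod>b\<in>Basis. f 0 b (x \<bullet> b))"
    by (rule lborel_integrable_prod_Basis) (rule f)
  thus "integrable lborel (\<lambda>x::'a. exp (- (a * (norm x)\<^sup>2)))"
    unfolding prod_f[symmetric] by (simp add: complex_of_real_integrable_eq)
  have "ft (\<lambda>x. complex_of_real (exp (- (a * (norm x)\<^sup>2)))) \<omega> = (LBINT x. (\<Prod>b\<in>Basis. f (- \<omega>) b (x \<bullet> b)))"
    unfolding ft_def prod_f[symmetric] by simp
  also have "\<dots> = (\<Prod>b\<in>Basis. \<integral>t. f (- \<omega>) b t \<partial>lborel)"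
    by (rule lborel_integral_prod_Basis) (rule f)
  also have "\<dots> = complex_of_real (\<Prod>b\<in>(Basis::'a set). sqrt (pi / a) * exp (- ((\<omega> \<bullet> b)\<^sup>2 / (4 * a))))"
    unfolding f_def integral_exp_square_cis[OF a] of_real_prod by simp
  also have "(\<Prod>b\<in>(Basis::'a set). sqrt (pi / a) * exp (- ((\<omega> \<bullet> b)\<^sup>2 / (4 * a))))
      = sqrt (pi / a) ^ DIM('a) * exp (- ((norm \<omega>)\<^sup>2 / (4 * a)))"
    unfolding prod.distrib exp_sum[OF finite_Basis, symmetric]
    by (simp add: norm_square_eq_sum_Basis sum_divide_distrib sum_negf)
  also have "sqrt (pi / a) ^ DIM('a) = (pi / a) powr (DIM('a) / 2)"
    using a by (simp add: powr_half_sqrt[symmetric] powr_realpow[symmetric] powr_powr)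
  finally show "ft (\<lambda>x. complex_of_real (exp (- (a * (norm x)\<^sup>2)))) \<omega>
      = complex_of_real ((pi / a) powr (DIM('a) / 2) * exp (- ((norm \<omega>)\<^sup>2 / (4 * a))))" .
qed

definition gaussian :: "'a::euclidean_space \<Rightarrow> complex" where
  "gaussian x = complex_of_real (exp (- (norm x)\<^sup>2))"

lemma borel_measurable_gaussian [measurable]: "gaussian \<in> borel_measurable borel"
  unfolding gaussian_def by measurable

lemma integrable_gaussian: "integrable lborel (gaussian :: 'a::euclidean_space \<Rightarrow> complex)"
  unfolding gaussian_def using integrable_exp_norm_square[of 1, where 'a = 'a] by simp

lemma ft_gaussian:
  "ft gaussian (z::'a::euclidean_space) = complex_of_real (pi powr (DIM('a) / 2) * exp (- ((norm z)\<^sup>2 / 4)))"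
  unfolding gaussian_def using ft_exp_norm_square[of 1 z] by simp

lemma
  shows integrable_ft_gaussian: "integrable lborel (ft gaussian :: 'a::euclidean_space \<Rightarrow> complex)"
    and integral_ft_gaussian: "(LBINT z. ft gaussian (z::'a)) = (2 * pi) ^ DIM('a)"
proof -
  have "integrable lborel (\<lambda>z::'a. exp (- ((norm z)\<^sup>2 / 4)))"
    using integrable_exp_norm_square[of "1 / 4", where 'a = 'a] by simp
  thus "integrable lborel (ft gaussian :: 'a \<Rightarrow> complex)"
    unfolding ft_gaussian[abs_def] by simp
  have "(LBINT z. exp (- ((norm (z::'a))\<^sup>2 / 4))) = (4 * pi) powr (DIM('a) / 2)"
    using ft_exp_norm_square[of "1 / 4" "0 :: 'a"] unfolding of_real_eq_iff[where 'a = complex, symmetric] 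
    by (simp add: ft_def mult.commute)
  hence "(LBINT z. ft gaussian (z::'a)) = complex_of_real (pi powr (DIM('a) / 2) * (4 * pi) powr (DIM('a) / 2))"
    unfolding ft_gaussian[abs_def] integral_complex_of_real by simp
  also have "pi powr (DIM('a) / 2) * (4 * pi) powr (DIM('a) / 2) = ((2 * pi) powr 2) powr (DIM('a) / 2)"
    by (subst powr_mult[symmetric]) (simp add: power2_eq_square mult_ac)
  also have "\<dots> = (2 * pi) ^ DIM('a)"
    by (simp add: powr_powr powr_realpow del: powr_numeral)
  finally show "(LBINT z. ft gaussian (z::'a)) = (2 * pi) ^ DIM('a)" by simp
qed

lemma integral_norm_ft_gaussian: "(LBINT z. cmod (ft gaussian (z::'a::euclidean_space))) = (2 * pi) ^ DIM('a)"
proof -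
  have "complex_of_real (LBINT z. cmod (ft gaussian (z::'a))) = (LBINT z. ft gaussian (z::'a))"
    unfolding integral_complex_of_real[symmetric] by (simp add: ft_gaussian norm_mult)
  also have "\<dots> = complex_of_real ((2 * pi) ^ DIM('a))" by (simp add: integral_ft_gaussian)
  finally show ?thesis by (simp only: of_real_eq_iff)
qed

lemma integral_ft_gaussian_regularised:
  fixes u :: "'a::euclidean_space \<Rightarrow> complex"
  assumes "integrable lborel u" and "\<delta> \<noteq> 0"
  shows "(LBINT \<omega>. ft u \<omega> * (gaussian (\<delta> *\<^sub>R \<omega>) * cis (\<omega> \<bullet> y))) = dilated_conv \<delta> u (ft gaussian) y"
proof -
  have "(\<lambda>z. ft gaussian (- z)) = (ft gaussian :: 'a \<Rightarrow> complex)"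
    by (simp add: fun_eq_iff ft_gaussian)
  thus ?thesis using integral_ft_dilated[OF assms(1) integrable_gaussian assms(2), of y] by simp
qed

lemma gaussian_dilated_tendsto:
  assumes "\<delta> \<longlonglongrightarrow> 0"
  shows "(\<lambda>n. gaussian (\<delta> n *\<^sub>R \<omega>)) \<longlonglongrightarrow> 1"
proof -
  have "(\<lambda>n. gaussian (\<delta> n *\<^sub>R \<omega>)) \<longlonglongrightarrow> complex_of_real (exp (- (norm (0 *\<^sub>R \<omega>))\<^sup>2))"
    unfolding gaussian_def by (intro tendsto_intros assms)
  thus ?thesis by simp
qed

theorem ft_inversion:
  fixes u :: "'a::euclidean_space \<Rightarrow> complex"
  assumes u: "integrable lborel u" and bound: "\<And>x. cmod (u x) \<le> B" and cont: "isCont u y"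
    and ft_u: "integrable lborel (ft u)"
  shows "(LBINT \<omega>. ft u \<omega> * cis (\<omega> \<bullet> y)) = (2 * pi) ^ DIM('a) * u y"
proof -
  have [measurable]: "u \<in> borel_measurable borel" using borel_measurable_integrable[OF u] by simp
  define \<delta> where "\<delta> n = inverse (real (Suc n))" for n
  have \<delta>: "\<delta> \<longlonglongrightarrow> 0" unfolding \<delta>_def by (rule LIMSEQ_inverse_real_of_nat)
  have "(\<lambda>n. LBINT \<omega>. ft u \<omega> * (gaussian (\<delta> n *\<^sub>R \<omega>) * cis (\<omega> \<bullet> y))) \<longlonglongrightarrow> (LBINT \<omega>. ft u \<omega> * cis (\<omega> \<bullet> y))"
  proof (rule integral_dominated_convergence[where w = "\<lambda>\<omega>. cmod (ft u \<omega>)"])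
    show "AE \<omega> in lborel. (\<lambda>n. ft u \<omega> * (gaussian (\<delta> n *\<^sub>R \<omega>) * cis (\<omega> \<bullet> y))) \<longlonglongrightarrow> ft u \<omega> * cis (\<omega> \<bullet> y)"
    proof (rule AE_I2)
      fix \<omega>
      have "(\<lambda>n. ft u \<omega> * (gaussian (\<delta> n *\<^sub>R \<omega>) * cis (\<omega> \<bullet> y))) \<longlonglongrightarrow> ft u \<omega> * (1 * cis (\<omega> \<bullet> y))"
        by (intro tendsto_intros gaussian_dilated_tendsto \<delta>)
      thus "(\<lambda>n. ft u \<omega> * (gaussian (\<delta> n *\<^sub>R \<omega>) * cis (\<omega> \<bullet> y))) \<longlonglongrightarrow> ft u \<omega> * cis (\<omega> \<bullet> y)" by simp
    qed
    show "AE \<omega> in lborel. norm (ft u \<omega> * (gaussian (\<delta> n *\<^sub>R \<omega>) * cis (\<omega> \<bullet> y))) \<le> cmod (ft u \<omega>)" for n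
      by (intro AE_I2) (auto simp: norm_mult gaussian_def intro!: mult_left_le)
  qed (use ft_u in auto)
  moreover have "(\<lambda>n. dilated_conv (\<delta> n) u (ft gaussian) y) \<longlonglongrightarrow> u y * (2 * pi) ^ DIM('a)"
    using dilated_conv_tendsto[OF _ integrable_ft_gaussian bound cont \<delta>] by (simp add: integral_ft_gaussian)
  moreover have "(LBINT \<omega>. ft u \<omega> * (gaussian (\<delta> n *\<^sub>R \<omega>) * cis (\<omega> \<bullet> y)))
      = dilated_conv (\<delta> n) u (ft gaussian) y" for n
    by (rule integral_ft_gaussian_regularised[OF u]) (simp add: \<delta>_def)
  ultimately show ?thesis
    by (auto simp: mult.commute intro: LIMSEQ_unique)
qed

theorem ft_injective:
  fixes h :: "'a::euclidean_space \<Rightarrow> complex"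
  assumes h: "integrable lborel h" and zero: "\<And>\<omega>. ft h \<omega> = 0"
  shows "AE x in lborel. h x = 0"
proof (rule AE_zero_if_box_integrals_zero[OF h])
  fix a b :: 'a
  define k where "k x = complex_of_real (indicator (box a b) x)" for x
  have [measurable]: "k \<in> borel_measurable borel" unfolding k_def by measurable
  have k_bound: "cmod (k x) \<le> 1" for x by (simp add: k_def)
  define \<delta> where "\<delta> n = inverse (real (Suc n))" for n
  have "(\<lambda>n. LBINT x. h x * dilated_conv (\<delta> n) k (ft gaussian) x)
      \<longlonglongrightarrow> (LBINT x. h x * (k x * (LBINT t. ft gaussian (t::'a))))"
  proof (rule tendsto_integral_mult_dilated_conv[OF h integrable_ft_gaussian _ k_bound])
    show "AE x in lborel. isCont k x"
      unfolding k_def by (rule AE_isCont_indicator_convex[OF convex_box(2)])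
    show "\<delta> \<longlonglongrightarrow> 0" unfolding \<delta>_def by (rule LIMSEQ_inverse_real_of_nat)
  qed simp
  moreover have "(LBINT x. h x * dilated_conv (\<delta> n) k (ft gaussian) x) = 0" for n
  proof -
    have "- \<delta> n \<noteq> 0" by (simp add: \<delta>_def)
    hence "dilated_conv (- \<delta> n) h (ft gaussian) y = 0" for y
      by (subst integral_ft_gaussian_regularised[OF h, symmetric]) (simp_all add: zero)
    thus ?thesis
      by (simp add: dilated_conv_adjoint[OF h integrable_ft_gaussian _ k_bound])
  qed
  ultimately have "(LBINT x. h x * (k x * (2 * pi) ^ DIM('a))) = 0"
    by (simp add: integral_ft_gaussian LIMSEQ_const_iff)
  moreover have "(LBINT x. h x * (k x * (2 * pi) ^ DIM('a))) = (LINT x:box a b|lborel. h x) * (2 * pi) ^ DIM('a)"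
    unfolding set_lebesgue_integral_def integral_mult_left_zero[symmetric]
    by (intro Bochner_Integration.integral_cong) (auto simp: k_def scaleR_conv_of_real)
  ultimately show "(LINT x:box a b|lborel. h x) = 0" by simp
qed

section \<open>The Fourier transform of square-integrable functions\<close>

lemma ft_uminus: "ft (\<lambda>x. u (- x)) \<omega> = ft u (- \<omega>)"
  using ft_reflect[of u 0 \<omega>] by simp

lemma integral_cnj_ft_mult:
  assumes u: "integrable lborel u" and v: "integrable lborel v"
  shows "(LBINT \<omega>. cnj (ft u \<omega>) * v \<omega>) = (LBINT x. cnj (u x) * (LBINT \<omega>. v \<omega> * cis (\<omega> \<bullet> x)))"
proof -
  have "(LBINT \<omega>. cnj (ft u \<omega>) * v \<omega>) = (LBINT \<omega>. ft (\<lambda>x. cnj (u x)) \<omega> * v (- \<omega>))"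
    using lborel_integral_uminus[of "\<lambda>\<omega>. cnj (ft u \<omega>) * v \<omega>"] by (simp add: cnj_ft)
  also have "\<dots> = (LBINT x. cnj (u x) * ft (\<lambda>\<omega>. v (- \<omega>)) x)"
    using u v by (intro ft_duality) (auto simp: lborel_integrable_uminus_iff)
  also have "\<dots> = (LBINT x. cnj (u x) * (LBINT \<omega>. v \<omega> * cis (\<omega> \<bullet> x)))"
    unfolding ft_uminus ft_def by (simp add: inner_commute)
  finally show ?thesis .
qed

lemma ft_gaussian_damped_L2_bound:
  fixes u :: "'a::euclidean_space \<Rightarrow> complex"
  assumes u: "integrable lborel u" "square_integrable lborel u" and "\<delta> \<noteq> 0"
  defines "w \<equiv> \<lambda>\<omega>. ft u \<omega> * complex_of_real (exp (- ((norm (\<delta> *\<^sub>R \<omega>))\<^sup>2 / 2)))"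
  shows "square_integrable lborel w" and "L2_norm lborel w \<le> sqrt ((2 * pi) ^ DIM('a)) * L2_norm lborel u"
proof -
  have [measurable]: "u \<in> borel_measurable borel" using borel_measurable_integrable[OF u(1)] by simp
  define U where "U = (LBINT x. cmod (u x))"
  have ft_u_le: "cmod (ft u \<omega>) \<le> U" for \<omega> unfolding U_def by (rule norm_ft_le)
  have damped: "integrable lborel (\<lambda>\<omega>. ft u \<omega> * gaussian (\<delta> *\<^sub>R \<omega>))"
    using integrable_mult_bounded[of lborel "\<lambda>\<omega>. gaussian (0 + \<delta> *\<^sub>R \<omega>)" "ft u" U]
      lborel_integrable_affine[OF integrable_gaussian \<open>\<delta> \<noteq> 0\<close>, of 0] ft_u_le
    by (simp add: mult.commute)
  have w_square: "cnj (ft u \<omega>) * (ft u \<omega> * gaussian (\<delta> *\<^sub>R \<omega>)) = complex_of_real ((cmod (w \<omega>))\<^sup>2)" for \<omega>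
  proof -
    have "exp (- (norm (\<delta> *\<^sub>R \<omega>))\<^sup>2) = exp (- ((norm (\<delta> *\<^sub>R \<omega>))\<^sup>2 / 2)) * exp (- ((norm (\<delta> *\<^sub>R \<omega>))\<^sup>2 / 2))"
      by (simp flip: exp_add)
    thus ?thesis
      unfolding complex_norm_square w_def gaussian_def by (simp add: mult_ac)
  qed
  have "integrable lborel (\<lambda>\<omega>. cnj (ft u \<omega>) * (ft u \<omega> * gaussian (\<delta> *\<^sub>R \<omega>)))"
    using integrable_mult_bounded[OF damped, of "\<lambda>\<omega>. cnj (ft u \<omega>)" U] ft_u_le by (simp add: mult.commute)
  thus w: "square_integrable lborel w"
    unfolding w_square complex_of_real_integrable_eq square_integrable_def by (simp add: w_def)
  have "complex_of_real ((L2_norm lborel w)\<^sup>2) = (LBINT x. cnj (u x) * dilated_conv \<delta> u (ft gaussian) x)"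
    unfolding power2_L2_norm integral_complex_of_real[symmetric] w_square[symmetric]
      integral_cnj_ft_mult[OF u(1) damped]
    by (simp add: mult.assoc integral_ft_gaussian_regularised[OF u(1) \<open>\<delta> \<noteq> 0\<close>])
  hence "(L2_norm lborel w)\<^sup>2 = cmod (LBINT x. cnj (u x) * dilated_conv \<delta> u (ft gaussian) x)"
    by (metis abs_of_nonneg norm_of_real zero_le_power2)
  also have "\<dots> \<le> L2_norm lborel (\<lambda>x. cnj (u x)) * L2_norm lborel u * (LBINT t. cmod (ft gaussian (t::'a)))"
    by (intro norm_integral_mult_dilated_conv_le square_integrable_cnj u integrable_ft_gaussian)
  also have "\<dots> = (sqrt ((2 * pi) ^ DIM('a)) * L2_norm lborel u)\<^sup>2"
    by (simp add: integral_norm_ft_gaussian power_mult_distrib power2_eq_square[of "L2_norm _ _"] L2_norm_def)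
  finally show "L2_norm lborel w \<le> sqrt ((2 * pi) ^ DIM('a)) * L2_norm lborel u"
    by (rule power2_le_imp_le) simp
qed

theorem
  fixes u :: "'a::euclidean_space \<Rightarrow> complex"
  assumes u: "integrable lborel u" "square_integrable lborel u"
  shows square_integrable_ft: "square_integrable lborel (ft u)"
    and L2_norm_ft_le: "L2_norm lborel (ft u) \<le> sqrt ((2 * pi) ^ DIM('a)) * L2_norm lborel u"
proof -
  have [measurable]: "u \<in> borel_measurable borel" using borel_measurable_integrable[OF u(1)] by simp
  define w where "w n \<omega> = ft u \<omega> * complex_of_real (exp (- ((norm (inverse (real (Suc n)) *\<^sub>R \<omega>))\<^sup>2 / 2)))" for n \<omega>
  have w: "square_integrable lborel (w n)" "L2_norm lborel (w n) \<le> sqrt ((2 * pi) ^ DIM('a)) * L2_norm lborel u" for n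
    unfolding w_def using ft_gaussian_damped_L2_bound[OF u, of "inverse (real (Suc n))"] by auto
  have lim: "(\<lambda>n. w n \<omega>) \<longlonglongrightarrow> ft u \<omega>" for \<omega>
  proof -
    have "(\<lambda>n. w n \<omega>) \<longlonglongrightarrow> ft u \<omega> * complex_of_real (exp (- ((norm (0 *\<^sub>R \<omega>))\<^sup>2 / 2)))"
      unfolding w_def by (intro tendsto_intros LIMSEQ_inverse_real_of_nat) auto
    thus ?thesis by simp
  qed
  show "square_integrable lborel (ft u)" "L2_norm lborel (ft u) \<le> sqrt ((2 * pi) ^ DIM('a)) * L2_norm lborel u"
    by (rule L2_Fatou[OF w(1) _ AE_I2[OF lim] always_eventually[OF allI[OF w(2)]]]; simp)+
qed

definition truncate :: "real \<Rightarrow> ('a::euclidean_space \<Rightarrow> complex) \<Rightarrow> 'a \<Rightarrow> complex" where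
  "truncate R f x = indicator (ball 0 R) x *\<^sub>R f x"

lemma integrable_truncate: "square_integrable lborel f \<Longrightarrow> integrable lborel (truncate R f)"
  unfolding truncate_def using emeasure_lborel_ball_finite
  by (intro integrable_indicator_square_integrable) (auto simp: less_top)

lemma norm_truncate_le: "cmod (truncate R f x) \<le> cmod (f x)"
  by (simp add: truncate_def split: split_indicator)

lemma square_integrable_truncate:
  assumes "square_integrable lborel f"
  shows "square_integrable lborel (truncate R f)"
  using borel_measurable_integrable[OF integrable_truncate[OF assms, of R]]
  by (intro square_integrable_bound[OF assms, where C = 1]) (auto simp: norm_truncate_le)

lemma truncate_tendsto: "(\<lambda>n. truncate (real n) f x) \<longlonglongrightarrow> f x"
proof (rule tendsto_eventually)
  obtain N :: nat where "norm x < real N" using reals_Archimedean2 by blast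
  thus "\<forall>\<^sub>F n in sequentially. truncate (real n) f x = f x"
    by (intro eventually_sequentiallyI[of N]) (auto simp: truncate_def)
qed

lemma L2_tendsto_truncate:
  fixes f :: "'a::euclidean_space \<Rightarrow> complex"
  assumes f: "square_integrable lborel f"
  shows "L2_tendsto lborel (\<lambda>n. truncate (real n) f) f"
proof -
  note [measurable] = f[THEN borel_measurable_square_integrable]
    square_integrable_truncate[OF f, THEN borel_measurable_square_integrable]
  have "(\<lambda>n. \<integral>x. (cmod (truncate (real n) f x - f x))\<^sup>2 \<partial>lborel) \<longlonglongrightarrow> (\<integral>x. 0 \<partial>(lborel :: 'a measure))"
  proof (rule integral_dominated_convergence[where w = "\<lambda>x. (cmod (f x))\<^sup>2"])
    show "AE x in lborel. (\<lambda>n. (cmod (truncate (real n) f x - f x))\<^sup>2) \<longlonglongrightarrow> 0"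
    proof (rule AE_I2)
      fix x
      have "(\<lambda>n. (cmod (truncate (real n) f x - f x))\<^sup>2) \<longlonglongrightarrow> (cmod (f x - f x))\<^sup>2"
        by (intro tendsto_intros truncate_tendsto)
      thus "(\<lambda>n. (cmod (truncate (real n) f x - f x))\<^sup>2) \<longlonglongrightarrow> 0" by simp
    qed
    show "AE x in lborel. norm ((cmod (truncate (real n) f x - f x))\<^sup>2) \<le> (cmod (f x))\<^sup>2" for n
      by (intro AE_I2) (auto simp: truncate_def split: split_indicator)
  qed (use integrable_norm_square[OF f] in auto)
  hence "(\<lambda>n. sqrt (\<integral>x. (cmod (truncate (real n) f x - f x))\<^sup>2 \<partial>lborel)) \<longlonglongrightarrow> sqrt 0"
    by (intro tendsto_real_sqrt) simp
  thus ?thesis by (simp add: L2_tendsto_def L2_norm_def)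
qed

definition has_L2_ft :: "('a::euclidean_space \<Rightarrow> complex) \<Rightarrow> ('a \<Rightarrow> complex) \<Rightarrow> bool" where
  "has_L2_ft f F \<longleftrightarrow> square_integrable lborel F \<and> L2_tendsto lborel (\<lambda>n. ft (truncate (real n) f)) F"

lemma square_integrable_ft_truncate:
  "square_integrable lborel f \<Longrightarrow> square_integrable lborel (ft (truncate R f))"
  by (intro square_integrable_ft integrable_truncate square_integrable_truncate)

lemma has_L2_ft_exists:
  fixes f :: "'a::euclidean_space \<Rightarrow> complex"
  assumes f: "square_integrable lborel f"
  shows "\<exists>F. has_L2_ft f F"
proof -
  let ?c = "sqrt ((2 * pi) ^ DIM('a))" and ?P = "\<lambda>n. truncate (real n) f"
  have P: "integrable lborel (?P n)" "square_integrable lborel (?P n)" for n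
    using f by (auto intro: integrable_truncate square_integrable_truncate)
  have "L2_Cauchy lborel ?P"
    by (rule L2_tendsto_imp_L2_Cauchy[OF P(2) f L2_tendsto_truncate[OF f]])
  have "L2_Cauchy lborel (\<lambda>n. ft (?P n))"
    unfolding L2_Cauchy_def
  proof (intro allI impI)
    fix e :: real assume "e > 0"
    hence "e / ?c > 0" by simp
    then obtain N where N: "\<forall>m\<ge>N. \<forall>n\<ge>N. L2_norm lborel (\<lambda>x. ?P m x - ?P n x) < e / ?c"
      using \<open>L2_Cauchy lborel ?P\<close> unfolding L2_Cauchy_def by blast
    have "L2_norm lborel (\<lambda>\<omega>. ft (?P m) \<omega> - ft (?P n) \<omega>) < e" if "m \<ge> N" "n \<ge> N" for m n
    proof -
      have "(\<lambda>\<omega>. ft (?P m) \<omega> - ft (?P n) \<omega>) = ft (\<lambda>x. ?P m x - ?P n x)"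
        by (simp add: fun_eq_iff ft_diff P(1))
      hence "L2_norm lborel (\<lambda>\<omega>. ft (?P m) \<omega> - ft (?P n) \<omega>) \<le> ?c * L2_norm lborel (\<lambda>x. ?P m x - ?P n x)"
        using L2_norm_ft_le[of "\<lambda>x. ?P m x - ?P n x"] P by (simp add: square_integrable_diff)
      also have "\<dots> < ?c * (e / ?c)"
        using N that by (intro mult_strict_left_mono) auto
      finally show ?thesis by simp
    qed
    thus "\<exists>N. \<forall>m\<ge>N. \<forall>n\<ge>N. L2_norm lborel (\<lambda>\<omega>. ft (?P m) \<omega> - ft (?P n) \<omega>) < e" by blast
  qed
  with square_integrable_ft_truncate[OF f] obtain F
    where "square_integrable lborel F" "L2_tendsto lborel (\<lambda>n. ft (?P n)) F"
    by (rule lborel.L2_complete)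
  thus ?thesis unfolding has_L2_ft_def by blast
qed

lemma has_L2_ft_duality:
  assumes F: "has_L2_ft f F" and f: "square_integrable lborel f"
    and \<psi>: "integrable lborel \<psi>" "square_integrable lborel \<psi>"
  shows "(LBINT x. F x * \<psi> x) = (LBINT \<omega>. f \<omega> * ft \<psi> \<omega>)"
proof -
  have "(\<lambda>n. LBINT x. ft (truncate (real n) f) x * \<psi> x) \<longlonglongrightarrow> (LBINT x. F x * \<psi> x)"
    using F square_integrable_ft_truncate[OF f] \<psi>(2)
    by (intro tendsto_integral_mult_L2) (auto simp: has_L2_ft_def)
  moreover have "(\<lambda>n. LBINT x. truncate (real n) f x * ft \<psi> x) \<longlonglongrightarrow> (LBINT x. f x * ft \<psi> x)"
    by (intro tendsto_integral_mult_L2 L2_tendsto_truncate square_integrable_truncate square_integrable_ft f \<psi>)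
  ultimately show ?thesis
    unfolding ft_duality[OF integrable_truncate[OF f] \<psi>(1)] by (rule LIMSEQ_unique)
qed

lemma has_L2_ft_cong_AE:
  assumes F: "has_L2_ft f F" and G: "G \<in> borel_measurable borel" and AE_eq: "AE x in lborel. F x = G x"
    and f: "square_integrable lborel f"
  shows "has_L2_ft f G"
proof -
  note [measurable] = square_integrable_ft_truncate[OF f, THEN borel_measurable_square_integrable] G
  have F2: "square_integrable lborel F" and lim: "L2_tendsto lborel (\<lambda>n. ft (truncate (real n) f)) F"
    using F by (auto simp: has_L2_ft_def)
  note [measurable] = F2[THEN borel_measurable_square_integrable]
  show ?thesis
    using square_integrable_cong_AE[OF F2 _ AE_eq] L2_tendsto_cong_AE[OF _ _ _ lim AE_eq]
    by (simp add: has_L2_ft_def)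
qed

lemma
  shows integrable_modulated_gaussian: "integrable lborel (\<lambda>\<omega>. gaussian \<omega> * cis (\<omega> \<bullet> y))"
    and square_integrable_modulated_gaussian: "square_integrable lborel (\<lambda>\<omega>. gaussian \<omega> * cis (\<omega> \<bullet> y))"
proof -
  show "integrable lborel (\<lambda>\<omega>. gaussian \<omega> * cis (\<omega> \<bullet> y))"
    by (intro integrable_mult_cis integrable_gaussian) simp
  thus "square_integrable lborel (\<lambda>\<omega>. gaussian \<omega> * cis (\<omega> \<bullet> y))"
    by (rule integrable_bounded_imp_square_integrable[where B = 1]) (simp add: gaussian_def norm_mult)
qed

lemma AE_zero_if_modulated_gaussian_integrals_zero:
  assumes d: "square_integrable lborel d"
    and zero: "\<And>y. (LBINT \<omega>. d \<omega> * (gaussian \<omega> * cis (\<omega> \<bullet> y))) = 0"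
  shows "AE \<omega> in lborel. d \<omega> = 0"
proof -
  have "integrable lborel (\<lambda>\<omega>. d \<omega> * gaussian \<omega>)"
    using integrable_mult_square_integrable[OF d square_integrable_modulated_gaussian[of 0]] by simp
  moreover have "ft (\<lambda>\<omega>. d \<omega> * gaussian \<omega>) y = 0" for y
    using zero[of "- y"] by (simp add: ft_def mult.assoc inner_commute)
  ultimately have "AE \<omega> in lborel. d \<omega> * gaussian \<omega> = 0"
    by (rule ft_injective)
  thus ?thesis by eventually_elim (simp add: gaussian_def)
qed

lemma integral_ft_uminus_mult_ft:
  fixes p G :: "'a::euclidean_space \<Rightarrow> complex"
  assumes p: "integrable lborel p" and G: "integrable lborel G" and bound: "\<And>\<omega>. cmod (G \<omega>) \<le> B"
    and cont: "\<And>\<omega>. isCont G \<omega>" and ft_G: "integrable lborel (ft G)"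
  shows "(LBINT x. ft p (- x) * ft G x) = (2 * pi) ^ DIM('a) * (LBINT \<omega>. p \<omega> * G \<omega>)"
proof -
  have "(LBINT x. ft p (- x) * ft G x) = (LBINT x. ft p x * ft G (- x))"
    using lborel_integral_uminus[of "\<lambda>x. ft p x * ft G (- x)"] by simp
  also have "\<dots> = (LBINT \<omega>. p \<omega> * ft (\<lambda>x. ft G (- x)) \<omega>)"
    by (rule ft_duality[OF p]) (simp add: lborel_integrable_uminus_iff ft_G)
  also have "ft (\<lambda>x. ft G (- x)) \<omega> = (2 * pi) ^ DIM('a) * G \<omega>" for \<omega>
    unfolding ft_uminus using ft_inversion[OF G bound cont ft_G, of \<omega>] by (simp add: ft_def inner_commute)
  hence "(LBINT \<omega>. p \<omega> * ft (\<lambda>x. ft G (- x)) \<omega>) = (LBINT \<omega>. (2 * pi) ^ DIM('a) * (p \<omega> * G \<omega>))"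
    by (simp add: mult_ac)
  finally show ?thesis by simp
qed

lemma integrable_ft_modulated_gaussian: "integrable lborel (ft (\<lambda>\<omega>. gaussian \<omega> * cis (\<omega> \<bullet> y)))"
proof -
  have "ft (\<lambda>\<omega>. gaussian \<omega> * cis (\<omega> \<bullet> y)) x = ft gaussian (x - y)" for x
    unfolding ft_def
    by (intro Bochner_Integration.integral_cong)
       (auto simp: mult.assoc cis_mult inner_diff_left inner_commute[of y])
  hence "ft (\<lambda>\<omega>. gaussian \<omega> * cis (\<omega> \<bullet> y)) = (\<lambda>x. ft gaussian (x - y))" by blast
  thus ?thesis
    using lborel_integrable_translate_iff[of "ft gaussian" y] by (simp add: integrable_ft_gaussian)
qed

theorem has_L2_ft_ft_uminus:
  fixes p :: "'a::euclidean_space \<Rightarrow> complex"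
  assumes p: "integrable lborel p" "square_integrable lborel p"
  shows "has_L2_ft (\<lambda>x. ft p (- x)) (\<lambda>\<omega>. (2 * pi) ^ DIM('a) * p \<omega>)"
proof -
  let ?c = "(2 * pi) ^ DIM('a) :: complex"
  have E: "square_integrable lborel (\<lambda>x. ft p (- x))"
    by (intro square_integrable_uminus square_integrable_ft p)
  then obtain F where F: "has_L2_ft (\<lambda>x. ft p (- x)) F" using has_L2_ft_exists by blast
  have integrals_eq: "(LBINT \<omega>. F \<omega> * (gaussian \<omega> * cis (\<omega> \<bullet> y)))
      = ?c * (LBINT \<omega>. p \<omega> * (gaussian \<omega> * cis (\<omega> \<bullet> y)))" for y
  proof -
    have "(LBINT \<omega>. F \<omega> * (gaussian \<omega> * cis (\<omega> \<bullet> y))) = (LBINT x. ft p (- x) * ft (\<lambda>\<omega>. gaussian \<omega> * cis (\<omega> \<bullet> y)) x)"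
      by (rule has_L2_ft_duality[OF F E integrable_modulated_gaussian square_integrable_modulated_gaussian])
    also have "\<dots> = ?c * (LBINT \<omega>. p \<omega> * (gaussian \<omega> * cis (\<omega> \<bullet> y)))"
    proof (rule integral_ft_uminus_mult_ft[OF p(1)
          integrable_modulated_gaussian _ _ integrable_ft_modulated_gaussian])
      show "cmod (gaussian \<omega> * cis (\<omega> \<bullet> y)) \<le> 1" for \<omega> by (simp add: gaussian_def norm_mult)
      show "isCont (\<lambda>\<omega>. gaussian \<omega> * cis (\<omega> \<bullet> y)) \<omega>" for \<omega>
        unfolding gaussian_def isCont_def by (intro tendsto_intros)
    qed
    finally show ?thesis .
  qed
  have "AE \<omega> in lborel. F \<omega> - ?c * p \<omega> = 0"
  proof (rule AE_zero_if_modulated_gaussian_integrals_zero)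
    have F2: "square_integrable lborel F" using F by (simp add: has_L2_ft_def)
    have cp: "square_integrable lborel (\<lambda>\<omega>. ?c * p \<omega>)" by (rule square_integrable_mult_left[OF p(2)])
    show "square_integrable lborel (\<lambda>\<omega>. F \<omega> - ?c * p \<omega>)"
      by (rule square_integrable_diff[OF F2 cp])
    show "(LBINT \<omega>. (F \<omega> - ?c * p \<omega>) * (gaussian \<omega> * cis (\<omega> \<bullet> y))) = 0" for y
      using integrals_eq[of y] integrable_mult_square_integrable[OF F2 square_integrable_modulated_gaussian[of y]]
        integrable_mult_square_integrable[OF cp square_integrable_modulated_gaussian[of y]]
      by (simp add: left_diff_distrib mult.assoc)
  qed
  hence "AE \<omega> in lborel. F \<omega> = ?c * p \<omega>" by eventually_elim simp
  thus ?thesis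
    using p(2)[THEN borel_measurable_square_integrable] by (intro has_L2_ft_cong_AE[OF F _ _ E]) auto
qed

lemma ft_trunc_eq_ft_truncate:
  fixes E :: "'a::euclidean_space \<Rightarrow> real"
  assumes [measurable]: "E \<in> borel_measurable borel"
  shows "ft_trunc E R = ft (truncate R (\<lambda>x. complex_of_real (E x)))"
proof
  fix \<omega>
  have [measurable]: "ball (0::'a) R \<in> sets borel" by simp
  have "ft_trunc E R \<omega> = (LBINT x. indicator (ball 0 R) x *\<^sub>R (E x *\<^sub>R cis (- (\<omega> \<bullet> x))))"
    unfolding ft_trunc_def set_lebesgue_integral_def by (rule integral_completion) measurable
  thus "ft_trunc E R \<omega> = ft (truncate R (\<lambda>x. complex_of_real (E x))) \<omega>"
    by (simp add: ft_def truncate_def scaleR_conv_of_real mult.assoc)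
qed

lemma L2_limit_ft_trunc_iff:
  fixes E :: "'a::euclidean_space \<Rightarrow> real"
  assumes E: "square_integrable lborel (\<lambda>x. complex_of_real (E x))"
    and F: "has_L2_ft (\<lambda>x. complex_of_real (E x)) F" and g: "g \<in> borel_measurable lebesgue"
  shows "(\<lambda>n. \<integral>\<^sup>+\<omega>. ennreal ((cmod (g \<omega> - ft_trunc E (real n) \<omega>))\<^sup>2) \<partial>lebesgue) \<longlonglongrightarrow> 0
    \<longleftrightarrow> (AE \<omega> in lebesgue. g \<omega> = F \<omega>)"
proof -
  let ?u = "\<lambda>n. ft_trunc E (real n)"
  have "(\<lambda>x. Re (complex_of_real (E x))) \<in> borel_measurable borel"
    using E[THEN borel_measurable_square_integrable] by measurable
  hence u_eq: "?u n = ft (truncate (real n) (\<lambda>x. complex_of_real (E x)))" for n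
    by (simp add: ft_trunc_eq_ft_truncate)
  have u: "square_integrable lborel (?u n)" for n
    unfolding u_eq by (rule square_integrable_ft_truncate[OF E])
  have F2: "square_integrable lborel F" and lim: "L2_tendsto lborel ?u F"
    using F unfolding has_L2_ft_def u_eq by auto
  note [measurable] = u[THEN borel_measurable_square_integrable] F2[THEN borel_measurable_square_integrable]
  have uL: "square_integrable lebesgue (?u n)" for n
    using u by (simp add: square_integrable_completion)
  have FL: "square_integrable lebesgue F" and limL: "L2_tendsto lebesgue ?u F"
    using F2 lim by (simp_all add: square_integrable_completion L2_tendsto_completion)
  show ?thesis
  proof
    assume "(\<lambda>n. \<integral>\<^sup>+\<omega>. ennreal ((cmod (g \<omega> - ?u n \<omega>))\<^sup>2) \<partial>lebesgue) \<longlonglongrightarrow> 0"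
    thus "AE \<omega> in lebesgue. g \<omega> = F \<omega>"
      unfolding nn_integral_tendsto_0_iff_L2_tendsto[OF uL g]
      using L2_tendsto_unique[OF uL _ FL _ limL] by blast
  next
    assume "AE \<omega> in lebesgue. g \<omega> = F \<omega>"
    hence "(\<integral>\<^sup>+\<omega>. ennreal ((cmod (g \<omega> - ?u n \<omega>))\<^sup>2) \<partial>lebesgue)
        = (\<integral>\<^sup>+\<omega>. ennreal ((cmod (F \<omega> - ?u n \<omega>))\<^sup>2) \<partial>lebesgue)" for n
      by (intro nn_integral_cong_AE) auto
    thus "(\<lambda>n. \<integral>\<^sup>+\<omega>. ennreal ((cmod (g \<omega> - ?u n \<omega>))\<^sup>2) \<partial>lebesgue) \<longlonglongrightarrow> 0"
      using nn_integral_tendsto_0_iff_L2_tendsto[OF uL FL[THEN borel_measurable_square_integrable]] FL limL by simp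
  qed
qed

lemma nn_integral_lebesgue_weighted_finite_iff:
  fixes p g :: "'a::euclidean_space \<Rightarrow> complex" and w :: "'a \<Rightarrow> real"
  assumes [measurable]: "p \<in> borel_measurable borel" "w \<in> borel_measurable borel" and w: "\<And>\<omega>. w \<omega> \<ge> 0"
    and "c \<noteq> 0" and g: "AE \<omega> in lebesgue. g \<omega> = c * p \<omega>"
  shows "(\<integral>\<^sup>+\<omega>. ennreal (w \<omega> * (cmod (g \<omega>))\<^sup>2) \<partial>lebesgue) < \<infinity> \<longleftrightarrow> integrable lborel (\<lambda>\<omega>. w \<omega> * (cmod (p \<omega>))\<^sup>2)"
proof -
  let ?h = "\<lambda>\<omega>. (cmod c)\<^sup>2 * (w \<omega> * (cmod (p \<omega>))\<^sup>2)"
  have "(\<integral>\<^sup>+\<omega>. ennreal (w \<omega> * (cmod (g \<omega>))\<^sup>2) \<partial>lebesgue) = (\<integral>\<^sup>+\<omega>. ennreal (norm (?h \<omega>)) \<partial>lebesgue)"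
    using g by (intro nn_integral_cong_AE) (auto simp: norm_mult power_mult_distrib abs_mult w mult_ac)
  also have "\<dots> = (\<integral>\<^sup>+\<omega>. ennreal (norm (?h \<omega>)) \<partial>lborel)"
    by (rule nn_integral_completion)
  finally have nn_eq: "(\<integral>\<^sup>+\<omega>. ennreal (w \<omega> * (cmod (g \<omega>))\<^sup>2) \<partial>lebesgue) = (\<integral>\<^sup>+\<omega>. ennreal (norm (?h \<omega>)) \<partial>lborel)" .
  have "?h \<in> borel_measurable lborel" by measurable
  hence "(\<integral>\<^sup>+\<omega>. ennreal (w \<omega> * (cmod (g \<omega>))\<^sup>2) \<partial>lebesgue) < \<infinity> \<longleftrightarrow> integrable lborel ?h"
    unfolding nn_eq integrable_iff_bounded by blast
  thus ?thesis using \<open>c \<noteq> 0\<close> by simp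
qed

theorem sobolev_space_iff_weighted_L2:
  fixes E :: "'a::euclidean_space \<Rightarrow> real"
  assumes p: "integrable lborel p" "square_integrable lborel p"
    and E: "\<And>x. complex_of_real (E x) = ft p (- x)"
  shows "E \<in> sobolev_space s \<longleftrightarrow> integrable lborel (\<lambda>\<omega>. (1 + (norm \<omega>)\<^sup>2) powr s * (cmod (p \<omega>))\<^sup>2)"
proof -
  let ?F = "\<lambda>\<omega>. (2 * pi) ^ DIM('a) * p \<omega>"
  let ?weight = "\<lambda>\<omega>. (1 + (norm (\<omega>::'a))\<^sup>2) powr s"
  have E2: "square_integrable lborel (\<lambda>x. complex_of_real (E x))"
    unfolding E by (intro square_integrable_uminus square_integrable_ft p)
  have F: "has_L2_ft (\<lambda>x. complex_of_real (E x)) ?F"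
    using has_L2_ft_ft_uminus[OF p] unfolding E .
  note [measurable] = p(2)[THEN borel_measurable_square_integrable]
  have "(\<lambda>x. Re (complex_of_real (E x))) \<in> borel_measurable borel"
    using E2[THEN borel_measurable_square_integrable] by measurable
  hence E_meas: "E \<in> borel_measurable lebesgue" by (simp add: measurable_completion)
  have "(\<integral>\<^sup>+x. ennreal ((E x)\<^sup>2) \<partial>lebesgue) = (\<integral>\<^sup>+x. ennreal ((E x)\<^sup>2) \<partial>lborel)"
    by (rule nn_integral_completion)
  also have "\<dots> < \<infinity>"
    using nn_integral_norm_square[OF E2] by simp
  finally have E_fin: "(\<integral>\<^sup>+x. ennreal ((E x)\<^sup>2) \<partial>lebesgue) < \<infinity>" .
  have weighted: "(\<integral>\<^sup>+\<omega>. ennreal (?weight \<omega> * (cmod (g \<omega>))\<^sup>2) \<partial>lebesgue) < \<infinity>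
      \<longleftrightarrow> integrable lborel (\<lambda>\<omega>. ?weight \<omega> * (cmod (p \<omega>))\<^sup>2)"
    if "AE \<omega> in lebesgue. g \<omega> = ?F \<omega>" for g
    by (rule nn_integral_lebesgue_weighted_finite_iff[OF _ _ _ _ that]) auto
  have "E \<in> sobolev_space s \<longleftrightarrow> (\<exists>g. g \<in> borel_measurable lebesgue
      \<and> (\<integral>\<^sup>+\<omega>. ennreal (?weight \<omega> * (cmod (g \<omega>))\<^sup>2) \<partial>lebesgue) < \<infinity> \<and> (AE \<omega> in lebesgue. g \<omega> = ?F \<omega>))"
    unfolding sobolev_space_def using E_meas E_fin L2_limit_ft_trunc_iff[OF E2 F] by blast
  also have "\<dots> \<longleftrightarrow> (\<exists>g. g \<in> borel_measurable lebesgue \<and> (AE \<omega> in lebesgue. g \<omega> = ?F \<omega>))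
      \<and> integrable lborel (\<lambda>\<omega>. ?weight \<omega> * (cmod (p \<omega>))\<^sup>2)"
    using weighted by blast
  also have "(\<exists>g. g \<in> borel_measurable lebesgue \<and> (AE \<omega> in lebesgue. g \<omega> = ?F \<omega>)) \<longleftrightarrow> True"
    by (auto intro!: exI[of _ ?F] measurable_completion)
  finally show ?thesis by simp
qed

section \<open>Compactly supported test functions\<close>

lemma
  fixes \<kappa> m x :: real
  assumes "\<kappa> > 0" and "m \<ge> 0" and "x \<ge> 0"
  shows powr_one_plus_mult_le: "(1 + \<kappa> * x) powr (- m) \<le> min 1 \<kappa> powr (- m) * (1 + x) powr (- m)"
    and powr_one_plus_mult_ge: "max 1 \<kappa> powr (- m) * (1 + x) powr (- m) \<le> (1 + \<kappa> * x) powr (- m)"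
proof -
  have "min 1 \<kappa> * x \<le> \<kappa> * x" "\<kappa> * x \<le> max 1 \<kappa> * x"
    using \<open>x \<ge> 0\<close> by (auto intro: mult_right_mono)
  hence "min 1 \<kappa> * (1 + x) \<le> 1 + \<kappa> * x" "1 + \<kappa> * x \<le> max 1 \<kappa> * (1 + x)"
    by (simp_all add: distrib_left add_mono)
  moreover have "0 < min 1 \<kappa> * (1 + x)" "0 < 1 + \<kappa> * x"
    using assms by (simp_all add: add_pos_nonneg)
  ultimately show "(1 + \<kappa> * x) powr (- m) \<le> min 1 \<kappa> powr (- m) * (1 + x) powr (- m)"
    "max 1 \<kappa> powr (- m) * (1 + x) powr (- m) \<le> (1 + \<kappa> * x) powr (- m)"
    using \<open>m \<ge> 0\<close> unfolding powr_mult[symmetric] by (auto intro: powr_mono2')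
qed

definition interval_kernel :: "real \<Rightarrow> complex" where
  "interval_kernel t = complex_of_real (indicator {-1..1} t / 2)"

lemma integrable_interval_kernel: "integrable lborel interval_kernel"
  unfolding interval_kernel_def by (intro integrable_of_real Bochner_Integration.integrable_divide) auto

lemma integral_norm_interval_kernel: "(LBINT t. cmod (interval_kernel t)) = 1"
proof -
  have "cmod (interval_kernel t) = indicator {-1..1} t / 2" for t
    by (simp add: interval_kernel_def split: split_indicator)
  hence "(LBINT t. cmod (interval_kernel t)) = (LBINT t. indicator {-1..1::real} t / 2)" by (simp only:)
  thus ?thesis by (simp add: measure_def)
qed

lemma norm_ft_interval_kernel_mult_le: "cmod (ft interval_kernel w) * \<bar>w\<bar> \<le> 1"
proof (cases "w = 0")
  case False
  have "(LBINT t. indicator {-1..1} t *\<^sub>R cis (- (w * t))) = \<i> / w * cis (- (w * 1)) - \<i> / w * cis (- (w * - 1))"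
  proof (rule integral_FTC_atLeastAtMost)
    show "continuous_on {-1..1} (\<lambda>t. cis (- (w * t)))" by (intro continuous_intros)
    fix t
    have "((\<lambda>t. \<i> / w * cis (- (w * t))) has_vector_derivative
        \<i> / w * (- w *\<^sub>R (\<i> * cis (- (w * t))))) (at t within {-1..1})"
      unfolding cis_conv_exp
      by (auto intro!: derivative_eq_intros has_vector_derivative_real_field simp: scaleR_conv_of_real field_simps)
    thus "((\<lambda>t. \<i> / w * cis (- (w * t))) has_vector_derivative cis (- (w * t))) (at t within {-1..1})"
      using False by (simp add: scaleR_conv_of_real field_simps)
  qed simp
  moreover have "ft interval_kernel w = (1 / 2) *\<^sub>R (LBINT t. indicator {-1..1} t *\<^sub>R cis (- (w * t)))"
    unfolding ft_def integral_scaleR_right[symmetric]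
    by (intro Bochner_Integration.integral_cong) (auto simp: interval_kernel_def scaleR_conv_of_real field_simps)
  ultimately have "ft interval_kernel w = \<i> / w * (cis (- w) - cis w) / 2"
    by (simp add: right_diff_distrib scaleR_conv_of_real)
  hence "cmod (ft interval_kernel w) * \<bar>w\<bar> = cmod (cis (- w) - cis w) / 2"
    using False by (simp add: norm_mult norm_divide)
  thus ?thesis using norm_triangle_ineq4[of "cis (- w)" "cis w"] by simp
qed simp

definition box_kernel :: "'a::euclidean_space \<Rightarrow> complex" where
  "box_kernel z = (\<Prod>b\<in>Basis. interval_kernel (z \<bullet> b))"

lemma integrable_box_kernel: "integrable lborel (box_kernel :: 'a::euclidean_space \<Rightarrow> complex)"
  unfolding box_kernel_def by (intro lborel_integrable_prod_Basis integrable_interval_kernel)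

lemma ft_box_kernel: "ft box_kernel (\<omega>::'a::euclidean_space) = (\<Prod>b\<in>Basis. ft interval_kernel (\<omega> \<bullet> b))"
proof -
  have "ft box_kernel \<omega> = (LBINT x. (\<Prod>b\<in>Basis. interval_kernel (x \<bullet> b) * cis (- ((\<omega> \<bullet> b) * (x \<bullet> b)))))"
    unfolding ft_def box_kernel_def prod.distrib using cis_inner_eq_prod_Basis[of "- \<omega>"] by simp
  also have "\<dots> = (\<Prod>b\<in>Basis. LBINT t. interval_kernel t * cis (- ((\<omega> \<bullet> b) * t)))"
    by (intro lborel_integral_prod_Basis integrable_mult_cis integrable_interval_kernel) simp
  finally show ?thesis by (simp add: ft_def)
qed

lemma integral_box_kernel: "(LBINT z. box_kernel (z::'a::euclidean_space)) = 1"
proof -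
  have "(LBINT t. interval_kernel t) = 1"
    unfolding interval_kernel_def integral_complex_of_real by (simp add: measure_def)
  thus ?thesis using ft_box_kernel[of "0 :: 'a"] by (simp add: ft_def)
qed

lemma norm_le_if_box_kernel_nonzero:
  assumes "box_kernel (z::'a::euclidean_space) \<noteq> 0"
  shows "norm z \<le> real DIM('a)"
proof -
  have "\<bar>z \<bullet> b\<bar> \<le> 1" if "b \<in> Basis" for b
    using assms that by (auto simp: box_kernel_def interval_kernel_def split: split_indicator_asm)
  hence "(\<Sum>b\<in>Basis. \<bar>z \<bullet> b\<bar>) \<le> real DIM('a) * 1"
    by (intro sum_bounded_above) auto
  thus ?thesis using norm_le_l1[of z] by linarith
qed

lemma norm_ft_box_kernel_le:
  "(cmod (ft box_kernel \<omega>))\<^sup>2 \<le> (1 + real DIM('a)) / (1 + (norm (\<omega>::'a::euclidean_space))\<^sup>2)"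
proof -
  define P where "P = cmod (ft box_kernel \<omega>)"
  have P_prod: "P = (\<Prod>b\<in>Basis. cmod (ft interval_kernel (\<omega> \<bullet> b)))"
    by (simp add: P_def ft_box_kernel prod_norm)
  have le_1: "cmod (ft interval_kernel w) \<le> 1" for w
    using norm_ft_le[of interval_kernel w] by (simp add: integral_norm_interval_kernel)
  have P: "0 \<le> P" "P \<le> 1"
    unfolding P_prod by (auto intro: prod_nonneg prod_le_1 le_1)
  have "P\<^sup>2 * (\<omega> \<bullet> b)\<^sup>2 \<le> 1" if b: "b \<in> Basis" for b
  proof -
    have "P = cmod (ft interval_kernel (\<omega> \<bullet> b)) * (\<Prod>c\<in>Basis - {b}. cmod (ft interval_kernel (\<omega> \<bullet> c)))"
      unfolding P_prod using b by (subst prod.remove[of _ b]) auto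
    also have "\<dots> \<le> cmod (ft interval_kernel (\<omega> \<bullet> b)) * 1"
      by (intro mult_left_mono prod_le_1) (auto simp: le_1)
    finally have "P * \<bar>\<omega> \<bullet> b\<bar> \<le> cmod (ft interval_kernel (\<omega> \<bullet> b)) * \<bar>\<omega> \<bullet> b\<bar>"
      by (intro mult_right_mono) auto
    also have "\<dots> \<le> 1" by (rule norm_ft_interval_kernel_mult_le)
    finally have "(P * \<bar>\<omega> \<bullet> b\<bar>)\<^sup>2 \<le> 1" using P(1) by (intro power_le_one) auto
    thus ?thesis by (simp add: power_mult_distrib)
  qed
  hence "P\<^sup>2 * (norm \<omega>)\<^sup>2 \<le> real DIM('a)"
    using sum_bounded_above[of "Basis :: 'a set" "\<lambda>b. P\<^sup>2 * (\<omega> \<bullet> b)\<^sup>2" 1]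
    by (simp add: norm_square_eq_sum_Basis sum_distrib_left)
  moreover have "P\<^sup>2 \<le> 1" using P by (rule power_le_one)
  ultimately have "P\<^sup>2 * (1 + (norm \<omega>)\<^sup>2) \<le> 1 + real DIM('a)" by (simp add: distrib_left)
  thus ?thesis
    unfolding P_def[symmetric] by (simp add: pos_le_divide_eq add_pos_nonneg)
qed

primrec box_spline :: "nat \<Rightarrow> 'a::euclidean_space \<Rightarrow> complex" where
  "box_spline 0 = box_kernel"
| "box_spline (Suc n) = conv (box_spline n) box_kernel"

lemma integrable_box_spline: "integrable lborel (box_spline n :: 'a::euclidean_space \<Rightarrow> complex)"
  by (induction n) (simp_all add: integrable_box_kernel integrable_dilated_conv)

lemma ft_box_spline: "ft (box_spline n) \<omega> = ft box_kernel \<omega> ^ Suc n"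
  by (induction n) (simp_all add: ft_dilated_conv integrable_box_spline integrable_box_kernel)

lemma norm_le_if_box_spline_nonzero:
  "box_spline n (z::'a::euclidean_space) \<noteq> 0 \<Longrightarrow> norm z \<le> real (Suc n) * real DIM('a)"
proof (induction n arbitrary: z)
  case 0
  thus ?case using norm_le_if_box_kernel_nonzero[of z] by simp
next
  case (Suc n)
  have "dilated_conv 1 (box_spline n) box_kernel z = 0" if far: "real (Suc (Suc n)) * real DIM('a) < norm z"
  proof (rule dilated_conv_eq_0)
    fix y :: 'a assume "box_spline n y \<noteq> 0"
    hence "norm y \<le> real (Suc n) * real DIM('a)" by (rule Suc.IH)
    thus "\<bar>1\<bar> * real DIM('a) < dist z y"
      using far norm_triangle_ineq2[of z y] by (simp add: dist_norm distrib_right)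
  qed (rule norm_le_if_box_kernel_nonzero)
  thus ?case using Suc.prems by (auto simp: not_less[symmetric])
qed

text \<open>Splines replace smooth bump functions: the support stays compact, and any prescribed
  polynomial decay of the transform is reached after finitely many convolutions.\<close>

lemma compactly_supported_kernel_exists:
  fixes m :: real
  obtains \<phi> :: "'a::euclidean_space \<Rightarrow> complex" and R A
  where "integrable lborel \<phi>" "(LBINT z. \<phi> z) = 1" "R > 0" "\<And>z. \<phi> z \<noteq> 0 \<Longrightarrow> norm z \<le> R"
    "\<And>\<omega>. cmod (ft \<phi> \<omega>) \<le> A * (1 + (norm \<omega>)\<^sup>2) powr (- m)"
proof
  define N where "N = Suc (nat \<lceil>m\<rceil>)"
  have N: "m \<le> real N" "Suc (2 * N - 1) = 2 * N" unfolding N_def by linarith simp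
  let ?\<phi> = "box_spline (2 * N - 1) :: 'a \<Rightarrow> complex"
  show "integrable lborel ?\<phi>" by (rule integrable_box_spline)
  show "(LBINT z. ?\<phi> z) = 1"
    using ft_box_spline[of "2 * N - 1" "0 :: 'a"] by (simp add: ft_def integral_box_kernel)
  show "real (Suc (2 * N - 1)) * real DIM('a) > 0" by simp
  show "norm z \<le> real (Suc (2 * N - 1)) * real DIM('a)" if "?\<phi> z \<noteq> 0" for z
    using that by (rule norm_le_if_box_spline_nonzero)
  show "cmod (ft ?\<phi> \<omega>) \<le> (1 + real DIM('a)) ^ N * (1 + (norm \<omega>)\<^sup>2) powr (- m)" for \<omega>
  proof -
    have ge_1: "1 + (norm \<omega>)\<^sup>2 \<ge> 1" by simp
    have "cmod (ft ?\<phi> \<omega>) = ((cmod (ft box_kernel \<omega>))\<^sup>2) ^ N"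
      unfolding ft_box_spline N(2) by (simp add: norm_power power_mult)
    also have "\<dots> \<le> ((1 + real DIM('a)) / (1 + (norm \<omega>)\<^sup>2)) ^ N"
      by (intro power_mono norm_ft_box_kernel_le) simp
    also have "\<dots> = (1 + real DIM('a)) ^ N * (1 + (norm \<omega>)\<^sup>2) powr (- real N)"
      using powr_realpow[of "1 + (norm \<omega>)\<^sup>2" N] ge_1
      by (simp add: power_divide powr_minus_divide less_le_trans[OF zero_less_one ge_1])
    also have "\<dots> \<le> (1 + real DIM('a)) ^ N * (1 + (norm \<omega>)\<^sup>2) powr (- m)"
      using N(1) ge_1 by (intro mult_left_mono powr_mono) auto
    finally show ?thesis .
  qed
qed

definition test_function :: "real \<Rightarrow> 'a::euclidean_space set \<Rightarrow> ('a \<Rightarrow> complex) \<Rightarrow> bool" where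
  "test_function m D \<psi> \<longleftrightarrow> integrable lborel \<psi> \<and> (\<exists>C. \<forall>x. cmod (\<psi> x) \<le> C)
     \<and> (\<exists>A. \<forall>\<omega>. cmod (ft \<psi> \<omega>) \<le> A * (1 + (norm \<omega>)\<^sup>2) powr (- m)) \<and> (\<forall>y\<in>D. \<forall>\<^sub>F z in nhds y. \<psi> z = 0)"

lemma test_function_dilated_conv:
  fixes \<phi> k :: "'a::euclidean_space \<Rightarrow> complex"
  assumes k: "integrable lborel k" and k_bound: "\<And>x. cmod (k x) \<le> C" and \<phi>: "integrable lborel \<phi>"
    and \<phi>_support: "\<And>z. \<phi> z \<noteq> 0 \<Longrightarrow> norm z \<le> R"
    and \<phi>_decay: "\<And>\<omega>. cmod (ft \<phi> \<omega>) \<le> A * (1 + (norm \<omega>)\<^sup>2) powr (- m)"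
    and "m \<ge> 0" and "\<delta> > 0" and "\<delta> * R < r" and far: "\<And>x y. k x \<noteq> 0 \<Longrightarrow> y \<in> D \<Longrightarrow> r \<le> dist x y"
  shows "test_function m D (dilated_conv \<delta> k \<phi>)"
proof -
  have "A \<ge> 0" using order_trans[OF norm_ge_zero \<phi>_decay[of 0]] by simp
  have "cmod (ft (dilated_conv \<delta> k \<phi>) \<omega>)
      \<le> (LBINT x. cmod (k x)) * (A * min 1 (\<delta>\<^sup>2) powr (- m)) * (1 + (norm \<omega>)\<^sup>2) powr (- m)" for \<omega>
  proof -
    have "cmod (ft \<phi> (\<delta> *\<^sub>R \<omega>)) \<le> A * (1 + \<delta>\<^sup>2 * (norm \<omega>)\<^sup>2) powr (- m)"
      using \<phi>_decay[of "\<delta> *\<^sub>R \<omega>"] by (simp add: power_mult_distrib)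
    also have "\<dots> \<le> A * (min 1 (\<delta>\<^sup>2) powr (- m) * (1 + (norm \<omega>)\<^sup>2) powr (- m))"
      using \<open>A \<ge> 0\<close> \<open>\<delta> > 0\<close> \<open>m \<ge> 0\<close> by (intro mult_left_mono powr_one_plus_mult_le) auto
    finally have "cmod (ft k \<omega>) * cmod (ft \<phi> (\<delta> *\<^sub>R \<omega>))
        \<le> (LBINT x. cmod (k x)) * (A * (min 1 (\<delta>\<^sup>2) powr (- m) * (1 + (norm \<omega>)\<^sup>2) powr (- m)))"
      by (intro mult_mono norm_ft_le) auto
    thus ?thesis by (simp add: ft_dilated_conv[OF k \<phi>] norm_mult mult.assoc)
  qed
  moreover have "\<forall>\<^sub>F z in nhds y. dilated_conv \<delta> k \<phi> z = 0" if "y \<in> D" for y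
    unfolding eventually_nhds_metric
  proof (intro exI[of _ "r - \<delta> * R"] conjI allI impI)
    fix z assume near: "dist z y < r - \<delta> * R"
    show "dilated_conv \<delta> k \<phi> z = 0"
    proof (rule dilated_conv_eq_0)
      fix x assume "k x \<noteq> 0"
      thus "\<bar>\<delta>\<bar> * R < dist z x"
        using far[OF _ \<open>y \<in> D\<close>, of x] near dist_triangle[of x y z] \<open>\<delta> > 0\<close> by (simp add: dist_commute)
    qed (rule \<phi>_support)
  qed (use \<open>\<delta> * R < r\<close> in simp)
  moreover have "\<exists>B. \<forall>x. cmod (dilated_conv \<delta> k \<phi> x) \<le> B"
    using norm_dilated_conv_le[of k \<phi> C \<delta>, OF _ \<phi> k_bound] borel_measurable_integrable[OF k] by auto
  ultimately show ?thesis
    unfolding test_function_def using integrable_dilated_conv[OF k \<phi>] by blast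
qed

lemma tendsto_integral_mult_mollified_indicator:
  fixes V :: "'a::euclidean_space \<Rightarrow> complex"
  assumes V: "square_integrable lborel V" and B: "convex B" "bounded B" "B \<in> sets borel"
    and \<phi>: "integrable lborel \<phi>" and \<phi>_support: "\<And>z. \<phi> z \<noteq> 0 \<Longrightarrow> norm z \<le> R"
    and \<delta>: "\<delta> \<longlonglongrightarrow> 0" "\<And>n. \<bar>\<delta> n\<bar> * R < r"
  shows "(\<lambda>n. LBINT x. V x * dilated_conv (\<delta> n) (\<lambda>x. complex_of_real (indicator B x)) \<phi> x)
    \<longlonglongrightarrow> (LINT x:B|lborel. V x) * (LBINT z. \<phi> z)"
proof -
  note [measurable] = B(3)
  define k where "k x = complex_of_real (indicator B x)" for x
  have [measurable]: "k \<in> borel_measurable borel" unfolding k_def by measurable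
  have k_cont: "AE x in lborel. isCont k x"
    unfolding k_def by (rule AE_isCont_indicator_convex[OF B(1)])
  obtain R0 where R0: "\<And>x. x \<in> B \<Longrightarrow> norm x < R0"
    using B(2) unfolding bounded_pos_less by auto
  have "dilated_conv (\<delta> n) k \<phi> x = 0" if "R0 + \<bar>r\<bar> \<le> norm x" for n x
  proof (rule dilated_conv_eq_0[OF _ \<phi>_support])
    fix z assume "k z \<noteq> 0"
    hence "norm z < R0" by (intro R0) (auto simp: k_def split: split_indicator_asm)
    thus "\<bar>\<delta> n\<bar> * R < dist x z"
      using that norm_triangle_ineq2[of x z] \<delta>(2)[of n] by (simp add: dist_norm)
  qed
  hence truncate_mult: "truncate (R0 + \<bar>r\<bar>) V x * dilated_conv (\<delta> n) k \<phi> x = V x * dilated_conv (\<delta> n) k \<phi> x" for n x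
    by (auto simp: truncate_def not_less split: split_indicator)
  have "(\<lambda>n. LBINT x. truncate (R0 + \<bar>r\<bar>) V x * dilated_conv (\<delta> n) k \<phi> x)
      \<longlonglongrightarrow> (LBINT x. truncate (R0 + \<bar>r\<bar>) V x * (k x * (LBINT z. \<phi> z)))"
    by (rule tendsto_integral_mult_dilated_conv[OF integrable_truncate[OF V] \<phi> _ _ k_cont \<delta>(1), where B = 1])
       (auto simp: k_def)
  moreover have "truncate (R0 + \<bar>r\<bar>) V x * k x = indicator B x *\<^sub>R V x" for x
    using R0[of x] by (auto simp: truncate_def k_def split: split_indicator)
  ultimately show ?thesis
    unfolding truncate_mult set_lebesgue_integral_def k_def[symmetric] integral_mult_left_zero[symmetric]
    by (simp flip: mult.assoc)
qed

lemma integral_convex_eq_0_if_test_integrals_eq_0: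
  fixes V :: "'a::euclidean_space \<Rightarrow> complex"
  assumes V: "square_integrable lborel V" and "m \<ge> 0" and "closed D"
    and orthogonal: "\<And>\<psi>. test_function m D \<psi> \<Longrightarrow> (LBINT x. V x * \<psi> x) = 0"
    and B: "convex B" "bounded B" "B \<in> sets borel" and disjoint: "closure B \<inter> D = {}"
  shows "(LINT x:B|lborel. V x) = 0"
proof -
  let ?k = "\<lambda>x. complex_of_real (indicator B x)"
  obtain \<phi> :: "'a \<Rightarrow> complex" and R A where \<phi>: "integrable lborel \<phi>" "(LBINT z. \<phi> z) = 1"
    and R: "R > 0" "\<And>z. \<phi> z \<noteq> 0 \<Longrightarrow> norm z \<le> R"
    and decay: "\<And>\<omega>. cmod (ft \<phi> \<omega>) \<le> A * (1 + (norm \<omega>)\<^sup>2) powr (- m)"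
    by (rule compactly_supported_kernel_exists[of m]) (rule that)
  obtain r where r: "r > 0" "\<And>x y. x \<in> closure B \<Longrightarrow> y \<in> D \<Longrightarrow> r \<le> dist x y"
    using separate_compact_closed[of "closure B" D] B(2) disjoint \<open>closed D\<close> by (auto simp: compact_closure)
  define \<delta> where "\<delta> n = r / (2 * R) * inverse (real (Suc n))" for n
  have \<delta>_pos: "\<delta> n > 0" for n using r(1) R(1) by (simp add: \<delta>_def)
  have "\<delta> n \<le> r / (2 * R) * 1" for n
    unfolding \<delta>_def using r(1) R(1) by (intro mult_left_mono) (auto simp: field_simps)
  hence \<delta>_R: "\<delta> n * R < r" for n
    using r(1) R(1) by (intro le_less_trans[OF mult_right_mono[of "\<delta> n" "r / (2 * R)" R]]) auto
  have \<delta>_lim: "\<delta> \<longlonglongrightarrow> 0"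
    unfolding \<delta>_def using tendsto_mult_right_zero[OF LIMSEQ_inverse_real_of_nat] by blast
  have indicator_integrable: "integrable lborel ?k"
    using emeasure_bounded_finite[OF B(2)] B(3) by simp
  have far: "r \<le> dist x y" if "?k x \<noteq> 0" "y \<in> D" for x y
    using that closure_subset[of B] by (intro r(2)) (auto split: split_indicator_asm)
  have "test_function m D (dilated_conv (\<delta> n) ?k \<phi>)" for n
    by (rule test_function_dilated_conv[OF indicator_integrable _ \<phi>(1) R(2) decay \<open>m \<ge> 0\<close> \<delta>_pos \<delta>_R far, where C = 1]) auto
  moreover have "(\<lambda>n. LBINT x. V x * dilated_conv (\<delta> n) ?k \<phi> x) \<longlonglongrightarrow> (LINT x:B|lborel. V x)"
    using tendsto_integral_mult_mollified_indicator[OF V B \<phi>(1) R(2) \<delta>_lim, of r] \<delta>_R \<delta>_pos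
    by (simp add: \<phi>(2) less_imp_le)
  ultimately show ?thesis
    using orthogonal by (simp add: LIMSEQ_const_iff)
qed

theorem AE_eq_0_off_closed_if_test_integrals_eq_0:
  fixes V :: "'a::euclidean_space \<Rightarrow> complex"
  assumes V: "square_integrable lborel V" and "m \<ge> 0" and "closed D"
    and orthogonal: "\<And>\<psi>. test_function m D \<psi> \<Longrightarrow> (LBINT x. V x * \<psi> x) = 0"
  shows "AE x in lborel. x \<notin> D \<longrightarrow> V x = 0"
proof -
  obtain \<D> where \<D>: "countable \<D>" "\<D> \<subseteq> Pow (- D)" "\<And>X. X \<in> \<D> \<Longrightarrow> \<exists>a b. X = cbox a b" "\<Union>\<D> = - D"
    using open_countable_Union_open_cbox[OF open_Compl[OF \<open>closed D\<close>]] by metis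
  have "AE x in lborel. x \<in> X \<longrightarrow> V x = 0" if X: "X \<in> \<D>" for X
  proof -
    obtain a b where X_eq: "X = cbox a b" using \<D>(3)[OF X] by blast
    have "AE x in lborel. indicator X x *\<^sub>R V x = 0"
    proof (rule AE_zero_if_box_integrals_zero)
      show "integrable lborel (\<lambda>x. indicator X x *\<^sub>R V x)"
        using emeasure_lborel_cbox_finite[of a b] unfolding X_eq
        by (intro integrable_indicator_square_integrable V) (auto simp: less_top)
      fix c d :: 'a
      have "closure (box c d \<inter> X) \<subseteq> X"
        unfolding X_eq by (intro closure_minimal) auto
      hence "(LINT x:box c d \<inter> X|lborel. V x) = 0"
        using \<D>(2) X unfolding X_eq
        by (intro integral_convex_eq_0_if_test_integrals_eq_0[OF V \<open>m \<ge> 0\<close> \<open>closed D\<close> orthogonal])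
           (auto intro: convex_Int bounded_Int)
      thus "(LINT x:box c d|lborel. indicator X x *\<^sub>R V x) = 0"
        by (simp add: set_lebesgue_integral_def indicator_inter_arith)
    qed
    thus ?thesis by eventually_elim auto
  qed
  hence "AE x in lborel. \<forall>X\<in>\<D>. x \<in> X \<longrightarrow> V x = 0"
    using \<D>(1) by (subst AE_ball_countable) auto
  thus ?thesis
    by eventually_elim (use \<D>(4) in blast)
qed

section \<open>Gaussian mixtures and the Matern spectrum\<close>

lemma
  fixes w a :: "real \<Rightarrow> real"
  assumes [measurable]: "w \<in> borel_measurable borel" "a \<in> borel_measurable borel"
    and w: "\<And>s. w s \<ge> 0" and a: "\<And>s. w s \<noteq> 0 \<Longrightarrow> a s > 0"
    and mass: "integrable lborel (\<lambda>s. w s * (pi / a s) powr (DIM('a) / 2))"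
  defines "F \<equiv> \<lambda>x::'a::euclidean_space. \<integral>s. w s * exp (- (a s * (norm x)\<^sup>2)) \<partial>lborel"
  shows integrable_gaussian_mixture: "integrable lborel F"
    and ft_gaussian_mixture: "ft (\<lambda>x. complex_of_real (F x)) \<omega>
      = complex_of_real (LBINT s. w s * (pi / a s) powr (DIM('a) / 2) * exp (- ((norm \<omega>)\<^sup>2 / (4 * a s))))"
proof -
  define f where "f s x = complex_of_real (w s * exp (- (a s * (norm x)\<^sup>2)))" for s and x :: 'a
  have [measurable]: "case_prod f \<in> borel_measurable (lborel \<Otimes>\<^sub>M lborel)"
    unfolding f_def by measurable
  have ft_f: "integrable lborel (f s) \<and> ft (f s) \<omega>
      = complex_of_real (w s * (pi / a s) powr (DIM('a) / 2) * exp (- ((norm \<omega>)\<^sup>2 / (4 * a s))))" for s \<omega>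
  proof (cases "w s = 0")
    case False
    have "ft (f s) \<omega> = complex_of_real (w s) * ft (\<lambda>x. complex_of_real (exp (- (a s * (norm x)\<^sup>2)))) \<omega>"
      by (simp add: ft_def f_def mult.assoc)
    thus ?thesis
      unfolding f_def ft_exp_norm_square[OF a[OF False]]
      using integrable_exp_norm_square[OF a[OF False], where 'a = 'a] by (simp add: mult.assoc)
  qed (simp add: ft_def f_def[abs_def])
  have "complex_of_real (cmod (f s x)) = f s x" for s x
    using w[of s] by (simp add: f_def norm_mult)
  hence "complex_of_real (LBINT x. cmod (f s x)) = ft (f s) 0" for s
    unfolding ft_def integral_complex_of_real[symmetric] by simp
  hence norm_f: "(LBINT x. cmod (f s x)) = w s * (pi / a s) powr (DIM('a) / 2)" for s
    using ft_f[of s 0] by (simp flip: of_real_eq_iff[where 'a = complex])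
  have pair: "integrable (lborel \<Otimes>\<^sub>M lborel) (\<lambda>(s, x). f s x)"
  proof (rule lborel_pair.Fubini_integrable)
    show "integrable lborel (\<lambda>s. \<integral>x. norm (case (s, x) of (s, x) \<Rightarrow> f s x) \<partial>lborel)"
      using mass by (simp add: norm_f)
  qed (use ft_f in auto)
  have F_eq: "complex_of_real (F x) = (LBINT s. f s x)" for x
    unfolding F_def f_def integral_complex_of_real ..
  have "integrable lborel (\<lambda>x. complex_of_real (F x))"
    unfolding F_eq using lborel_pair.integrable_snd[OF pair] by simp
  thus "integrable lborel F" by (simp only: complex_of_real_integrable_eq)
  have pair_cis: "integrable (lborel \<Otimes>\<^sub>M lborel) (\<lambda>(s, x). f s x * cis (- (\<omega> \<bullet> x)))"
    by (rule Bochner_Integration.integrable_bound[OF pair]) (auto simp: norm_mult)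
  have "ft (\<lambda>x. complex_of_real (F x)) \<omega> = (LBINT x. (LBINT s. f s x * cis (- (\<omega> \<bullet> x))))"
    unfolding ft_def F_eq by simp
  also have "\<dots> = (LBINT s. ft (f s) \<omega>)"
    unfolding ft_def using lborel_pair.Fubini_integral[OF pair_cis] by simp
  finally show "ft (\<lambda>x. complex_of_real (F x)) \<omega>
      = complex_of_real (LBINT s. w s * (pi / a s) powr (DIM('a) / 2) * exp (- ((norm \<omega>)\<^sup>2 / (4 * a s))))"
    unfolding conjunct2[OF ft_f] integral_complex_of_real .
qed

lemma
  fixes z l :: real
  assumes z: "z > 0" and l: "l > 0"
  shows set_integrable_powr_exp: "set_integrable lborel {0<..} (\<lambda>s. s powr (z - 1) * exp (- (l * s)))"
    and set_integral_powr_exp: "(LINT s:{0<..}|lborel. s powr (z - 1) * exp (- (l * s))) = Gamma z * l powr (- z)"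
proof -
  define g where "g s = indicator {0<..} s * (s powr (z - 1) * exp (- s))" for s :: real
  have [measurable]: "g \<in> borel_measurable borel" unfolding g_def by measurable
  have g_nonneg: "g s \<ge> 0" for s by (simp add: g_def)
  have "(\<integral>\<^sup>+s. ennreal (g s) \<partial>lborel) = (\<integral>\<^sup>+t. ennreal (indicator {0..} t * t powr (z - 1) / exp t) \<partial>lborel)"
    by (intro nn_integral_cong) (auto simp: g_def exp_minus divide_inverse split: split_indicator)
  also have "\<dots> = ennreal (Gamma z)" using Gamma_conv_nn_integral_real[OF z] by simp
  finally have nn_g: "(\<integral>\<^sup>+s. ennreal (g s) \<partial>lborel) = ennreal (Gamma z)" .
  have g: "integrable lborel g"
    using nn_g g_nonneg by (intro integrableI_nonneg) auto
  have integral_g: "(LBINT s. g s) = Gamma z"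
    using nn_g g_nonneg Gamma_real_pos[OF z]
    by (subst integral_eq_nn_integral) (auto simp: enn2real_ennreal less_imp_le)
  have g_scaled: "g (0 + l * s) = l powr (z - 1) * (indicator {0<..} s * (s powr (z - 1) * exp (- (l * s))))" for s
    using l by (auto simp: g_def powr_mult zero_less_mult_iff split: split_indicator)
  have "integrable lborel (\<lambda>s. g (0 + l * s))"
    using lborel_integrable_real_affine[OF g, of l 0] l by simp
  thus "set_integrable lborel {0<..} (\<lambda>s. s powr (z - 1) * exp (- (l * s)))"
    unfolding g_scaled set_integrable_def using l by simp
  have "Gamma z = l * (l powr (z - 1) * (LINT s:{0<..}|lborel. s powr (z - 1) * exp (- (l * s))))"
    using lborel_integral_real_affine[of l g 0] l
    unfolding integral_g g_scaled by (simp add: set_lebesgue_integral_def)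
  also have "\<dots> = l powr z * (LINT s:{0<..}|lborel. s powr (z - 1) * exp (- (l * s)))"
    using l by (simp add: powr_diff)
  finally show "(LINT s:{0<..}|lborel. s powr (z - 1) * exp (- (l * s))) = Gamma z * l powr (- z)"
    using l by (simp add: powr_minus)
qed

lemma
  fixes f :: "real \<Rightarrow> real"
  assumes f: "set_integrable lborel {0<..} f" and c: "c > 0"
  shows lborel_integrable_exp_substitution: "integrable lborel (\<lambda>t. c * exp t * f (c * exp t))"
    and lborel_integral_exp_substitution:
      "(LBINT t. c * exp t * f (c * exp t)) = (LINT s:{0<..}|lborel. f s)"
proof -
  define g where "g t = c * exp t" for t :: real
  define F where "F s = indicator {0<..} s * f s" for s
  have [measurable]: "F \<in> borel_measurable borel" "g \<in> borel_measurable borel"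
    using borel_measurable_integrable[OF f[unfolded set_integrable_def]]
    by (auto simp: F_def[abs_def] g_def[abs_def])
  have g_pos: "g t > 0" for t using c by (simp add: g_def)
  have "s = g (ln (s / c))" if "s > 0" for s using that c by (simp add: g_def)
  hence g_range: "g ` UNIV = {0<..}" using g_pos by auto
  have k_eq: "\<bar>g t\<bar> * f (g t) = g t * F (g t)" for t using g_pos[of t] by (simp add: F_def)
  have f_abs: "f absolutely_integrable_on {0<..}"
    using f by (simp add: set_integrable_def integrable_completion borel_measurable_integrable)
  have integral_f: "integral {0<..} f = (LINT s:{0<..}|lborel. f s)"
    using set_lebesgue_integral_eq_integral(2)[OF f_abs] f
    by (simp add: set_lebesgue_integral_def set_integrable_def integral_completion borel_measurable_integrable)
  have "(g has_field_derivative g t) (at t within UNIV)" for t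
    unfolding g_def by (auto intro!: derivative_eq_intros)
  hence k: "(\<lambda>t. g t * F (g t)) absolutely_integrable_on UNIV \<and>
      integral UNIV (\<lambda>t. g t * F (g t)) = (LINT s:{0<..}|lborel. f s)"
    using has_absolute_integral_change_of_variables_1'[of UNIV g g f] f_abs integral_f c
    unfolding g_range k_eq by (auto simp: g_def inj_on_def)
  have "integrable lborel (\<lambda>t. g t * F (g t))"
    using k by (simp add: set_integrable_def integrable_completion)
  thus "integrable lborel (\<lambda>t. c * exp t * f (c * exp t))"
    using g_pos by (simp add: F_def g_def)
  have "integral UNIV (\<lambda>t. g t * F (g t)) = (LBINT t. g t * F (g t))"
    using set_lebesgue_integral_eq_integral(2)[OF conjunct1[OF k]]
    by (simp add: set_lebesgue_integral_def integral_completion)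
  thus "(LBINT t. c * exp t * f (c * exp t)) = (LINT s:{0<..}|lborel. f s)"
    using k g_pos by (simp add: F_def g_def)
qed

lemma integral_exp_cosh_eq_besselK:
  assumes k: "integrable lborel (\<lambda>t. exp (- r * cosh t) * exp (\<nu> * t))"
  shows "(LBINT t. exp (- r * cosh t) * exp (\<nu> * t)) = 2 * besselK \<nu> r"
proof -
  let ?k = "\<lambda>t. exp (- r * cosh t) * exp (\<nu> * t)" and ?e = "\<lambda>t. exp (- r * cosh t) * cosh (\<nu> * t)"
  have k_minus: "integrable lborel (\<lambda>t. ?k (- t))" "(LBINT t. ?k (- t)) = (LBINT t. ?k t)"
    using k lborel_integrable_uminus_iff[of ?k] lborel_integral_uminus[of ?k] by auto
  have e_eq: "?e t = (?k t + ?k (- t)) / 2" for t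
    by (simp add: cosh_def field_simps)
  have even_integrable: "integrable lborel ?e"
    unfolding e_eq by (intro Bochner_Integration.integrable_divide Bochner_Integration.integrable_add k k_minus)
  have "(LBINT t. ?k t) = (LBINT t. ?e t)"
    unfolding e_eq using k k_minus by simp
  also have "has_bochner_integral lborel ?e (2 *\<^sub>R (LINT t:{0..}|lborel. ?e t))"
    unfolding set_lebesgue_integral_def
    by (intro has_bochner_integral_even_function has_bochner_integral_integrable integrable_mult_indicator even_integrable) auto
  hence "(LBINT t. ?e t) = 2 * (LINT t:{0..}|lborel. ?e t)"
    by (simp add: has_bochner_integral_integral_eq)
  also have "(LINT t:{0..}|lborel. ?e t) = (LINT t:{0<..}|lborel. ?e t)"
    unfolding set_lebesgue_integral_def
    by (rule integral_discrete_difference[where X = "{0}"]) (auto split: split_indicator)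
  also have "\<dots> = besselK \<nu> r"
    by (simp add: besselK_def interval_lebesgue_integral_0_infty)
  finally show ?thesis .
qed

lemma set_integral_powr_exp_eq_besselK:
  assumes \<nu>: "\<nu> > 0" and r: "r > 0"
  shows "(LINT s:{0<..}|lborel. s powr (\<nu> - 1) * exp (- s) * exp (- (r\<^sup>2 / (4 * s))))
    = 2 * (r / 2) powr \<nu> * besselK \<nu> r"
proof -
  define f where "f s = s powr (\<nu> - 1) * exp (- s) * exp (- (r\<^sup>2 / (4 * s)))" for s
  let ?k = "\<lambda>t. exp (- r * cosh t) * exp (\<nu> * t)"
  have f: "set_integrable lborel {0<..} f"
    unfolding set_integrable_def
  proof (rule Bochner_Integration.integrable_bound)
    show "integrable lborel (\<lambda>s. indicator {0<..} s *\<^sub>R (s powr (\<nu> - 1) * exp (- (1 * s))))"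
      using set_integrable_powr_exp[OF \<nu> zero_less_one] by (simp add: set_integrable_def)
    show "AE s in lborel. norm (indicator {0<..} s *\<^sub>R f s)
        \<le> norm (indicator {0<..} s *\<^sub>R (s powr (\<nu> - 1) * exp (- (1 * s))))"
      by (intro AE_I2) (auto simp: f_def abs_mult intro!: mult_left_le split: split_indicator)
  qed (simp add: f_def)
  have f_exp: "r / 2 * exp t * f (r / 2 * exp t) = (r / 2) powr \<nu> * ?k t" for t
  proof -
    let ?g = "r / 2 * exp t"
    have "?g * ?g powr (\<nu> - 1) = ?g powr \<nu>"
      using r powr_mult_base[of ?g "\<nu> - 1"] by simp
    also have "\<dots> = (r / 2) powr \<nu> * exp (\<nu> * t)"
      unfolding powr_mult by (simp add: exp_powr_real mult.commute)
    finally have "?g * ?g powr (\<nu> - 1) = (r / 2) powr \<nu> * exp (\<nu> * t)" .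
    moreover have "exp (- ?g) * exp (- (r\<^sup>2 / (4 * ?g))) = exp (- r * cosh t)"
      using r unfolding exp_add[symmetric]
      by (simp add: cosh_def exp_minus field_simps power2_eq_square)
    ultimately show ?thesis by (simp add: f_def mult.assoc[symmetric])
  qed
  have "integrable lborel (\<lambda>t. (r / 2) powr \<nu> * ?k t)"
    using lborel_integrable_exp_substitution[OF f, of "r / 2"] r unfolding f_exp by simp
  hence k: "integrable lborel ?k" using r by simp
  have "(LINT s:{0<..}|lborel. f s) = (r / 2) powr \<nu> * (LBINT t. ?k t)"
    using lborel_integral_exp_substitution[OF f, of "r / 2"] r unfolding f_exp by simp
  thus ?thesis
    unfolding integral_exp_cosh_eq_besselK[OF k] by (simp add: f_def)
qed

definition gamma_density :: "real \<Rightarrow> real \<Rightarrow> real" where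
  "gamma_density \<nu> s = indicator {0<..} s * (s powr (\<nu> - 1) * exp (- s)) / Gamma \<nu>"

lemma borel_measurable_gamma_density [measurable]: "gamma_density \<nu> \<in> borel_measurable borel"
  unfolding gamma_density_def by measurable

lemma gamma_density_nonneg: "\<nu> > 0 \<Longrightarrow> gamma_density \<nu> s \<ge> 0"
  using Gamma_real_pos[of \<nu>] by (simp add: gamma_density_def)

lemma
  fixes \<nu> h l :: real
  assumes \<nu>: "\<nu> > 0" and h: "h \<ge> 0" and l: "l \<ge> 0"
  shows integrable_gamma_density_moment:
      "integrable lborel (\<lambda>s. gamma_density \<nu> s * s powr h * exp (- (l * s)))"
    and integral_gamma_density_moment: "(LBINT s. gamma_density \<nu> s * s powr h * exp (- (l * s)))
      = Gamma (\<nu> + h) / Gamma \<nu> * (1 + l) powr (- (\<nu> + h))"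
proof -
  have integrand_eq: "gamma_density \<nu> s * s powr h * exp (- (l * s))
      = indicator {0<..} s *\<^sub>R (s powr (\<nu> + h - 1) * exp (- ((1 + l) * s))) / Gamma \<nu>" for s
  proof (cases "s > 0")
    case True
    have "s powr (\<nu> + h - 1) = s powr (\<nu> - 1) * s powr h"
      unfolding powr_add[symmetric] by (simp add: algebra_simps)
    moreover have "exp (- ((1 + l) * s)) = exp (- s) * exp (- (l * s))"
      unfolding exp_add[symmetric] by (simp add: algebra_simps)
    ultimately show ?thesis using True by (simp add: gamma_density_def)
  qed (simp add: gamma_density_def)
  have "\<nu> + h > 0" "1 + l > 0" using \<nu> h l by auto
  thus "integrable lborel (\<lambda>s. gamma_density \<nu> s * s powr h * exp (- (l * s)))"
    and "(LBINT s. gamma_density \<nu> s * s powr h * exp (- (l * s)))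
      = Gamma (\<nu> + h) / Gamma \<nu> * (1 + l) powr (- (\<nu> + h))"
    using set_integrable_powr_exp[of "\<nu> + h" "1 + l"] set_integral_powr_exp[of "\<nu> + h" "1 + l"]
    unfolding integrand_eq set_integrable_def set_lebesgue_integral_def by auto
qed

lemma
  assumes \<nu>: "\<nu> > 0"
  shows integrable_gamma_density: "integrable lborel (gamma_density \<nu>)"
    and integral_gamma_density: "(LBINT s. gamma_density \<nu> s) = 1"
proof -
  have integrand_eq: "gamma_density \<nu> s * s powr 0 * exp (- (0 * s)) = gamma_density \<nu> s" for s
    by (simp add: gamma_density_def)
  show "integrable lborel (gamma_density \<nu>)" "(LBINT s. gamma_density \<nu> s) = 1"
    using integrable_gamma_density_moment[OF \<nu>, of 0 0] integral_gamma_density_moment[OF \<nu>, of 0 0]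
      Gamma_real_pos[OF \<nu>]
    unfolding integrand_eq by auto
qed

lemma matern_eq_gaussian_mixture:
  fixes x :: "'a::real_normed_vector"
  assumes \<nu>: "\<nu> > 0" and "\<phi> > 0" and \<kappa>: "\<kappa> = 2 * sqrt \<nu> * \<phi>"
  shows "matern \<nu> \<phi> x = (LBINT s. gamma_density \<nu> s * exp (- (\<kappa>\<^sup>2 / (4 * s) * (norm x)\<^sup>2)))"
proof (cases "x = 0")
  case True
  thus ?thesis using integral_gamma_density[OF \<nu>] by (simp add: matern_def)
next
  case False
  define r where "r = \<kappa> * norm x"
  have r: "r > 0" using False assms by (simp add: r_def)
  have "(LBINT s. gamma_density \<nu> s * exp (- (\<kappa>\<^sup>2 / (4 * s) * (norm x)\<^sup>2)))
    = (LINT s:{0<..}|lborel. s powr (\<nu> - 1) * exp (- s) * exp (- (r\<^sup>2 / (4 * s)))) / Gamma \<nu>"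
    unfolding set_lebesgue_integral_def integral_divide_zero[symmetric]
    by (intro Bochner_Integration.integral_cong) (auto simp: gamma_density_def r_def power_mult_distrib)
  also have "\<dots> = r powr \<nu> * besselK \<nu> r / (Gamma \<nu> * 2 powr (\<nu> - 1))"
    using r unfolding set_integral_powr_exp_eq_besselK[OF \<nu> r]
    by (simp add: powr_divide powr_diff field_simps)
  also have "\<dots> = matern \<nu> \<phi> x"
    using False by (simp add: matern_def Let_def r_def \<kappa>)
  finally show ?thesis ..
qed

definition matern_spectrum :: "real \<Rightarrow> real \<Rightarrow> 'a::euclidean_space \<Rightarrow> real" where
  "matern_spectrum \<nu> \<kappa> \<omega> = (\<kappa>\<^sup>2 * pi) powr (- (DIM('a) / 2)) * (Gamma (\<nu> + DIM('a) / 2) / Gamma \<nu>)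
     * (1 + (norm \<omega>)\<^sup>2 / \<kappa>\<^sup>2) powr (- (\<nu> + DIM('a) / 2))"

lemma integrable_matern:
  assumes \<nu>: "\<nu> > 0" and "\<phi> > 0"
  shows "integrable lborel (matern \<nu> \<phi> :: 'a::euclidean_space \<Rightarrow> real)"
proof -
  define \<kappa> where "\<kappa> = 2 * sqrt \<nu> * \<phi>"
  have \<kappa>: "\<kappa> > 0" using assms by (simp add: \<kappa>_def)
  let ?h = "real DIM('a) / 2"
  have mass_eq: "gamma_density \<nu> s * (pi / (\<kappa>\<^sup>2 / (4 * s))) powr ?h
      = (4 * pi / \<kappa>\<^sup>2) powr ?h * (gamma_density \<nu> s * s powr ?h * exp (- (0 * s)))" for s
  proof (cases "s > 0")
    case True
    have "(pi / (\<kappa>\<^sup>2 / (4 * s))) powr ?h = (4 * pi / \<kappa>\<^sup>2) powr ?h * s powr ?h"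
      using \<kappa> by (subst powr_mult[symmetric]) (auto simp: field_simps)
    thus ?thesis by simp
  qed (simp add: gamma_density_def)
  have "integrable lborel (\<lambda>s. gamma_density \<nu> s * (pi / (\<kappa>\<^sup>2 / (4 * s))) powr ?h)"
    unfolding mass_eq by (intro integrable_mult_right integrable_gamma_density_moment \<nu>) auto
  hence "integrable lborel (\<lambda>x::'a. LBINT s. gamma_density \<nu> s * exp (- (\<kappa>\<^sup>2 / (4 * s) * (norm x)\<^sup>2)))"
    using \<kappa> by (intro integrable_gaussian_mixture gamma_density_nonneg \<nu>)
      (auto simp: gamma_density_def split: split_indicator_asm)
  thus ?thesis
    unfolding matern_eq_gaussian_mixture[OF assms \<kappa>_def, symmetric] .
qed

lemma matern_spectrum_eq_gaussian_mixture:
  fixes \<omega> :: "'a::euclidean_space"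
  assumes \<nu>: "\<nu> > 0" and \<kappa>: "\<kappa> > 0"
  shows "matern_spectrum \<nu> \<kappa> \<omega>
    = (LBINT s. gamma_density \<nu> s * (s / (\<kappa>\<^sup>2 * pi)) powr (DIM('a) / 2) * exp (- (s / \<kappa>\<^sup>2 * (norm \<omega>)\<^sup>2)))"
proof -
  let ?h = "real DIM('a) / 2"
  have "(s / (\<kappa>\<^sup>2 * pi)) powr ?h = (\<kappa>\<^sup>2 * pi) powr (- ?h) * s powr ?h" for s
    using powr_divide[of s "\<kappa>\<^sup>2 * pi" ?h] by (simp only: powr_minus_divide mult_1_left times_divide_eq_left)
  hence "gamma_density \<nu> s * (s / (\<kappa>\<^sup>2 * pi)) powr ?h * exp (- (s / \<kappa>\<^sup>2 * (norm \<omega>)\<^sup>2))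
      = (\<kappa>\<^sup>2 * pi) powr (- ?h) * (gamma_density \<nu> s * s powr ?h * exp (- ((norm \<omega>)\<^sup>2 / \<kappa>\<^sup>2 * s)))" for s
    by (simp only: times_divide_eq_left times_divide_eq_right mult_ac)
  moreover have "(LBINT s. gamma_density \<nu> s * s powr ?h * exp (- ((norm \<omega>)\<^sup>2 / \<kappa>\<^sup>2 * s)))
      = Gamma (\<nu> + ?h) / Gamma \<nu> * (1 + (norm \<omega>)\<^sup>2 / \<kappa>\<^sup>2) powr (- (\<nu> + ?h))"
    by (rule integral_gamma_density_moment[OF \<nu>]) auto
  ultimately show ?thesis
    by (simp only: matern_spectrum_def integral_mult_right_zero mult.assoc)
qed

lemma
  fixes x :: "'a::euclidean_space"
  assumes \<nu>: "\<nu> > 0" and "\<phi> > 0" and \<kappa>_def: "\<kappa> = 2 * sqrt \<nu> * \<phi>"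
  shows integrable_matern_spectrum: "integrable lborel (matern_spectrum \<nu> \<kappa> :: 'a \<Rightarrow> real)"
    and ft_matern_spectrum: "ft (\<lambda>\<omega>. complex_of_real (matern_spectrum \<nu> \<kappa> \<omega>)) x = complex_of_real (matern \<nu> \<phi> x)"
proof -
  have \<kappa>: "\<kappa> > 0" using assms by simp
  let ?h = "real DIM('a) / 2"
  define w where "w s = gamma_density \<nu> s * (s / (\<kappa>\<^sup>2 * pi)) powr ?h" for s
  have [measurable]: "w \<in> borel_measurable borel" unfolding w_def by measurable
  have w_nonneg: "w s \<ge> 0" for s using gamma_density_nonneg[OF \<nu>] by (simp add: w_def)
  have exponent_pos: "s / \<kappa>\<^sup>2 > 0" if "w s \<noteq> 0" for s
    using that \<kappa> by (auto simp: w_def gamma_density_def split: split_indicator_asm)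
  have w_mass: "w s * (pi / (s / \<kappa>\<^sup>2)) powr ?h = gamma_density \<nu> s" for s
  proof (cases "s > 0")
    case True
    have "(s / (\<kappa>\<^sup>2 * pi)) powr ?h * (pi / (s / \<kappa>\<^sup>2)) powr ?h = 1"
      using True \<kappa> by (subst powr_mult[symmetric]) (auto simp: field_simps)
    thus ?thesis by (simp add: w_def mult.assoc)
  qed (simp add: w_def gamma_density_def)
  have mass: "integrable lborel (\<lambda>s. w s * (pi / (s / \<kappa>\<^sup>2)) powr ?h)"
    unfolding w_mass by (rule integrable_gamma_density[OF \<nu>])
  have spectrum_eq: "matern_spectrum \<nu> \<kappa> \<omega> = (LBINT s. w s * exp (- (s / \<kappa>\<^sup>2 * (norm \<omega>)\<^sup>2)))" for \<omega> :: 'a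
    unfolding matern_spectrum_eq_gaussian_mixture[OF \<nu> \<kappa>] w_def ..
  show "integrable lborel (matern_spectrum \<nu> \<kappa> :: 'a \<Rightarrow> real)"
    unfolding spectrum_eq[abs_def] by (rule integrable_gaussian_mixture[OF _ _ w_nonneg exponent_pos mass]) auto
  have "ft (\<lambda>\<omega>. complex_of_real (matern_spectrum \<nu> \<kappa> \<omega>)) x
      = complex_of_real (LBINT s. w s * (pi / (s / \<kappa>\<^sup>2)) powr ?h * exp (- ((norm x)\<^sup>2 / (4 * (s / \<kappa>\<^sup>2)))))"
    unfolding spectrum_eq[abs_def] by (rule ft_gaussian_mixture[OF _ _ w_nonneg exponent_pos mass]) auto
  also have "\<dots> = complex_of_real (matern \<nu> \<phi> x)"
    unfolding w_mass matern_eq_gaussian_mixture[OF \<nu> \<open>\<phi> > 0\<close> \<kappa>_def] by (simp add: mult.commute)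
  finally show "ft (\<lambda>\<omega>. complex_of_real (matern_spectrum \<nu> \<kappa> \<omega>)) x = complex_of_real (matern \<nu> \<phi> x)" .
qed

lemma matern_spectrum_bounds:
  assumes \<nu>: "\<nu> > 0" and \<kappa>: "\<kappa> > 0" and m: "m = \<nu> + real DIM('a::euclidean_space) / 2"
  obtains c C where "c > 0" "\<And>\<omega>::'a. c * (1 + (norm \<omega>)\<^sup>2) powr (- m) \<le> matern_spectrum \<nu> \<kappa> \<omega>"
    "\<And>\<omega>::'a. matern_spectrum \<nu> \<kappa> \<omega> \<le> C * (1 + (norm \<omega>)\<^sup>2) powr (- m)"
proof -
  define A where "A = (\<kappa>\<^sup>2 * pi) powr (- (DIM('a) / 2)) * (Gamma m / Gamma \<nu>)"
  have m_pos: "m > 0" using \<nu> by (simp add: m add_pos_nonneg)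
  have A: "A > 0"
    using \<kappa> Gamma_real_pos[OF \<nu>] Gamma_real_pos[OF m_pos] by (simp add: A_def)
  have spectrum_eq: "matern_spectrum \<nu> \<kappa> \<omega> = A * (1 + 1 / \<kappa>\<^sup>2 * (norm \<omega>)\<^sup>2) powr (- m)" for \<omega> :: 'a
    by (simp add: matern_spectrum_def A_def m)
  show ?thesis
  proof
    show "A * max 1 (1 / \<kappa>\<^sup>2) powr (- m) > 0" using A \<kappa> by simp
    fix \<omega> :: 'a
    show "A * max 1 (1 / \<kappa>\<^sup>2) powr (- m) * (1 + (norm \<omega>)\<^sup>2) powr (- m) \<le> matern_spectrum \<nu> \<kappa> \<omega>"
      unfolding spectrum_eq mult.assoc
      using A \<kappa> m_pos by (intro mult_left_mono powr_one_plus_mult_ge) auto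
    show "matern_spectrum \<nu> \<kappa> \<omega> \<le> A * min 1 (1 / \<kappa>\<^sup>2) powr (- m) * (1 + (norm \<omega>)\<^sup>2) powr (- m)"
      unfolding spectrum_eq mult.assoc
      using A \<kappa> m_pos by (intro mult_left_mono powr_one_plus_mult_le) auto
  qed
qed

lemma isCont_matern_spectrum:
  assumes "\<kappa> \<noteq> 0"
  shows "isCont (matern_spectrum \<nu> \<kappa>) \<omega>"
proof -
  have "1 + (norm \<omega>)\<^sup>2 / \<kappa>\<^sup>2 > 0" by (intro add_pos_nonneg divide_nonneg_nonneg) auto
  thus ?thesis
    unfolding matern_spectrum_def isCont_def using assms by (intro tendsto_intros) auto
qed

section \<open>Native spaces of spectral kernels\<close>

locale spectral_kernel =
  fixes K S :: "'a::euclidean_space \<Rightarrow> real" and m c C :: real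
  assumes K_integrable: "integrable lborel K"
    and S_integrable: "integrable lborel S"
    and isCont_S: "isCont S \<omega>"
    and S_even: "S (- \<omega>) = S \<omega>"
    and ft_S: "ft (\<lambda>\<omega>. complex_of_real (S \<omega>)) x = complex_of_real (K x)"
    and c_pos: "c > 0" and m_pos: "m > 0"
    and S_lower: "c * (1 + (norm \<omega>)\<^sup>2) powr (- m) \<le> S \<omega>"
    and S_upper: "S \<omega> \<le> C * (1 + (norm \<omega>)\<^sup>2) powr (- m)"
begin

lemma K_measurable [measurable]: "K \<in> borel_measurable borel"
  using borel_measurable_integrable[OF K_integrable] by simp

lemma S_measurable [measurable]: "S \<in> borel_measurable borel"
  using borel_measurable_integrable[OF S_integrable] by simp

lemma
  shows weight_mult_S_ge: "c \<le> (1 + (norm \<omega>)\<^sup>2) powr m * S \<omega>"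
    and weight_mult_S_le: "(1 + (norm \<omega>)\<^sup>2) powr m * S \<omega> \<le> C"
proof -
  have "1 + (norm \<omega>)\<^sup>2 > 0" by (simp add: add_pos_nonneg)
  hence cancel: "(1 + (norm \<omega>)\<^sup>2) powr m * (a * (1 + (norm \<omega>)\<^sup>2) powr (- m)) = a" for a
    by (simp add: powr_minus)
  show "c \<le> (1 + (norm \<omega>)\<^sup>2) powr m * S \<omega>" "(1 + (norm \<omega>)\<^sup>2) powr m * S \<omega> \<le> C"
    using mult_left_mono[OF S_lower, of "(1 + (norm \<omega>)\<^sup>2) powr m" \<omega>]
      mult_left_mono[OF S_upper, of "(1 + (norm \<omega>)\<^sup>2) powr m" \<omega>] unfolding cancel by auto
qed

lemma S_pos: "S \<omega> > 0"
  using weight_mult_S_ge[of \<omega>] c_pos by (smt (verit) mult_nonneg_nonpos powr_ge_zero)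

lemma S_le_C: "S \<omega> \<le> C"
proof -
  have "1 * S \<omega> \<le> (1 + (norm \<omega>)\<^sup>2) powr m * S \<omega>"
    using m_pos S_pos[of \<omega>] by (intro mult_right_mono ge_one_powr_ge_zero) auto
  thus ?thesis using weight_mult_S_le[of \<omega>] by linarith
qed

lemma K_even: "K (- x) = K x"
  using ft_uminus[of "\<lambda>\<omega>. complex_of_real (S \<omega>)" x] by (simp add: S_even ft_S)

lemma K_eq_integral: "complex_of_real (K x) = (LBINT \<omega>. complex_of_real (S \<omega>) * cis (\<omega> \<bullet> x))"
  using ft_S[of "- x"] by (simp add: K_even ft_def inner_commute)

lemma norm_K_le: "\<bar>K x\<bar> \<le> (LBINT \<omega>. S \<omega>)"
  using norm_ft_le[of "\<lambda>\<omega>. complex_of_real (S \<omega>)" x] S_pos by (simp add: ft_S less_imp_le)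

lemma ft_K: "ft (\<lambda>x. complex_of_real (K x)) \<omega> = complex_of_real ((2 * pi) ^ DIM('a) * S \<omega>)"
proof -
  have "(LBINT x. ft (\<lambda>\<omega>. complex_of_real (S \<omega>)) x * cis (x \<bullet> (- \<omega>)))
      = (2 * pi) ^ DIM('a) * complex_of_real (S (- \<omega>))"
  proof (rule ft_inversion)
    show "cmod (complex_of_real (S \<omega>)) \<le> C" for \<omega> using S_pos[of \<omega>] S_le_C[of \<omega>] by simp
    show "isCont (\<lambda>\<omega>. complex_of_real (S \<omega>)) (- \<omega>)" using isCont_S by (intro continuous_intros)
  qed (use S_integrable K_integrable in \<open>simp_all add: ft_S[abs_def]\<close>)
  thus ?thesis by (simp add: ft_S S_even ft_def inner_commute)
qed

definition rootS :: "'a \<Rightarrow> complex" where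
  "rootS \<omega> = complex_of_real (sqrt (S \<omega>))"

lemma rootS_measurable [measurable]: "rootS \<in> borel_measurable borel"
  unfolding rootS_def by measurable

lemma rootS_mult_self: "rootS \<omega> * rootS \<omega> = complex_of_real (S \<omega>)"
  using S_pos[of \<omega>] by (simp add: rootS_def flip: of_real_mult)

lemma rootS_nonzero: "rootS \<omega> \<noteq> 0"
  using S_pos[of \<omega>] by (simp add: rootS_def)

lemma norm_rootS_square: "(cmod (rootS \<omega>))\<^sup>2 = S \<omega>"
  using S_pos[of \<omega>] by (simp add: rootS_def)

lemma square_integrable_rootS_cis: "square_integrable lborel (\<lambda>\<omega>. rootS \<omega> * cis (\<omega> \<bullet> x))"
proof -
  have "square_integrable lborel rootS"
    unfolding square_integrable_def norm_rootS_square using S_integrable by simp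
  thus ?thesis by (rule square_integrable_bound[where C = 1]) (auto simp: norm_mult)
qed

lemma square_integrable_rootS_mult:
  assumes p: "square_integrable lborel p"
  shows "square_integrable lborel (\<lambda>\<omega>. rootS \<omega> * p \<omega>)"
proof -
  note [measurable] = p[THEN borel_measurable_square_integrable]
  have "cmod (rootS \<omega>) \<le> sqrt C" for \<omega>
    using S_pos[of \<omega>] S_le_C[of \<omega>] by (simp add: rootS_def)
  thus ?thesis
    by (intro square_integrable_bound[OF p, where C = "sqrt C"]) (auto simp: norm_mult intro!: mult_right_mono)
qed

text \<open>\<open>synth\<close> is the isometry from \<open>L\<^sup>2\<close> onto the complexified native space of the whole space.\<close>

definition synth :: "('a \<Rightarrow> complex) \<Rightarrow> 'a \<Rightarrow> complex" where
  "synth q x = (LBINT \<omega>. q \<omega> * (rootS \<omega> * cis (\<omega> \<bullet> x)))"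

definition symbol :: "(real \<times> 'a) list \<Rightarrow> 'a \<Rightarrow> complex" where
  "symbol l \<omega> = (\<Sum>(b, y)\<leftarrow>l. complex_of_real b * (rootS \<omega> * cis (\<omega> \<bullet> (- y))))"

lemma symbol_Nil [simp]: "symbol [] = (\<lambda>\<omega>. 0)"
  and symbol_Cons [simp]:
    "symbol ((b, y) # l) = (\<lambda>\<omega>. complex_of_real b * (rootS \<omega> * cis (\<omega> \<bullet> (- y))) + symbol l \<omega>)"
  by (simp_all add: symbol_def fun_eq_iff)

lemma symbol_append: "symbol (l @ l') \<omega> = symbol l \<omega> + symbol l' \<omega>"
  by (simp add: symbol_def)

lemma symbol_map_uminus: "symbol (map (\<lambda>(b, y). (- b, y)) l) \<omega> = - symbol l \<omega>"
  by (induction l) auto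

lemma square_integrable_symbol: "square_integrable lborel (symbol l)"
proof (induction l)
  case Nil
  thus ?case by (simp add: square_integrable_def)
next
  case (Cons a l)
  thus ?case
    by (cases a)
       (auto intro!: square_integrable_add square_integrable_mult_left square_integrable_rootS_cis
             simp del: inner_minus_right)
qed

lemma integrable_synth: "square_integrable lborel q \<Longrightarrow> integrable lborel (\<lambda>\<omega>. q \<omega> * (rootS \<omega> * cis (\<omega> \<bullet> x)))"
  by (rule integrable_mult_square_integrable[OF _ square_integrable_rootS_cis])

lemma synth_diff:
  assumes "square_integrable lborel p" and "square_integrable lborel q"
  shows "synth (\<lambda>\<omega>. p \<omega> - q \<omega>) x = synth p x - synth q x"
  unfolding synth_def using assms by (simp add: left_diff_distrib integrable_synth)

lemma integral_mult_cnj_symbol: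
  assumes q: "square_integrable lborel q"
  shows "(LBINT \<omega>. q \<omega> * cnj (symbol l \<omega>)) = (\<Sum>(b, y)\<leftarrow>l. complex_of_real b * synth q y)"
proof (induction l)
  case (Cons a l)
  obtain b y where a: "a = (b, y)" by force
  have "integrable lborel (\<lambda>\<omega>. q \<omega> * cnj (symbol l \<omega>))"
    by (intro integrable_mult_square_integrable q square_integrable_cnj square_integrable_symbol)
  moreover have "q \<omega> * cnj (symbol (a # l) \<omega>)
      = complex_of_real b * (q \<omega> * (rootS \<omega> * cis (\<omega> \<bullet> y))) + q \<omega> * cnj (symbol l \<omega>)" for \<omega>
    by (simp add: a rootS_def cis_cnj algebra_simps)
  ultimately show ?case
    using Cons integrable_synth[OF q, of y] by (simp add: a synth_def)
qed simp

lemma synth_symbol: "synth (symbol l) x = complex_of_real (kexp K l x)"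
proof -
  let ?h = "\<lambda>\<omega>. rootS \<omega> * cis (\<omega> \<bullet> (- x))"
  have "synth ?h y = complex_of_real (K (x - y))" for y
  proof -
    have "cis (\<omega> \<bullet> (y - x)) = cis (\<omega> \<bullet> (- x)) * cis (\<omega> \<bullet> y)" for \<omega>
      by (simp add: cis_mult inner_diff_right)
    hence "synth ?h y = (LBINT \<omega>. complex_of_real (S \<omega>) * cis (\<omega> \<bullet> (y - x)))"
      by (simp add: synth_def rootS_mult_self[symmetric] mult_ac)
    thus ?thesis using K_even[of "x - y"] by (simp flip: K_eq_integral)
  qed
  hence "(LBINT \<omega>. ?h \<omega> * cnj (symbol l \<omega>)) = complex_of_real (kexp K l x)"
    unfolding integral_mult_cnj_symbol[OF square_integrable_rootS_cis] kexp_def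
    by (induction l) auto
  moreover have "cnj (synth (symbol l) x) = (LBINT \<omega>. ?h \<omega> * cnj (symbol l \<omega>))"
    unfolding synth_def Bochner_Integration.integral_cnj[symmetric]
    by (simp add: rootS_def cis_cnj mult_ac)
  ultimately show ?thesis by (metis complex_cnj_cnj complex_cnj_complex_of_real)
qed

lemma kinner_eq_integral: "complex_of_real (kinner K l l') = (LBINT \<omega>. symbol l' \<omega> * cnj (symbol l \<omega>))"
proof -
  have "kinner K l l' = (\<Sum>(b, y)\<leftarrow>l. b * kexp K l' y)"
    by (simp add: kinner_def kexp_def sum_list_const_mult split_def mult.assoc)
  moreover have "complex_of_real (\<Sum>(b, y)\<leftarrow>l. b * kexp K l' y)
      = (\<Sum>(b, y)\<leftarrow>l. complex_of_real b * complex_of_real (kexp K l' y))"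
    by (induction l) auto
  ultimately show ?thesis
    by (simp add: integral_mult_cnj_symbol square_integrable_symbol synth_symbol)
qed

lemma kdist2_eq_L2_norm: "kdist2 K l l' = (L2_norm lborel (\<lambda>\<omega>. symbol l \<omega> - symbol l' \<omega>))\<^sup>2"
proof -
  define d where "d = l @ map (\<lambda>(b, y). (- b, y)) l'"
  have "symbol d = (\<lambda>\<omega>. symbol l \<omega> - symbol l' \<omega>)"
    by (simp add: d_def fun_eq_iff symbol_append symbol_map_uminus)
  moreover have "complex_of_real (kdist2 K l l') = complex_of_real ((L2_norm lborel (symbol d))\<^sup>2)"
    unfolding kdist2_def Let_def d_def[symmetric] kinner_eq_integral power2_L2_norm
      integral_complex_of_real[symmetric] complex_norm_square ..
  ultimately show ?thesis by (simp only: of_real_eq_iff)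
qed

lemma kcauchy_imp_L2_Cauchy:
  assumes "kcauchy K s"
  shows "L2_Cauchy lborel (\<lambda>n. symbol (s n))"
  unfolding L2_Cauchy_def
proof (intro allI impI)
  fix e :: real assume "e > 0"
  hence "e\<^sup>2 > 0" by simp
  then obtain N where N: "\<forall>m\<ge>N. \<forall>n\<ge>N. kdist2 K (s m) (s n) < e\<^sup>2"
    using assms unfolding kcauchy_def by blast
  thus "\<exists>N. \<forall>m\<ge>N. \<forall>n\<ge>N. L2_norm lborel (\<lambda>\<omega>. symbol (s m) \<omega> - symbol (s n) \<omega>) < e"
    unfolding kdist2_eq_L2_norm using \<open>e > 0\<close> by (blast intro: power2_less_imp_less less_imp_le)
qed

definition spectral_span :: "'a set \<Rightarrow> ('a \<Rightarrow> complex) set" where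
  "spectral_span D = {q. square_integrable lborel q \<and>
     (\<exists>s. (\<forall>n. snd ` set (s n) \<subseteq> D) \<and> L2_tendsto lborel (\<lambda>n. symbol (s n)) q)}"

lemma native_space_imp_spectral_span:
  assumes "f \<in> native_space K D"
  obtains q where "q \<in> spectral_span D" "\<And>x. complex_of_real (canon_ext K D f x) = synth q x"
    "\<And>x. x \<in> D \<Longrightarrow> canon_ext K D f x = f x"
proof -
  define s where "s = (SOME s. approx_seq K D f s)"
  have s: "approx_seq K D f s"
    using assms someI_ex[of "approx_seq K D f"] unfolding s_def native_space_def by simp
  hence "L2_Cauchy lborel (\<lambda>n. symbol (s n))"
    by (intro kcauchy_imp_L2_Cauchy) (simp add: approx_seq_def)
  then obtain q where q: "square_integrable lborel q" "L2_tendsto lborel (\<lambda>n. symbol (s n)) q"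
    by (rule lborel.L2_complete[OF square_integrable_symbol])
  have synth_lim: "(\<lambda>n. complex_of_real (kexp K (s n) x)) \<longlonglongrightarrow> synth q x" for x
    unfolding synth_symbol[symmetric] synth_def
    by (rule tendsto_integral_mult_L2[OF square_integrable_symbol q(1) square_integrable_rootS_cis q(2)])
  have kexp_lim: "(\<lambda>n. kexp K (s n) x) \<longlonglongrightarrow> Re (synth q x)" for x
    using tendsto_Re[OF synth_lim[of x]] by simp
  have canon_ext_eq: "canon_ext K D f x = Re (synth q x)" for x
    unfolding canon_ext_def Let_def s_def[symmetric] by (rule limI[OF kexp_lim])
  show ?thesis
  proof
    show "q \<in> spectral_span D"
      using q s unfolding spectral_span_def approx_seq_def by blast
    show "complex_of_real (canon_ext K D f x) = synth q x" for x
      unfolding canon_ext_eq by (rule LIMSEQ_unique[OF tendsto_of_real[OF kexp_lim] synth_lim])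
    show "canon_ext K D f x = f x" if "x \<in> D" for x
      unfolding canon_ext_eq using s that by (intro LIMSEQ_unique[OF kexp_lim]) (simp add: approx_seq_def)
  qed
qed

lemma spectral_span_orthogonal:
  assumes q: "q \<in> spectral_span D" and r: "square_integrable lborel r"
    and zero: "\<And>y. y \<in> D \<Longrightarrow> synth r y = 0"
  shows "(LBINT \<omega>. r \<omega> * cnj (q \<omega>)) = 0"
proof -
  obtain s where s: "\<And>n. snd ` set (s n) \<subseteq> D" and lim: "L2_tendsto lborel (\<lambda>n. symbol (s n)) q"
    and q2: "square_integrable lborel q"
    using q unfolding spectral_span_def by blast
  have "(\<Sum>(b, y)\<leftarrow>l. complex_of_real b * synth r y) = 0" if "snd ` set l \<subseteq> D" for l
    using that by (induction l) (auto simp: zero)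
  hence "(LBINT \<omega>. cnj (symbol (s n) \<omega>) * r \<omega>) = 0" for n
    using integral_mult_cnj_symbol[OF r, of "s n"] s by (simp add: mult.commute)
  moreover have "(\<lambda>n. LBINT \<omega>. cnj (symbol (s n) \<omega>) * r \<omega>) \<longlonglongrightarrow> (LBINT \<omega>. cnj (q \<omega>) * r \<omega>)"
    by (intro tendsto_integral_mult_L2 square_integrable_cnj square_integrable_symbol q2 r L2_tendsto_cnj lim)
  ultimately show ?thesis by (simp add: LIMSEQ_const_iff mult.commute)
qed

lemma
  fixes q :: "'a \<Rightarrow> complex"
  defines "weighted \<equiv> \<lambda>\<omega>. (1 + (norm \<omega>)\<^sup>2) powr (2 * m) * (cmod (rootS \<omega> * q \<omega>))\<^sup>2"
  shows weighted_square_ge: "c\<^sup>2 * (cmod (q \<omega> / rootS \<omega>))\<^sup>2 \<le> weighted \<omega>"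
    and weighted_square_le: "weighted \<omega> \<le> C\<^sup>2 * (cmod (q \<omega> / rootS \<omega>))\<^sup>2"
proof -
  have "(cmod (rootS \<omega> * q \<omega>))\<^sup>2 = (S \<omega>)\<^sup>2 * (cmod (q \<omega> / rootS \<omega>))\<^sup>2"
    using S_pos[of \<omega>]
    unfolding norm_mult norm_divide power_mult_distrib power_divide norm_rootS_square
    by (simp add: power2_eq_square[of "S \<omega>"])
  moreover have "(1 + (norm \<omega>)\<^sup>2) powr (2 * m) = ((1 + (norm \<omega>)\<^sup>2) powr m)\<^sup>2"
    using powr_add[of "1 + (norm \<omega>)\<^sup>2" m m] by (simp only: power2_eq_square mult_2)
  ultimately have weighted_eq: "weighted \<omega> = ((1 + (norm \<omega>)\<^sup>2) powr m * S \<omega>)\<^sup>2 * (cmod (q \<omega> / rootS \<omega>))\<^sup>2"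
    by (simp only: weighted_def power_mult_distrib mult.assoc)
  show "c\<^sup>2 * (cmod (q \<omega> / rootS \<omega>))\<^sup>2 \<le> weighted \<omega>"
    unfolding weighted_eq using weight_mult_S_ge[of \<omega>] c_pos by (intro mult_right_mono power_mono) auto
  show "weighted \<omega> \<le> C\<^sup>2 * (cmod (q \<omega> / rootS \<omega>))\<^sup>2"
    unfolding weighted_eq using weight_mult_S_le[of \<omega>] S_pos[of \<omega>] by (intro mult_right_mono power_mono) auto
qed

lemma sobolev_space_synth_iff:
  fixes E :: "'a \<Rightarrow> real"
  assumes q: "square_integrable lborel q" and E: "\<And>x. complex_of_real (E x) = synth q x"
  shows "E \<in> sobolev_space (2 * m) \<longleftrightarrow> square_integrable lborel (\<lambda>\<omega>. q \<omega> / rootS \<omega>)"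
proof -
  note [measurable] = q[THEN borel_measurable_square_integrable]
  let ?p = "\<lambda>\<omega>. rootS \<omega> * q \<omega>"
  let ?weighted = "\<lambda>\<omega>. (1 + (norm \<omega>)\<^sup>2) powr (2 * m) * (cmod (?p \<omega>))\<^sup>2"
  have p: "integrable lborel ?p" "square_integrable lborel ?p"
    using integrable_synth[OF q, of 0] square_integrable_rootS_mult[OF q] by (simp_all add: mult.commute)
  have "complex_of_real (E x) = ft ?p (- x)" for x
    by (simp add: E synth_def ft_def inner_commute mult_ac)
  hence "E \<in> sobolev_space (2 * m) \<longleftrightarrow> integrable lborel ?weighted"
    by (rule sobolev_space_iff_weighted_L2[OF p])
  also have "\<dots> \<longleftrightarrow> integrable lborel (\<lambda>\<omega>. (cmod (q \<omega> / rootS \<omega>))\<^sup>2)"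
  proof
    assume "integrable lborel ?weighted"
    hence "integrable lborel (\<lambda>\<omega>. c\<^sup>2 * (cmod (q \<omega> / rootS \<omega>))\<^sup>2)"
      by (rule Bochner_Integration.integrable_bound)
         (use weighted_square_ge in \<open>auto intro: order_trans[OF _ abs_ge_self]\<close>)
    thus "integrable lborel (\<lambda>\<omega>. (cmod (q \<omega> / rootS \<omega>))\<^sup>2)" using c_pos by simp
  next
    assume "integrable lborel (\<lambda>\<omega>. (cmod (q \<omega> / rootS \<omega>))\<^sup>2)"
    hence "integrable lborel (\<lambda>\<omega>. C\<^sup>2 * (cmod (q \<omega> / rootS \<omega>))\<^sup>2)" by simp
    thus "integrable lborel ?weighted"
      by (rule Bochner_Integration.integrable_bound)
         (use weighted_square_le in \<open>auto intro: order_trans[OF _ abs_ge_self]\<close>)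
  qed
  finally show ?thesis by (simp add: square_integrable_def)
qed

lemma conv_K_eq_synth:
  assumes v: "integrable lborel v"
  shows "conv (\<lambda>x. complex_of_real (K x)) v x = synth (\<lambda>\<omega>. rootS \<omega> * ft v \<omega>) x"
proof -
  let ?S = "\<lambda>\<omega>. complex_of_real (S \<omega>) * cis (\<omega> \<bullet> x)"
  have "ft ?S t = complex_of_real (K (x - t))" for t
    unfolding K_eq_integral ft_def
    by (intro Bochner_Integration.integral_cong) (auto simp: mult.assoc cis_mult inner_diff_right inner_commute)
  hence "conv (\<lambda>x. complex_of_real (K x)) v x = (LBINT t. v t * ft ?S t)"
    by (simp add: dilated_conv_def mult.commute)
  also have "\<dots> = (LBINT \<omega>. ft v \<omega> * ?S \<omega>)"
    by (intro ft_duality[symmetric] v integrable_mult_cis integrable_of_real S_integrable) simp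
  finally show ?thesis
    by (simp add: synth_def rootS_mult_self[symmetric] mult_ac)
qed

lemma spectral_span_eq_rootS_mult_ft:
  assumes q: "q \<in> spectral_span D" and v: "integrable lborel v" "square_integrable lborel v"
    and v_support: "\<And>t. t \<notin> D \<Longrightarrow> v t = 0"
    and synth_eq: "\<And>x. x \<in> D \<Longrightarrow> synth q x = conv (\<lambda>x. complex_of_real (K x)) v x"
  shows "AE \<omega> in lborel. q \<omega> = rootS \<omega> * ft v \<omega>"
proof -
  have q2: "square_integrable lborel q" using q by (simp add: spectral_span_def)
  let ?u = "\<lambda>\<omega>. rootS \<omega> * ft v \<omega>"
  have u: "square_integrable lborel ?u"
    by (intro square_integrable_rootS_mult square_integrable_ft v)
  define r where "r \<omega> = q \<omega> - ?u \<omega>" for \<omega>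
  have r: "square_integrable lborel r" unfolding r_def by (intro square_integrable_diff q2 u)
  have synth_r: "synth r y = 0" if "y \<in> D" for y
    unfolding r_def synth_diff[OF q2 u] using synth_eq[OF that] by (simp add: conv_K_eq_synth[OF v(1)])
  have r_q: "(LBINT \<omega>. r \<omega> * cnj (q \<omega>)) = 0"
    by (rule spectral_span_orthogonal[OF q r synth_r])
  have "(LBINT \<omega>. r \<omega> * cnj (?u \<omega>)) = (LBINT \<omega>. cnj (ft v \<omega>) * (r \<omega> * (rootS \<omega> * cis (\<omega> \<bullet> 0))))"
    by (simp add: rootS_def mult_ac)
  also have "\<dots> = (LBINT x. cnj (v x) * synth r x)"
    unfolding synth_def integral_cnj_ft_mult[OF v(1) integrable_synth[OF r]] by (simp add: mult.assoc)
  also have "\<dots> = 0"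
    using synth_r v_support by (intro integral_eq_zero_AE AE_I2) auto
  finally have r_u: "(LBINT \<omega>. r \<omega> * cnj (?u \<omega>)) = 0" .
  have "complex_of_real ((L2_norm lborel r)\<^sup>2) = (LBINT \<omega>. r \<omega> * cnj (q \<omega>) - r \<omega> * cnj (?u \<omega>))"
    unfolding power2_L2_norm integral_complex_of_real[symmetric] complex_norm_square
    by (intro Bochner_Integration.integral_cong) (auto simp: r_def algebra_simps)
  also have "\<dots> = 0"
    using r_q r_u integrable_mult_square_integrable[OF r square_integrable_cnj[OF q2]]
      integrable_mult_square_integrable[OF r square_integrable_cnj[OF u]]
    by (subst Bochner_Integration.integral_diff) auto
  finally have "L2_norm lborel r = 0" by simp
  hence "AE \<omega> in lborel. r \<omega> = 0" using L2_norm_eq_0_iff_AE[OF r] by simp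
  thus ?thesis by eventually_elim (simp add: r_def)
qed

lemma
  shows integrable_K_reflect: "integrable lborel (\<lambda>t. complex_of_real (K (x - t)))"
    and square_integrable_K_reflect: "square_integrable lborel (\<lambda>t. complex_of_real (K (x - t)))"
proof -
  show K: "integrable lborel (\<lambda>t. complex_of_real (K (x - t)))"
    using K_integrable by (simp add: lborel_integrable_reflect_iff)
  show "square_integrable lborel (\<lambda>t. complex_of_real (K (x - t)))"
    by (rule integrable_bounded_imp_square_integrable[OF K, where B = "LBINT \<omega>. S \<omega>"]) (simp add: norm_K_le)
qed

lemma test_function_ft_bound:
  assumes "test_function m D \<psi>"
  obtains A where "\<And>\<omega>. cmod (ft \<psi> \<omega>) \<le> A * S \<omega>"
proof -
  obtain A where decay: "\<And>\<omega>. cmod (ft \<psi> \<omega>) \<le> A * (1 + (norm \<omega>)\<^sup>2) powr (- m)"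
    using assms unfolding test_function_def by blast
  have "A \<ge> 0" using order_trans[OF norm_ge_zero decay[of 0]] by simp
  have "cmod (ft \<psi> \<omega>) \<le> A / c * S \<omega>" for \<omega>
  proof -
    have "A * (1 + (norm \<omega>)\<^sup>2) powr (- m) = A / c * (c * (1 + (norm \<omega>)\<^sup>2) powr (- m))"
      using c_pos by simp
    also have "\<dots> \<le> A / c * S \<omega>" using \<open>A \<ge> 0\<close> c_pos by (intro mult_left_mono S_lower) auto
    finally show ?thesis using decay[of \<omega>] by linarith
  qed
  thus ?thesis by (rule that)
qed

lemma test_function_imp_synth_eq_0:
  assumes \<psi>: "test_function m D \<psi>"
  shows "square_integrable lborel (\<lambda>\<omega>. ft \<psi> \<omega> / rootS \<omega>)"
    and "y \<in> D \<Longrightarrow> synth (\<lambda>\<omega>. ft \<psi> \<omega> / rootS \<omega>) y = 0"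
proof -
  obtain B where \<psi>1: "integrable lborel \<psi>" and bound: "\<And>x. cmod (\<psi> x) \<le> B"
    and vanishing: "\<And>y. y \<in> D \<Longrightarrow> \<forall>\<^sub>F z in nhds y. \<psi> z = 0"
    using \<psi> unfolding test_function_def by blast
  obtain A where ft_le: "\<And>\<omega>. cmod (ft \<psi> \<omega>) \<le> A * S \<omega>"
    by (rule test_function_ft_bound[OF \<psi>]) (rule that)
  have [measurable]: "\<psi> \<in> borel_measurable borel" using borel_measurable_integrable[OF \<psi>1] by simp
  have ft_\<psi>: "integrable lborel (ft \<psi>)"
  proof (rule Bochner_Integration.integrable_bound)
    show "integrable lborel (\<lambda>\<omega>. A * S \<omega>)" using S_integrable by simp
    show "AE \<omega> in lborel. norm (ft \<psi> \<omega>) \<le> norm (A * S \<omega>)"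
      by (intro AE_I2) (simp only: real_norm_def order_trans[OF ft_le abs_ge_self])
  qed simp
  show "square_integrable lborel (\<lambda>\<omega>. ft \<psi> \<omega> / rootS \<omega>)"
  proof (rule square_integrable_bound[OF square_integrable_rootS_cis[of 0]])
    have "cmod (ft \<psi> \<omega> / rootS \<omega>) \<le> A * cmod (rootS \<omega>)" for \<omega>
    proof -
      have "cmod (ft \<psi> \<omega>) \<le> A * cmod (rootS \<omega>) * cmod (rootS \<omega>)"
        using ft_le[of \<omega>] by (simp only: norm_rootS_square[symmetric] power2_eq_square mult.assoc)
      thus ?thesis
        using rootS_nonzero[of \<omega>] by (simp add: norm_divide pos_divide_le_eq)
    qed
    thus "AE \<omega> in lborel. cmod (ft \<psi> \<omega> / rootS \<omega>) \<le> A * cmod (rootS \<omega> * cis (\<omega> \<bullet> 0))" by simp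
  qed simp
  assume "y \<in> D"
  have "isCont \<psi> y"
    using isCont_cong[OF vanishing[OF \<open>y \<in> D\<close>]] by simp
  hence "(LBINT \<omega>. ft \<psi> \<omega> * cis (\<omega> \<bullet> y)) = (2 * pi) ^ DIM('a) * \<psi> y"
    by (rule ft_inversion[OF \<psi>1 bound _ ft_\<psi>])
  also have "\<psi> y = 0" using eventually_nhds_x_imp_x[OF vanishing[OF \<open>y \<in> D\<close>]] .
  finally show "synth (\<lambda>\<omega>. ft \<psi> \<omega> / rootS \<omega>) y = 0"
    using rootS_nonzero by (simp add: synth_def)
qed

lemma integral_L2_ft_mult_K:
  assumes p: "square_integrable lborel (\<lambda>\<omega>. q \<omega> / rootS \<omega>)" and F: "has_L2_ft (\<lambda>\<omega>. cnj (q \<omega> / rootS \<omega>)) F"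
  shows "(LBINT t. F t * complex_of_real (K (x - t))) = (2 * pi) ^ DIM('a) * cnj (synth q x)"
proof -
  have "ft (\<lambda>t. complex_of_real (K (x - t))) \<omega> = (2 * pi) ^ DIM('a) * (rootS \<omega> * rootS \<omega> * cis (- (\<omega> \<bullet> x)))" for \<omega>
    using ft_reflect[of "\<lambda>t. complex_of_real (K t)" x \<omega>] by (simp add: ft_K S_even rootS_mult_self)
  hence "cnj (q \<omega> / rootS \<omega>) * ft (\<lambda>t. complex_of_real (K (x - t))) \<omega>
      = (2 * pi) ^ DIM('a) * cnj (q \<omega> * (rootS \<omega> * cis (\<omega> \<bullet> x)))" for \<omega>
    using rootS_nonzero[of \<omega>] by (simp add: rootS_def cis_cnj)
  thus ?thesis
    unfolding has_L2_ft_duality[OF F square_integrable_cnj[OF p] integrable_K_reflect square_integrable_K_reflect]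
    by (simp add: synth_def flip: Bochner_Integration.integral_cnj)
qed

text \<open>Conjugating \<open>q / rootS\<close> before the transform turns the bilinear duality into the inner product
  with \<open>q\<close>.\<close>

lemma spectral_span_eq_conv:
  assumes q: "q \<in> spectral_span D" and p: "square_integrable lborel (\<lambda>\<omega>. q \<omega> / rootS \<omega>)" and D: "closed D"
  obtains V where "square_integrable lborel V" "AE t in lborel. t \<notin> D \<longrightarrow> V t = 0"
    "\<And>x. synth q x = conv (\<lambda>x. complex_of_real (K x)) V x"
proof -
  let ?c = "(2 * pi) ^ DIM('a) :: complex"
  obtain F where F: "has_L2_ft (\<lambda>\<omega>. cnj (q \<omega> / rootS \<omega>)) F"
    using has_L2_ft_exists[OF square_integrable_cnj[OF p]] by blast
  hence F2: "square_integrable lborel F" by (simp add: has_L2_ft_def)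
  have F_test: "(LBINT t. F t * \<psi> t) = 0" if \<psi>: "test_function m D \<psi>" for \<psi>
  proof -
    have "integrable lborel \<psi>" "square_integrable lborel \<psi>"
      using \<psi> unfolding test_function_def by (auto intro: integrable_bounded_imp_square_integrable)
    hence "(LBINT t. F t * \<psi> t) = (LBINT \<omega>. ft \<psi> \<omega> / rootS \<omega> * cnj (q \<omega>))"
      by (simp add: has_L2_ft_duality[OF F square_integrable_cnj[OF p]] rootS_def mult.commute)
    also have "\<dots> = 0"
      by (rule spectral_span_orthogonal[OF q test_function_imp_synth_eq_0[OF \<psi>]])
    finally show ?thesis .
  qed
  show ?thesis
  proof
    show "square_integrable lborel (\<lambda>t. 1 / ?c * cnj (F t))"
      by (intro square_integrable_mult_left square_integrable_cnj F2)
    have "AE t in lborel. t \<notin> D \<longrightarrow> F t = 0"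
      using m_pos by (intro AE_eq_0_off_closed_if_test_integrals_eq_0[OF F2 _ D F_test]) auto
    thus "AE t in lborel. t \<notin> D \<longrightarrow> 1 / ?c * cnj (F t) = 0"
      by eventually_elim simp
    show "synth q x = conv (\<lambda>x. complex_of_real (K x)) (\<lambda>t. 1 / ?c * cnj (F t)) x" for x
    proof -
      have "conv (\<lambda>x. complex_of_real (K x)) (\<lambda>t. 1 / ?c * cnj (F t)) x
          = 1 / ?c * cnj (LBINT t. F t * complex_of_real (K (x - t)))"
        unfolding dilated_conv_def Bochner_Integration.integral_cnj[symmetric] integral_mult_right_zero[symmetric]
        by (simp add: mult_ac)
      thus ?thesis unfolding integral_L2_ft_mult_K[OF p F] by simp
    qed
  qed
qed

lemma integral_equation_imp_sobolev:
  fixes v :: "'a \<Rightarrow> real"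
  assumes D: "compact D" and f: "f \<in> native_space K D"
    and v: "set_borel_measurable lebesgue D v" "set_integrable lebesgue D (\<lambda>t. (v t)\<^sup>2)"
    and equation: "\<And>x. x \<in> D \<Longrightarrow> f x = (LINT t:D|lebesgue. K (x - t) * v t)"
  shows "canon_ext K D f \<in> sobolev_space (2 * m)"
proof -
  obtain q where q: "q \<in> spectral_span D" and ext: "\<And>x. complex_of_real (canon_ext K D f x) = synth q x"
    and ext_f: "\<And>x. x \<in> D \<Longrightarrow> canon_ext K D f x = f x"
    by (rule native_space_imp_spectral_span[OF f]) (rule that)
  have q2: "square_integrable lborel q" using q by (simp add: spectral_span_def)
  obtain u :: "'a \<Rightarrow> real" where [measurable]: "u \<in> borel_measurable borel" and u_support: "\<And>t. t \<notin> D \<Longrightarrow> u t = 0"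
    and u_eq: "AE t in lebesgue. indicator D t * v t = u t"
    and u: "integrable lborel (\<lambda>t. complex_of_real (u t))" "square_integrable lborel (\<lambda>t. complex_of_real (u t))"
    by (rule compact_L2_ex_borel[OF D v]) (rule that)
  have "synth q x = conv (\<lambda>x. complex_of_real (K x)) (\<lambda>t. complex_of_real (u t)) x" if x: "x \<in> D" for x
  proof -
    have v_meas: "(\<lambda>t. indicator D t * v t) \<in> borel_measurable lebesgue"
      using v(1) by (simp add: set_borel_measurable_def)
    have K_meas: "(\<lambda>t. K (x - t)) \<in> borel_measurable lebesgue"
      by (rule measurable_completion) simp
    have "f x = (\<integral>t. K (x - t) * (indicator D t * v t) \<partial>lebesgue)"
      using equation[OF x] by (simp add: set_lebesgue_integral_def mult_ac)
    also have "\<dots> = (\<integral>t. K (x - t) * u t \<partial>lebesgue)"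
    proof (rule integral_cong_AE)
      show "AE t in lebesgue. K (x - t) * (indicator D t * v t) = K (x - t) * u t"
        using u_eq by eventually_elim simp
      show "(\<lambda>t. K (x - t) * u t) \<in> borel_measurable lebesgue"
        by (rule measurable_completion) simp
    qed (use v_meas K_meas in measurable)
    also have "\<dots> = (LBINT t. K (x - t) * u t)"
      by (rule integral_completion) simp
    finally have "complex_of_real (f x) = (LBINT t. complex_of_real (K (x - t) * u t))"
      by (simp only: integral_complex_of_real)
    thus ?thesis using ext[of x] ext_f[OF x] by (simp add: dilated_conv_def)
  qed
  hence "AE \<omega> in lborel. q \<omega> = rootS \<omega> * ft (\<lambda>t. complex_of_real (u t)) \<omega>"
    using u_support by (intro spectral_span_eq_rootS_mult_ft[OF q u]) auto
  hence "AE \<omega> in lborel. ft (\<lambda>t. complex_of_real (u t)) \<omega> = q \<omega> / rootS \<omega>"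
    by eventually_elim (simp add: rootS_nonzero)
  hence "square_integrable lborel (\<lambda>\<omega>. q \<omega> / rootS \<omega>)"
    using q2[THEN borel_measurable_square_integrable]
    by (intro square_integrable_cong_AE[OF square_integrable_ft[OF u]]) auto
  thus ?thesis using sobolev_space_synth_iff[OF q2 ext] by blast
qed

lemma sobolev_imp_integral_equation:
  assumes D: "closed D" and f: "f \<in> native_space K D"
    and sobolev: "canon_ext K D f \<in> sobolev_space (2 * m)"
  shows "\<exists>v. set_borel_measurable lebesgue D v \<and> set_integrable lebesgue D (\<lambda>t. (v t)\<^sup>2) \<and>
    (\<forall>x\<in>D. f x = (LINT t:D|lebesgue. K (x - t) * v t))"
proof -
  obtain q where q: "q \<in> spectral_span D" and ext: "\<And>x. complex_of_real (canon_ext K D f x) = synth q x"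
    and ext_f: "\<And>x. x \<in> D \<Longrightarrow> canon_ext K D f x = f x"
    by (rule native_space_imp_spectral_span[OF f]) (rule that)
  have "square_integrable lborel q" using q by (simp add: spectral_span_def)
  hence "square_integrable lborel (\<lambda>\<omega>. q \<omega> / rootS \<omega>)"
    using sobolev sobolev_space_synth_iff[OF _ ext] by blast
  then obtain V where V: "square_integrable lborel V" and V_support: "AE t in lborel. t \<notin> D \<longrightarrow> V t = 0"
    and synth_eq: "\<And>x. synth q x = conv (\<lambda>x. complex_of_real (K x)) V x"
    by (rule spectral_span_eq_conv[OF q _ D]) (rule that)
  note [measurable] = V[THEN borel_measurable_square_integrable]
  have [measurable]: "D \<in> sets borel" using D by simp
  define v where "v t = Re (V t)" for t
  have [measurable]: "v \<in> borel_measurable borel" unfolding v_def by measurable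
  show ?thesis
  proof (intro exI[of _ v] conjI ballI)
    show "set_borel_measurable lebesgue D v"
      unfolding set_borel_measurable_def by (rule measurable_completion) measurable
    have "integrable lborel (\<lambda>t. (v t)\<^sup>2)"
    proof (rule Bochner_Integration.integrable_bound[OF integrable_norm_square[OF V]])
      show "AE t in lborel. norm ((v t)\<^sup>2) \<le> norm ((cmod (V t))\<^sup>2)"
        by (simp add: v_def cmod_power2)
    qed simp
    thus "set_integrable lebesgue D (\<lambda>t. (v t)\<^sup>2)"
      unfolding set_integrable_def
      by (subst integrable_completion) (measurable, intro integrable_mult_indicator, simp_all)
    fix x assume x: "x \<in> D"
    have "f x = Re (synth q x)" using ext[of x, symmetric] ext_f[OF x] by simp
    also have "\<dots> = (LBINT t. Re (complex_of_real (K (x - t)) * V t))"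
      unfolding synth_eq dilated_conv_def scaleR_one
      by (intro integral_Re[symmetric] integrable_mult_square_integrable square_integrable_K_reflect V)
    also have "\<dots> = (LBINT t. indicator D t *\<^sub>R (K (x - t) * v t))"
      using V_support by (intro integral_cong_AE) (auto simp: v_def split: split_indicator)
    also have "\<dots> = (LINT t:D|lebesgue. K (x - t) * v t)"
      unfolding set_lebesgue_integral_def by (rule integral_completion[symmetric]) measurable
    finally show "f x = (LINT t:D|lebesgue. K (x - t) * v t)" .
  qed
qed

end

lemma matern_spectral_kernel:
  fixes m \<phi> :: real
  defines "\<nu> \<equiv> m - real DIM('a::euclidean_space) / 2"
  assumes m: "m > real DIM('a) / 2" and \<phi>: "\<phi> > 0"
  obtains S c C where "spectral_kernel (matern \<nu> \<phi> :: 'a \<Rightarrow> real) S m c C"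
proof -
  define \<kappa> where "\<kappa> = 2 * sqrt \<nu> * \<phi>"
  have \<nu>: "\<nu> > 0" using m by (simp add: \<nu>_def)
  hence \<kappa>: "\<kappa> > 0" using \<phi> by (simp add: \<kappa>_def)
  have "m = \<nu> + real DIM('a) / 2" by (simp add: \<nu>_def)
  then obtain c C where c_pos: "c > 0" and lower: "\<And>\<omega>::'a. c * (1 + (norm \<omega>)\<^sup>2) powr (- m) \<le> matern_spectrum \<nu> \<kappa> \<omega>"
    and upper: "\<And>\<omega>::'a. matern_spectrum \<nu> \<kappa> \<omega> \<le> C * (1 + (norm \<omega>)\<^sup>2) powr (- m)"
    by (rule matern_spectrum_bounds[OF \<nu> \<kappa>]) (rule that)
  have "spectral_kernel (matern \<nu> \<phi> :: 'a \<Rightarrow> real) (matern_spectrum \<nu> \<kappa>) m c C"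
  proof
    show "m > 0" using m by (rule le_less_trans[rotated]) simp
    show "matern_spectrum \<nu> \<kappa> (- \<omega>) = matern_spectrum \<nu> \<kappa> \<omega>" for \<omega> :: 'a
      by (simp add: matern_spectrum_def)
    show "isCont (matern_spectrum \<nu> \<kappa>) \<omega>" for \<omega> :: 'a
      using \<kappa> by (intro isCont_matern_spectrum) simp
  qed (use integrable_matern[OF \<nu> \<phi>] integrable_matern_spectrum[OF \<nu> \<phi> \<kappa>_def] ft_matern_spectrum[OF \<nu> \<phi> \<kappa>_def]
      c_pos lower upper in auto)
  thus ?thesis by (rule that)
qed

theorem theorem2p2:
  fixes \<Omega> :: "'a::euclidean_space set" and m \<phi> :: real and f :: "'a \<Rightarrow> real"
  assumes "convex \<Omega>" and "compact \<Omega>"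
    and "m > real DIM('a) / 2" and "\<phi> > 0"
    and "f \<in> native_space (matern (m - real DIM('a) / 2) \<phi>) \<Omega>"
  shows "(\<exists>v :: 'a \<Rightarrow> real.
            set_borel_measurable lebesgue \<Omega> v \<and>
            set_integrable lebesgue \<Omega> (\<lambda>t. (v t)\<^sup>2) \<and>
            (\<forall>x\<in>\<Omega>. f x = (LINT t:\<Omega>|lebesgue. matern (m - real DIM('a) / 2) \<phi> (x - t) * v t)))
         \<longleftrightarrow> canon_ext (matern (m - real DIM('a) / 2) \<phi>) \<Omega> f \<in> sobolev_space (2 * m)"
proof -
  obtain S c C where "spectral_kernel (matern (m - real DIM('a) / 2) \<phi> :: 'a \<Rightarrow> real) S m c C"
    by (rule matern_spectral_kernel[OF assms(3,4)])
  then interpret spectral_kernel "matern (m - real DIM('a) / 2) \<phi> :: 'a \<Rightarrow> real" S m c C .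
  show ?thesis
    using integral_equation_imp_sobolev[OF assms(2,5)]
      sobolev_imp_integral_equation[OF compact_imp_closed[OF assms(2)] assms(5)] by blast
qed

end
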